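(* Let $n\in\mathbb{N}$ and let $g,h\in L^2(\mathbb{R})$, $g\neq0$, be such that $g_th\in L^2(\mathbb{R})$ for every $t\in\mathbb{R}$, where $g_t(t')=g(t'-t)$. Then $$h(t)=\frac{1}{\langle g,g\rangle}\int_{-\infty}^{\infty}\overline{g(t-\tau)}\,\Phi_n\mathcal{V}_g^{(n)}h(-t,\tau)\,d\tau,$$ where $\Phi_n\mathcal{V}_g^{(n)}h(-t,\tau)$ denotes $\Phi_n$ applied to the function $f_\tau(\omega)=\mathcal{V}_g^{(n)}h(\omega,\tau)$ (with $\tau$ fixed), evaluated at $-t$.
   Context: $\Phi_n$ is the unitary operator on $L^2(\mathbb{R})$ defined as follows. $c_n(\eta)=\sum_{l\ge0}\frac{(-1)^l n}{(2n)^{2l+\frac{1}{2n}}\Gamma(l+\frac{1}{2n})l!}\eta^{2nl}$; $\mathcal{H}$ is the Hilbert transform ($\mathcal{H}f(x)=\frac1\pi\,\mathrm{p.v.}\int\frac{f(t)}{x-t}dt$ on $L^2(\mathbb{R})$, extended to tempered distributions); $s_n=-\mathcal{H}c_n$, $\varphi_n=c_n+is_n$. With $\phi=\mathbf{1}_{[0,1]}$, $\phi_{j,k}(t)=\phi(2^jt-k)$, $V_j$ the finite linear span of $\{\phi_{j,k}\}_{k\in\mathbb{Z}}$ and $V_j^+$ its even elements, on $D_j=V_j^+\oplus\mathcal{H}(V_j^+)$ one sets $\Phi_n g(\omega)=\int\varphi_n(\omega t)g(t)\,dt$ (for odd $g\in\mathcal{H}(V_j^+)$ understood distributionally, equal to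 $i\operatorname{sgn}(\omega)\int c_n(\omega t)(\mathcal{H}g)(t)dt$), and $\Phi_n$ is the bounded extension to $L^2(\mathbb{R})$ from the dense set $\bigcup_jD_j$. The short-time $\Phi_n$ transform of $h$ with window $g$ (for $g,h\in L^2$ with $g_th\in L^2$) is $\mathcal{V}_g^{(n)}h(\omega,t)=\Phi_n(g_th)(\omega)$. *)

theory Defs
  imports "HOL-Analysis.Analysis"
begin

definition sq_int :: "(real \<Rightarrow> complex) \<Rightarrow> bool" where
  "sq_int f \<longleftrightarrow> f \<in> borel_measurable lborel \<and> integrable lborel (\<lambda>x. (cmod (f x))\<^sup>2)"

definition L2_norm :: "(real \<Rightarrow> complex) \<Rightarrow> real" where
  "L2_norm f = sqrt (LINT x|lborel. (cmod (f x))\<^sup>2)"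

definition L2_inner :: "(real \<Rightarrow> complex) \<Rightarrow> (real \<Rightarrow> complex) \<Rightarrow> complex" where
  "L2_inner f g = (LINT x|lborel. f x * cnj (g x))"

definition c_kernel :: "nat \<Rightarrow> real \<Rightarrow> real" where
  "c_kernel n \<eta> = (\<Sum>l. ((-1) ^ l * real n /
        ((2 * real n) powr (2 * real l + 1 / (2 * real n)) * Gamma (real l + 1 / (2 * real n)) * fact l))
        * \<eta> ^ (2 * n * l))"

definition hilbert :: "(real \<Rightarrow> complex) \<Rightarrow> real \<Rightarrow> complex" where
  "hilbert f x = complex_of_real (1 / pi) *
     Lim (at_right 0) (\<lambda>\<epsilon>::real. LINT t|lborel.
        indicator {t. \<epsilon> < \<bar>x - t\<bar>} t *\<^sub>R (f t / complex_of_real (x - t)))"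

definition haar_phi :: "int \<Rightarrow> int \<Rightarrow> real \<Rightarrow> complex" where
  "haar_phi j k t = indicator {0..1::real} ((2::real) powr real_of_int j * t - real_of_int k)"

definition V_space :: "int \<Rightarrow> (real \<Rightarrow> complex) set" where
  "V_space j = {u. \<exists>K a. finite K \<and> (\<forall>t. u t = (\<Sum>k\<in>K. a k * haar_phi j k t))}"

definition V_plus :: "int \<Rightarrow> (real \<Rightarrow> complex) set" where
  "V_plus j = {u \<in> V_space j. AE t in lborel. u (- t) = u t}"

text \<open>Prescribed values on D_j = V_j^+ + H(V_j^+):
  for even u: Phi u(w) = int c_n(w t) u(t) dt;
  for odd g = H v: Phi g(w) = i sgn(w) int c_n(w t) (H g)(t) dt.\<close>
definition Phi_on_D :: "nat \<Rightarrow> (real \<Rightarrow> complex) \<Rightarrow> (real \<Rightarrow> complex) \<Rightarrow> real \<Rightarrow> complex" where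
  "Phi_on_D n u v \<omega> =
     (LINT t|lborel. complex_of_real (c_kernel n (\<omega> * t)) * u t)
   + \<i> * complex_of_real (sgn \<omega>) *
     (LINT t|lborel. complex_of_real (c_kernel n (\<omega> * t)) * hilbert (hilbert v) t)"

text \<open>T is a bounded linear operator on L^2 (acting on representatives, respecting a.e. equality)
  that agrees with the prescribed formula on every D_j. Since the union of the D_j is dense,
  this determines T uniquely (as an operator on L^2).\<close>
definition is_Phi :: "nat \<Rightarrow> ((real \<Rightarrow> complex) \<Rightarrow> (real \<Rightarrow> complex)) \<Rightarrow> bool" where
  "is_Phi n T \<longleftrightarrow>
     (\<forall>f. sq_int f \<longrightarrow> sq_int (T f)) \<and>
     (\<forall>f g. sq_int f \<and> sq_int g \<and> (AE x in lborel. f x = g x)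
        \<longrightarrow> (AE \<omega> in lborel. T f \<omega> = T g \<omega>)) \<and>
     (\<forall>f g a b. sq_int f \<and> sq_int g
        \<longrightarrow> (AE \<omega> in lborel. T (\<lambda>x. a * f x + b * g x) \<omega> = a * T f \<omega> + b * T g \<omega>)) \<and>
     (\<exists>C. \<forall>f. sq_int f \<longrightarrow> L2_norm (T f) \<le> C * L2_norm f) \<and>
     (\<forall>j u v. u \<in> V_plus j \<and> v \<in> V_plus j \<longrightarrow>
        (AE \<omega> in lborel. T (\<lambda>t. u t + hilbert v t) \<omega> = Phi_on_D n u v \<omega>))"

definition Phi :: "nat \<Rightarrow> (real \<Rightarrow> complex) \<Rightarrow> (real \<Rightarrow> complex)" where
  "Phi n = (SOME T. is_Phi n T)"

definition STPhi :: "nat \<Rightarrow> (real \<Rightarrow> complex) \<Rightarrow> (real \<Rightarrow> complex) \<Rightarrow> real \<Rightarrow> real \<Rightarrow> complex" where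
  "STPhi n g h \<omega> t = Phi n (\<lambda>t'. g (t' - t) * h t') \<omega>"

end

theory Submission
  imports Defs
begin

text \<open>
  Splitting functions on the line into even and odd parts turns \<open>\<Phi>\<^sub>n\<close> into operators on
  \<open>L\<^sup>2(0, \<infinity>)\<close>: it acts as \<open>A\<close> on even parts and as \<open>- i W A\<close> on odd parts, where \<open>A\<close> is the
  integral operator with kernel \<open>2 c\<^sub>n(\<omega> t)\<close> and \<open>W\<close> is the Hilbert transform from even to odd
  functions.  By Weber's integral \<open>A\<close> maps \<open>exp (- s x\<^sup>2\<^sup>n)\<close> to a multiple of
  \<open>exp (- x\<^sup>2\<^sup>n / (4 n\<^sup>2 s))\<close>, which makes it a self-adjoint isometric involution; \<open>W\<close> is an isometry
  by an explicit computation on indicators of intervals.  As \<open>W\<close> commutes with dilations and the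
  dual pairs of Gaussians are dilates of each other, \<open>W A W = A\<close>.  Hence \<open>\<Phi>\<^sub>n \<circ> \<Phi>\<^sub>n\<close> is the
  reflection \<open>f(x) \<mapsto> f(- x)\<close>, and the inversion formula becomes
  \<open>\<integral> \<bar>g(t - \<tau>)\<bar>\<^sup>2 h(t) d\<tau> = \<langle>g, g\<rangle> h(t)\<close>.
\<close>

section \<open>Extension of isometries\<close>

text \<open>The series gives \<open>c_kernel\<close> only a growth bound of the type exp (C x^(2n)),
  which does not make the integral defining A converge on general square integrable functions. So A
  and W are built abstractly: an isometry is determined by its values on a family with dense span,
  and only equality of Gram matrices has to be checked. For A the family consists of generalised
  Gaussians, where the Gamma factors of the series cancel against the moments; for W it consists of
  the intervals (0, a], where the transform is an explicit logarithm. The families must then be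
  linked, since the spaces D_j involve A on intervals: this is \<open>cos_op_chi\<close>. On even
  steps the Hilbert transform squares to -1, so an odd g = W v is prescribed to go to - i A v. By W
  A W = A this is - i W A g, whence the form of the operator on odd parts; its square is - W A W A =
  - A A = -1. The same relation makes W surjective, on which the uniqueness of the bounded extension
  rests.\<close>

lemma subspace_closure:
  fixes S :: "'a::real_normed_vector set"
  assumes "subspace S"
  shows "subspace (closure S)"
  unfolding subspace_def
proof (intro conjI ballI allI)
  show "0 \<in> closure S"
    using assms closure_subset subspace_0 by blast
next
  fix x y assume "x \<in> closure S" "y \<in> closure S"
  then obtain X Y where "\<And>k. X k \<in> S" "X \<longlonglongrightarrow> x" "\<And>k. Y k \<in> S" "Y \<longlonglongrightarrow> y"
    unfolding closure_sequential by blast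
  then have "\<And>k. X k + Y k \<in> S" "(\<lambda>k. X k + Y k) \<longlonglongrightarrow> x + y"
    using assms by (auto intro: subspace_add tendsto_add)
  then show "x + y \<in> closure S"
    unfolding closure_sequential by (intro exI[of _ "\<lambda>k. X k + Y k"]) blast
next
  fix c x assume "x \<in> closure S"
  then obtain X where "\<And>k. X k \<in> S" "X \<longlonglongrightarrow> x"
    unfolding closure_sequential by blast
  then have "\<And>k. c *\<^sub>R X k \<in> S" "(\<lambda>k. c *\<^sub>R X k) \<longlonglongrightarrow> c *\<^sub>R x"
    using assms by (auto intro: subspace_scale tendsto_scaleR)
  then show "c *\<^sub>R x \<in> closure S"
    unfolding closure_sequential by (intro exI[of _ "\<lambda>k. c *\<^sub>R X k"]) blast
qed

text \<open>The graph is extended instead of the map: \<open>R\<close> is the closed span of the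
  pairs (e i, e' i). Equal Gram matrices give both components of a pair in \<open>R\<close> the same
  norm, so \<open>R\<close> is single valued and every linear relation among the \<open>e i\<close>
  persists among the \<open>e' i\<close>. Density, together with completeness of the target, makes
  \<open>R\<close> total.\<close>

lemma isometry_extension:
  fixes e :: "'i \<Rightarrow> 'a::{real_inner,complete_space}"
    and e' :: "'i \<Rightarrow> 'b::{real_inner,complete_space}"
  assumes inner_eq: "\<And>i j. i \<in> I \<Longrightarrow> j \<in> I \<Longrightarrow> inner (e' i) (e' j) = inner (e i) (e j)"
    and dense: "closure (span (e ` I)) = UNIV"
  obtains U where "linear U" "\<And>x y. inner (U x) (U y) = inner x y" "\<And>i. i \<in> I \<Longrightarrow> U (e i) = e' i"
proof -
  define S where "S = (\<lambda>i. (e i, e' i)) ` I"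
  define R where "R = closure (span S)"
  have iso_span: "inner (fst p) (fst q) = inner (snd p) (snd q)" if "p \<in> span S" "q \<in> span S" for p q
    using that(1)
  proof (induction p rule: span_induct_alt)
    case base
    then show ?case by simp
  next
    case (step c p r)
    have "inner (fst p) (fst q) = inner (snd p) (snd q)" using that(2)
    proof (induction q rule: span_induct_alt)
      case base
      then show ?case by simp
    next
      case (step d q r)
      then show ?case
        using \<open>p \<in> S\<close> inner_eq by (auto simp: S_def inner_add_right)
    qed
    with step show ?case by (simp add: inner_add_left)
  qed
  have subR: "subspace R"
    unfolding R_def by (intro subspace_closure subspace_span)
  have norm_span: "norm (fst p) = norm (snd p)" if "p \<in> span S" for p
    using iso_span[OF that that] by (simp add: norm_eq_sqrt_inner)
  have norm_R: "norm (fst p) = norm (snd p)" if "p \<in> R" for p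
  proof -
    have "closed {p :: 'a \<times> 'b. norm (fst p) = norm (snd p)}"
      by (intro closed_Collect_eq continuous_intros)
    then have "R \<subseteq> {p. norm (fst p) = norm (snd p)}"
      unfolding R_def by (intro closure_minimal) (use norm_span in auto)
    with that show ?thesis by auto
  qed
  have fst_span: "fst ` span S = span (e ` I)"
    by (simp add: S_def linear_span_image[OF linear_fst, symmetric] image_image)
  have ex: "\<exists>y. (x, y) \<in> R" for x
  proof -
    have "x \<in> closure (fst ` span S)" using dense fst_span by simp
    then obtain X where X: "\<And>k. X k \<in> fst ` span S" "X \<longlonglongrightarrow> x"
      using closure_sequential by blast
    from X(1) have "\<exists>y. (X k, y) \<in> span S" for k
      by (force simp: image_iff)
    then obtain Y where Y: "\<And>k. (X k, Y k) \<in> span S" by metis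
    have "dist (Y j) (Y k) = dist (X j) (X k)" for j k
      using norm_span[OF span_diff[OF Y[of j] Y[of k]]] by (simp add: dist_norm)
    moreover have "Cauchy X" using X(2) by (rule LIMSEQ_imp_Cauchy)
    ultimately have "Cauchy Y" by (simp add: Cauchy_def)
    then obtain y where "Y \<longlonglongrightarrow> y" using Cauchy_convergent_iff convergent_def by blast
    with X(2) have "(\<lambda>k. (X k, Y k)) \<longlonglongrightarrow> (x, y)" by (rule tendsto_Pair)
    then have "(x, y) \<in> R" unfolding R_def closure_sequential
      using Y by (intro exI[of _ "\<lambda>k. (X k, Y k)"]) blast
    then show ?thesis ..
  qed
  have uniq: "y = z" if "(x, y) \<in> R" "(x, z) \<in> R" for x y z
    using norm_R[OF subspace_diff[OF subR that]] by simp
  define U where "U x = (THE y. (x, y) \<in> R)" for x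
  have UR: "(x, U x) \<in> R" for x
    unfolding U_def using ex[of x] uniq by (metis theI')
  have U_eq: "U x = y" if "(x, y) \<in> R" for x y
    using uniq[OF UR that] .
  have lin: "linear U"
  proof (rule linearI)
    show "U (x + y) = U x + U y" for x y
      using subspace_add[OF subR UR[of x] UR[of y]] by (intro U_eq) simp
    show "U (c *\<^sub>R x) = c *\<^sub>R U x" for c x
      using subspace_scale[OF subR UR[of x]] by (intro U_eq) simp
  qed
  have norm_U: "norm (U x) = norm x" for x
    using norm_R[OF UR[of x]] by simp
  show ?thesis
  proof
    show "linear U" by (fact lin)
    show "inner (U x) (U y) = inner x y" for x y
      by (simp add: dot_norm norm_U flip: linear_add[OF lin])
    show "U (e i) = e' i" if "i \<in> I" for i
      using that by (intro U_eq) (auto simp: R_def S_def intro!: closure_subset[THEN subsetD] span_base)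
  qed
qed

lemma inner_eq_imp_eq:
  fixes x y :: "'a::real_inner"
  assumes "closure (span S) = UNIV" "\<And>s. s \<in> S \<Longrightarrow> inner x s = inner y s"
  shows "x = y"
proof -
  have "closed {z. inner (x - y) z = 0}"
    by (intro closed_Collect_eq continuous_intros)
  moreover have "span S \<subseteq> {z. inner (x - y) z = 0}"
    using assms(2) by (intro span_minimal)
      (auto simp: subspace_def inner_add_right inner_diff_left)
  ultimately have "closure (span S) \<subseteq> {z. inner (x - y) z = 0}"
    by (intro closure_minimal)
  then have "inner (x - y) (x - y) = 0" unfolding assms(1) by blast
  then show ?thesis by simp
qed

lemma bounded_linear_eq_on_dense:
  fixes f g :: "'a::real_normed_vector \<Rightarrow> 'b::real_normed_vector"
  assumes "closure (span S) = UNIV" "bounded_linear f" "bounded_linear g"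
    "\<And>s. s \<in> S \<Longrightarrow> f s = g s"
  shows "f x = g x"
proof -
  have "closed {z. f z = g z}"
    using assms(2,3) by (intro closed_Collect_eq linear_continuous_on)
  moreover have "span S \<subseteq> {z. f z = g z}"
    using assms(2,3,4) by (intro span_minimal)
      (auto simp: subspace_def bounded_linear.linear linear_add linear_scale linear_0)
  ultimately have "closure (span S) \<subseteq> {z. f z = g z}"
    by (intro closure_minimal)
  with assms(1) show ?thesis by auto
qed

lemma isometry_bounded_linear:
  fixes U :: "'a::real_inner \<Rightarrow> 'b::real_inner"
  assumes "linear U" "\<And>x y. inner (U x) (U y) = inner x y"
  shows "bounded_linear U"
proof (rule bounded_linear_intro[where K = 1])
  show "U (x + y) = U x + U y" "U (c *\<^sub>R x) = c *\<^sub>R U x" for x y c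
    using assms(1) by (simp_all add: linear_add linear_scale)
  show "norm (U x) \<le> norm x * 1" for x
    by (simp add: norm_eq_sqrt_inner assms(2))
qed

section \<open>The real Hilbert space of square integrable functions on the half line\<close>

text \<open>A density instead of a restricted space keeps the underlying space \<open>UNIV\<close>,
  so Borel functions on the whole line can be used as they are; their values on the negative axis do
  not count.\<close>

definition hl :: "real measure" where
  "hl = density lborel (\<lambda>x. ennreal (indicator {0<..} x))"

lemma sets_hl [measurable_cong, simp]: "sets hl = sets borel"
  and space_hl [simp]: "space hl = UNIV"
  by (simp_all add: hl_def)

lemma measurable_hl [simp]: "measurable hl M = measurable borel M"
  by (rule measurable_cong_sets) simp_all

lemma AE_hl: "(AE x in hl. P x) \<longleftrightarrow> (AE x in lborel. x > 0 \<longrightarrow> P x)"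
  unfolding hl_def by (subst AE_density) (auto simp: indicator_def)

lemma integral_hl:
  fixes f :: "real \<Rightarrow> 'a::{banach, second_countable_topology}"
  assumes "f \<in> borel_measurable borel"
  shows "integral\<^sup>L hl f = (LINT x|lborel. indicator {0<..} x *\<^sub>R f x)"
  unfolding hl_def using assms by (intro integral_density) auto

lemma integrable_hl:
  fixes f :: "real \<Rightarrow> 'a::{banach, second_countable_topology}"
  assumes "f \<in> borel_measurable borel"
  shows "integrable hl f \<longleftrightarrow> integrable lborel (\<lambda>x. indicator {0<..} x *\<^sub>R f x)"
  unfolding hl_def using assms by (intro integrable_density) auto

lemma nn_integral_hl:
  assumes "f \<in> borel_measurable borel"
  shows "integral\<^sup>N hl f = (\<integral>\<^sup>+x. indicator {0<..} x * f x \<partial>lborel)"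
  unfolding hl_def using assms by (subst nn_integral_density) (auto simp: ennreal_indicator)

definition sqr :: "(real \<Rightarrow> real) \<Rightarrow> bool" where
  "sqr f \<longleftrightarrow> f \<in> borel_measurable borel \<and> integrable hl (\<lambda>x. (f x)\<^sup>2)"

lemma sqr_measurable [measurable_dest]: "sqr f \<Longrightarrow> f \<in> borel_measurable borel"
  by (simp add: sqr_def)

lemma sqr_integrable_mult:
  assumes "sqr f" "sqr g"
  shows "integrable hl (\<lambda>x. f x * g x)"
proof (rule Bochner_Integration.integrable_bound)
  show "integrable hl (\<lambda>x. (f x)\<^sup>2 + (g x)\<^sup>2)"
    using assms by (auto simp: sqr_def)
  show "(\<lambda>x. f x * g x) \<in> borel_measurable hl"
    using assms by (auto simp: sqr_def)
  show "AE x in hl. norm (f x * g x) \<le> norm ((f x)\<^sup>2 + (g x)\<^sup>2)"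
  proof (rule AE_I2)
    fix x
    have "0 \<le> (\<bar>f x\<bar> - \<bar>g x\<bar>)\<^sup>2" by simp
    then have "2 * (\<bar>f x\<bar> * \<bar>g x\<bar>) \<le> (f x)\<^sup>2 + (g x)\<^sup>2"
      by (simp add: power2_diff)
    moreover have "0 \<le> \<bar>f x\<bar> * \<bar>g x\<bar>" by simp
    ultimately show "norm (f x * g x) \<le> norm ((f x)\<^sup>2 + (g x)\<^sup>2)"
      unfolding real_norm_def abs_mult by linarith
  qed
qed

lemma sqr_zero [simp]: "sqr (\<lambda>_. 0)"
  by (simp add: sqr_def)

lemma sqr_scale: "sqr f \<Longrightarrow> sqr (\<lambda>x. c * f x)"
  by (auto simp: sqr_def power_mult_distrib)

lemma sqr_add: "sqr f \<Longrightarrow> sqr g \<Longrightarrow> sqr (\<lambda>x. f x + g x)"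
  using sqr_integrable_mult[of f g]
  by (auto simp: sqr_def power2_sum mult.assoc)

lemma sqr_uminus: "sqr f \<Longrightarrow> sqr (\<lambda>x. - f x)"
  using sqr_scale[of f "-1"] by simp

lemma sqr_diff: "sqr f \<Longrightarrow> sqr g \<Longrightarrow> sqr (\<lambda>x. f x - g x)"
  using sqr_add[of f "\<lambda>x. - g x"] sqr_uminus[of g] by simp

lemma sqr_bound:
  assumes "sqr g" "f \<in> borel_measurable borel" "AE x in hl. \<bar>f x\<bar> \<le> \<bar>g x\<bar>"
  shows "sqr f"
  unfolding sqr_def
proof
  show "integrable hl (\<lambda>x. (f x)\<^sup>2)"
  proof (rule Bochner_Integration.integrable_bound)
    show "integrable hl (\<lambda>x. (g x)\<^sup>2)" using assms(1) by (simp add: sqr_def)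
    show "(\<lambda>x. (f x)\<^sup>2) \<in> borel_measurable hl" using assms(2) by auto
    show "AE x in hl. norm ((f x)\<^sup>2) \<le> norm ((g x)\<^sup>2)"
      using assms(3) by eventually_elim (simp add: abs_le_square_iff)
  qed
qed (fact assms)

definition l2_rel :: "(real \<Rightarrow> real) \<Rightarrow> (real \<Rightarrow> real) \<Rightarrow> bool" where
  "l2_rel f g \<longleftrightarrow> sqr f \<and> sqr g \<and> (AE x in hl. f x = g x)"

\<comment> \<open>Real scalars suffice because A and W map real functions to real functions; the
  complex structure is rebuilt on pairs by \<open>vec4\<close> and \<open>cscale\<close>.\<close>
quotient_type l2 = "real \<Rightarrow> real" / partial: l2_rel
proof (rule part_equivpI)
  show "\<exists>x. l2_rel x x" by (intro exI[of _ "\<lambda>_. 0"]) (simp add: l2_rel_def)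
  show "symp l2_rel" by (auto simp: l2_rel_def symp_def elim: AE_mp)
  show "transp l2_rel" by (auto simp: l2_rel_def transp_def elim!: eventually_elim2)
qed

instantiation l2 :: real_inner
begin

lift_definition zero_l2 :: l2 is "\<lambda>_. 0" by (simp add: l2_rel_def)
lift_definition plus_l2 :: "l2 \<Rightarrow> l2 \<Rightarrow> l2" is "\<lambda>f g x. f x + g x"
  by (auto simp: l2_rel_def sqr_add)
lift_definition uminus_l2 :: "l2 \<Rightarrow> l2" is "\<lambda>f x. - f x"
  by (auto simp: l2_rel_def sqr_uminus)
lift_definition minus_l2 :: "l2 \<Rightarrow> l2 \<Rightarrow> l2" is "\<lambda>f g x. f x - g x"
  by (auto simp: l2_rel_def sqr_diff)
lift_definition scaleR_l2 :: "real \<Rightarrow> l2 \<Rightarrow> l2" is "\<lambda>c f x. c * f x"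
  by (auto simp: l2_rel_def sqr_scale)
lift_definition inner_l2 :: "l2 \<Rightarrow> l2 \<Rightarrow> real" is "\<lambda>f g. LINT x|hl. f x * g x"
  by (auto simp: l2_rel_def intro!: integral_cong_AE)

definition norm_l2 :: "l2 \<Rightarrow> real" where "norm_l2 f = sqrt (inner f f)"
definition sgn_l2 :: "l2 \<Rightarrow> l2" where "sgn_l2 f = inverse (norm f) *\<^sub>R f"
definition dist_l2 :: "l2 \<Rightarrow> l2 \<Rightarrow> real" where "dist_l2 f g = norm (f - g)"
definition uniformity_l2 :: "(l2 \<times> l2) filter" where
  "uniformity_l2 = (INF e\<in>{0<..}. principal {(x, y). dist x y < e})"
definition open_l2 :: "l2 set \<Rightarrow> bool" where
  "open_l2 U \<longleftrightarrow> (\<forall>x\<in>U. \<forall>\<^sub>F (x', y) in uniformity. x' = x \<longrightarrow> y \<in> U)"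

instance
proof
  fix f g h :: l2 and a b :: real
  show "f + g + h = f + (g + h)" by transfer (simp add: l2_rel_def algebra_simps sqr_add)
  show "f + g = g + f" by transfer (simp add: l2_rel_def algebra_simps sqr_add)
  show "0 + f = f" by transfer (auto simp: l2_rel_def)
  show "- f + f = 0" by transfer (auto simp: l2_rel_def)
  show "f - g = f + - g" by transfer (auto simp: l2_rel_def intro!: sqr_diff)
  show "a *\<^sub>R (f + g) = a *\<^sub>R f + a *\<^sub>R g"
    by transfer (simp add: l2_rel_def algebra_simps sqr_add sqr_scale)
  show "(a + b) *\<^sub>R f = a *\<^sub>R f + b *\<^sub>R f"
    by transfer (simp add: l2_rel_def algebra_simps sqr_add sqr_scale)
  show "a *\<^sub>R b *\<^sub>R f = (a * b) *\<^sub>R f"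
    by transfer (simp add: l2_rel_def algebra_simps sqr_add sqr_scale)
  show "1 *\<^sub>R f = f" by transfer (simp add: l2_rel_def)
  show "sgn f = inverse (norm f) *\<^sub>R f" by (rule sgn_l2_def)
  show "dist f g = norm (f - g)" by (rule dist_l2_def)
  show "uniformity = (INF e\<in>{0<..}. principal {(x::l2, y). dist x y < e})"
    by (rule uniformity_l2_def)
  show "open U \<longleftrightarrow> (\<forall>x\<in>U. \<forall>\<^sub>F (x', y) in uniformity. x' = x \<longrightarrow> y \<in> U)" for U :: "l2 set"
    by (rule open_l2_def)
  show "inner f g = inner g f" by transfer (simp add: mult.commute)
  show "inner (f + g) h = inner f h + inner g h"
    by transfer (simp add: l2_rel_def distrib_right Bochner_Integration.integral_add sqr_integrable_mult)
  show "inner (a *\<^sub>R f) g = a * inner f g"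
    by transfer (simp add: mult.assoc)
  show "0 \<le> inner f f" by transfer simp
  show "inner f f = 0 \<longleftrightarrow> f = 0"
  proof transfer
    fix f assume f: "l2_rel f f"
    then have sq: "sqr f" by (simp add: l2_rel_def)
    have "(LINT x|hl. f x * f x) = 0 \<longleftrightarrow> (AE x in hl. f x * f x = 0)"
      using sqr_integrable_mult[OF sq sq] by (intro integral_nonneg_eq_0_iff_AE) auto
    then show "(LINT x|hl. f x * f x) = 0 \<longleftrightarrow> l2_rel f (\<lambda>_. 0)"
      using sq by (simp add: l2_rel_def)
  qed
  show "norm f = sqrt (inner f f)" by (rule norm_l2_def)
qed

end

lemma sqr_rep: "sqr (rep_l2 f)"
  using Quotient_rep_reflp[OF Quotient_l2] by (simp add: l2_rel_def)

lemma abs_rep_l2: "abs_l2 (rep_l2 f) = f"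
  using Quotient_abs_rep[OF Quotient_l2] .

lemma rep_l2_measurable [measurable]: "rep_l2 f \<in> borel_measurable borel"
  using sqr_rep by (simp add: sqr_def)

lemma rep_abs_l2: "sqr f \<Longrightarrow> AE x in hl. rep_l2 (abs_l2 f) x = f x"
  using Quotient_rep_abs[OF Quotient_l2, of f] by (simp add: l2_rel_def)

lemma abs_l2_eq_iff:
  "sqr f \<Longrightarrow> sqr g \<Longrightarrow> abs_l2 f = abs_l2 g \<longleftrightarrow> (AE x in hl. f x = g x)"
  using Quotient_rel[OF Quotient_l2, of f g] by (auto simp: l2_rel_def)

lemma inner_abs_l2:
  "sqr f \<Longrightarrow> sqr g \<Longrightarrow> inner (abs_l2 f) (abs_l2 g) = (LINT x|hl. f x * g x)"
  by (rule inner_l2.abs_eq) (simp_all add: l2_rel_def)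

lemma norm_abs_l2: "sqr f \<Longrightarrow> (norm (abs_l2 f))\<^sup>2 = (LINT x|hl. (f x)\<^sup>2)"
  by (simp add: power2_norm_eq_inner inner_abs_l2 flip: power2_eq_square)

lemma add_abs_l2: "sqr f \<Longrightarrow> sqr g \<Longrightarrow> abs_l2 f + abs_l2 g = abs_l2 (\<lambda>x. f x + g x)"
  by (rule plus_l2.abs_eq) (simp_all add: l2_rel_def)

lemma diff_abs_l2: "sqr f \<Longrightarrow> sqr g \<Longrightarrow> abs_l2 f - abs_l2 g = abs_l2 (\<lambda>x. f x - g x)"
  by (rule minus_l2.abs_eq) (simp_all add: l2_rel_def)

lemma scaleR_abs_l2: "sqr f \<Longrightarrow> c *\<^sub>R abs_l2 f = abs_l2 (\<lambda>x. c * f x)"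
  by (rule scaleR_l2.abs_eq) (simp_all add: l2_rel_def)

lemma zero_abs_l2: "0 = abs_l2 (\<lambda>x. 0)"
  by (simp add: zero_l2_def map_fun_def)

lemma dist_abs_l2: "sqr f \<Longrightarrow> sqr g \<Longrightarrow> (dist (abs_l2 f) (abs_l2 g))\<^sup>2 = (LINT x|hl. (f x - g x)\<^sup>2)"
  by (simp add: dist_norm diff_abs_l2 norm_abs_l2 sqr_diff)

lemma tendsto_dist_power2:
  fixes f :: "nat \<Rightarrow> 'a::metric_space"
  assumes "(\<lambda>k. (dist (f k) l)\<^sup>2) \<longlonglongrightarrow> 0"
  shows "f \<longlonglongrightarrow> l"
  using tendsto_real_sqrt[OF assms] tendsto_dist_iff[of f l sequentially] by simp

lemma subspace_abs_l2_sum: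
  assumes K: "subspace K" and "finite I" "\<And>i. i \<in> I \<Longrightarrow> sqr (e i)" "\<And>i. i \<in> I \<Longrightarrow> abs_l2 (e i) \<in> K"
  shows "sqr (\<lambda>x. \<Sum>i\<in>I. c i * e i x) \<and> abs_l2 (\<lambda>x. \<Sum>i\<in>I. c i * e i x) \<in> K"
  using assms(2-)
proof (induction I)
  case empty
  then show ?case using subspace_0[OF K] zero_abs_l2 by simp
next
  case (insert i I)
  then have "c i *\<^sub>R abs_l2 (e i) + abs_l2 (\<lambda>x. \<Sum>i\<in>I. c i * e i x) \<in> K"
    by (intro subspace_add[OF K] subspace_scale[OF K]) auto
  with insert show ?case by (simp add: scaleR_abs_l2 add_abs_l2 sqr_scale sqr_add)
qed

text \<open>Fatou's lemma for the squares of \<open>f k - g\<close>: a pointwise limit inherits the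
  distance bound to \<open>g\<close>, and membership in L^2 comes along since F = (F - g) +
  g.\<close>

lemma l2_Fatou:
  assumes f: "\<And>k. sqr (f k)" and g: "sqr g" and F: "F \<in> borel_measurable borel"
    and lim: "AE x in hl. (\<lambda>k. f k x) \<longlonglongrightarrow> F x"
    and bound: "\<forall>\<^sub>F k in sequentially. dist (abs_l2 (f k)) (abs_l2 g) \<le> c"
  shows "sqr F \<and> dist (abs_l2 F) (abs_l2 g) \<le> c"
proof -
  have m [measurable]: "f k \<in> borel_measurable borel" "g \<in> borel_measurable borel" for k
    using f g by (simp_all add: sqr_def)
  have c0: "0 \<le> c"
    using eventually_happens[OF bound] by (auto intro: order_trans[OF zero_le_dist])
  have "(\<integral>\<^sup>+x. ennreal ((F x - g x)\<^sup>2) \<partial>hl) = (\<integral>\<^sup>+x. liminf (\<lambda>k. ennreal ((f k x - g x)\<^sup>2)) \<partial>hl)"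
  proof (rule nn_integral_cong_AE)
    show "AE x in hl. ennreal ((F x - g x)\<^sup>2) = liminf (\<lambda>k. ennreal ((f k x - g x)\<^sup>2))"
      using lim
    proof eventually_elim
      case (elim x)
      then have "(\<lambda>k. ennreal ((f k x - g x)\<^sup>2)) \<longlonglongrightarrow> ennreal ((F x - g x)\<^sup>2)"
        by (intro tendsto_ennrealI tendsto_intros)
      then show ?case by (intro lim_imp_Liminf[symmetric]) simp_all
    qed
  qed
  also have "\<dots> \<le> liminf (\<lambda>k. \<integral>\<^sup>+x. ennreal ((f k x - g x)\<^sup>2) \<partial>hl)"
    by (intro nn_integral_liminf) simp
  also have "\<dots> \<le> liminf (\<lambda>k. ennreal (c\<^sup>2))"
  proof (rule Liminf_mono)
    show "\<forall>\<^sub>F k in sequentially. (\<integral>\<^sup>+x. ennreal ((f k x - g x)\<^sup>2) \<partial>hl) \<le> ennreal (c\<^sup>2)"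
      using bound
    proof eventually_elim
      case (elim k)
      have "(\<integral>\<^sup>+x. ennreal ((f k x - g x)\<^sup>2) \<partial>hl) = ennreal (LINT x|hl. (f k x - g x)\<^sup>2)"
        using sqr_diff[OF f[of k] g] by (intro nn_integral_eq_integral) (auto simp: sqr_def)
      also have "\<dots> = ennreal ((dist (abs_l2 (f k)) (abs_l2 g))\<^sup>2)"
        by (simp add: dist_abs_l2 f g)
      also have "\<dots> \<le> ennreal (c\<^sup>2)"
        using elim by (intro ennreal_leI power_mono) auto
      finally show ?case .
    qed
  qed
  finally have *: "(\<integral>\<^sup>+x. ennreal ((F x - g x)\<^sup>2) \<partial>hl) \<le> ennreal (c\<^sup>2)"
    by (simp add: Liminf_const)
  then have int: "integrable hl (\<lambda>x. (F x - g x)\<^sup>2)"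
    using F m(2) le_less_trans[OF * ennreal_less_top] by (intro integrableI_bounded) auto
  have "sqr (\<lambda>x. (F x - g x) + g x)"
    using int F g by (intro sqr_add) (auto simp: sqr_def)
  then have sF: "sqr F" by simp
  have "ennreal ((dist (abs_l2 F) (abs_l2 g))\<^sup>2) \<le> ennreal (c\<^sup>2)"
    using * nn_integral_eq_integral[OF int] by (simp add: dist_abs_l2 sF g)
  then have "(dist (abs_l2 F) (abs_l2 g))\<^sup>2 \<le> c\<^sup>2"
    by (subst (asm) ennreal_le_iff) auto
  then have "dist (abs_l2 F) (abs_l2 g) \<le> c"
    using c0 by (rule power2_le_imp_le)
  with sF show ?thesis by simp
qed

text \<open>Weighting the squares by \<open>2\<^sup>k\<close> gives pointwise summability from AM-GM, without Minkowski's
  inequality for infinite sums.\<close>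

lemma AE_convergent_of_summable_dist:
  assumes f: "\<And>k. sqr (f k)"
    and d: "\<And>k. dist (abs_l2 (f (Suc k))) (abs_l2 (f k)) \<le> (1/4) ^ k"
  shows "AE x in hl. convergent (\<lambda>k. f k x)"
proof -
  have m [measurable]: "f k \<in> borel_measurable borel" for k
    using f by (simp add: sqr_def)
  define D where "D k x = 2 ^ k * (f (Suc k) x - f k x)\<^sup>2" for k x
  have D0: "0 \<le> D k x" for k x by (simp add: D_def)
  have [measurable]: "D k \<in> borel_measurable borel" for k unfolding D_def by measurable
  have nnD: "(\<integral>\<^sup>+x. ennreal (D k x) \<partial>hl) \<le> ennreal ((1/8) ^ k)" for k
  proof -
    have int: "integrable hl (\<lambda>x. (f (Suc k) x - f k x)\<^sup>2)"
      using sqr_diff[OF f[of "Suc k"] f[of k]] by (simp add: sqr_def)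
    then have "(\<integral>\<^sup>+x. ennreal (D k x) \<partial>hl) = ennreal (LINT x|hl. D k x)"
      unfolding D_def by (intro nn_integral_eq_integral) auto
    also have "(LINT x|hl. D k x) = 2 ^ k * (dist (abs_l2 (f (Suc k))) (abs_l2 (f k)))\<^sup>2"
      by (simp add: D_def dist_abs_l2 f)
    also have "\<dots> \<le> 2 ^ k * ((1/4) ^ k)\<^sup>2"
      by (intro mult_left_mono power_mono d) auto
    also have "\<dots> = (2 * (1/4)\<^sup>2) ^ k"
      unfolding power_mult_distrib by (simp only: power_mult[symmetric] mult.commute)
    also have "\<dots> = (1/8) ^ k"
      by (simp add: power2_eq_square)
    finally show ?thesis by (simp add: ennreal_leI)
  qed
  have "(\<integral>\<^sup>+x. (\<Sum>k. ennreal (D k x)) \<partial>hl) = (\<Sum>k. \<integral>\<^sup>+x. ennreal (D k x) \<partial>hl)"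
    by (rule nn_integral_suminf) simp
  also have "\<dots> \<le> (\<Sum>k. ennreal ((1/8) ^ k))"
    by (intro suminf_le nnD) auto
  also have "\<dots> = ennreal (\<Sum>k. (1/8) ^ k)"
    by (intro suminf_ennreal2 summable_geometric) auto
  also have "\<dots> < \<infinity>" by simp
  finally have "AE x in hl. (\<Sum>k. ennreal (D k x)) \<noteq> \<infinity>"
    by (intro nn_integral_PInf_AE) auto
  then show ?thesis
  proof eventually_elim
    case (elim x)
    then have sD: "summable (\<lambda>k. D k x)"
      by (intro summable_suminf_not_top D0) simp
    have "summable (\<lambda>k. f (Suc k) x - f k x)"
    proof (rule summable_comparison_test)
      show "summable (\<lambda>k. (D k x + (1/2) ^ k) / 2)"
        by (intro summable_divide summable_add sD summable_geometric) simp
      have "norm (f (Suc k) x - f k x) \<le> (D k x + (1/2) ^ k) / 2" for k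
      proof -
        define y where "y = \<bar>f (Suc k) x - f k x\<bar>"
        define p where "p = sqrt (2 ^ k)"
        have p: "p > 0" "p\<^sup>2 = 2 ^ k" by (simp_all add: p_def)
        have "0 \<le> (p * y - 1 / p)\<^sup>2" by simp
        also have "\<dots> = p\<^sup>2 * y\<^sup>2 - 2 * y + 1 / p\<^sup>2"
          using p(1) by (simp add: power2_diff power_mult_distrib power_divide)
        finally have "2 * y \<le> 2 ^ k * y\<^sup>2 + (1/2) ^ k"
          using p(2) by (simp add: power_divide)
        then show ?thesis by (simp add: D_def y_def)
      qed
      then show "\<exists>N. \<forall>k\<ge>N. norm (f (Suc k) x - f k x) \<le> (D k x + (1/2) ^ k) / 2" by blast
    qed
    then have "convergent (\<lambda>k. \<Sum>j<k. f (Suc j) x - f j x)"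
      by (simp add: summable_iff_convergent)
    moreover have "(\<Sum>j<k. f (Suc j) x - f j x) = f k x - f 0 x" for k
      by (rule sum_lessThan_telescope)
    ultimately have "convergent (\<lambda>k. f k x - f 0 x)"
      by simp
    then show "convergent (\<lambda>k. f k x)"
      using convergent_diff_const_right_iff by blast
  qed
qed

text \<open>Riesz-Fischer: a subsequence with gaps at most 4^(-k) converges almost everywhere, and
  \<open>l2_Fatou\<close> bounds the distance of its pointwise limit from every member by the same
  quantity.\<close>

instance l2 :: complete_space
proof
  fix X :: "nat \<Rightarrow> l2" assume "Cauchy X"
  then have "\<exists>N. \<forall>m\<ge>N. \<forall>n\<ge>N. dist (X m) (X n) < (1/4) ^ k" for k
    by (intro metric_CauchyD) auto
  then obtain M where M: "\<And>k m n. m \<ge> M k \<Longrightarrow> n \<ge> M k \<Longrightarrow> dist (X m) (X n) < (1/4) ^ k"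
    by metis
  \<comment> \<open>Summing the moduli makes the sequence of indices monotone while staying above
    \<open>M k\<close>.\<close>
  define N where "N k = (\<Sum>j\<le>k. M j)" for k
  have MN: "M k \<le> N k" for k unfolding N_def by (rule member_le_sum) auto
  have N_mono: "N j \<le> N k" if "j \<le> k" for j k
    unfolding N_def using that by (intro sum_mono2) auto
  have XN: "dist (X m) (X (N k)) \<le> (1/4) ^ k" if "m \<ge> N k" for m k
    using M[of k m "N k"] MN[of k] that by simp
  define f where "f k = rep_l2 (X (N k))" for k
  have f: "sqr (f k)" and af: "abs_l2 (f k) = X (N k)" for k
    by (simp_all add: f_def sqr_rep abs_rep_l2)
  have [measurable]: "f k \<in> borel_measurable borel" for k
    using f by (simp add: sqr_def)
  define F where "F x = lim (\<lambda>k. f k x)" for x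
  have F [measurable]: "F \<in> borel_measurable borel" unfolding F_def by measurable
  have "AE x in hl. convergent (\<lambda>k. f k x)"
    by (rule AE_convergent_of_summable_dist) (auto simp: f af intro!: XN N_mono)
  then have lim: "AE x in hl. (\<lambda>k. f k x) \<longlonglongrightarrow> F x"
    by eventually_elim (simp add: F_def convergent_LIMSEQ_iff)
  have *: "sqr F \<and> dist (abs_l2 F) (abs_l2 (f k)) \<le> (1/4) ^ k" for k
    by (rule l2_Fatou[OF f f F lim]) (auto simp: af eventually_sequentially intro!: exI[of _ k] XN N_mono)
  have "X \<longlonglongrightarrow> abs_l2 F"
  proof (rule metric_LIMSEQ_I)
    fix r :: real assume "r > 0"
    then obtain k where k: "(1/4) ^ k < r / 2"
      using real_arch_pow_inv[of "r/2" "1/4"] by auto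
    have "dist (X m) (abs_l2 F) < r" if "m \<ge> N k" for m
    proof -
      have "dist (X m) (abs_l2 F) \<le> dist (X m) (X (N k)) + dist (abs_l2 F) (X (N k))"
        by (rule dist_triangle2)
      also have "\<dots> \<le> (1/4) ^ k + (1/4) ^ k"
        using XN[OF that] *[of k] by (simp add: af)
      finally show ?thesis using k by simp
    qed
    then show "\<exists>no. \<forall>n\<ge>no. dist (X n) (abs_l2 F) < r" by blast
  qed
  then show "convergent X" by (rule convergentI)
qed

lemma l2_dominated_convergence:
  assumes F: "\<And>k. F k \<in> borel_measurable borel" and f: "f \<in> borel_measurable borel"
    and g: "sqr g"
    and lim: "AE x in hl. (\<lambda>k. F k x) \<longlonglongrightarrow> f x"
    and bound: "\<And>k. AE x in hl. \<bar>F k x\<bar> \<le> g x"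
  shows "sqr f" "sqr (F k)" "(\<lambda>k. abs_l2 (F k)) \<longlonglongrightarrow> abs_l2 f"
proof -
  have gm: "g \<in> borel_measurable borel" using g by (simp add: sqr_def)
  have "AE x in hl. \<forall>k. \<bar>F k x\<bar> \<le> g x"
    using bound by (simp add: AE_all_countable)
  then have bf: "AE x in hl. \<bar>f x\<bar> \<le> g x"
    using lim
  proof eventually_elim
    case (elim x)
    show ?case
      by (rule LIMSEQ_le_const2[OF tendsto_rabs[OF elim(2)]]) (use elim(1) in auto)
  qed
  show sf: "sqr f"
    by (rule sqr_bound[OF g f]) (use bf in eventually_elim, auto)
  show sF: "sqr (F k)" for k
    by (rule sqr_bound[OF g F]) (use bound[of k] in eventually_elim, auto)
  have "(\<lambda>k. LINT x|hl. (F k x - f x)\<^sup>2) \<longlonglongrightarrow> (LINT x|hl. 0)"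
  proof (rule integral_dominated_convergence)
    show "integrable hl (\<lambda>x. 4 * (g x)\<^sup>2)" using g by (simp add: sqr_def)
    show "AE x in hl. (\<lambda>k. (F k x - f x)\<^sup>2) \<longlonglongrightarrow> 0"
      using lim
    proof eventually_elim
      case (elim x)
      have "(\<lambda>k. (F k x - f x)\<^sup>2) \<longlonglongrightarrow> (f x - f x)\<^sup>2"
        by (intro tendsto_intros elim)
      then show ?case by simp
    qed
    show "AE x in hl. norm ((F k x - f x)\<^sup>2) \<le> 4 * (g x)\<^sup>2" for k
      using bf bound[of k]
    proof eventually_elim
      case (elim x)
      then have "\<bar>F k x - f x\<bar> \<le> \<bar>2 * g x\<bar>" by linarith
      then have "(F k x - f x)\<^sup>2 \<le> (2 * g x)\<^sup>2" by (rule abs_le_square_iff[THEN iffD1])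
      then show ?case by (simp add: power_mult_distrib)
    qed
  qed (use F f in auto)
  then have "(\<lambda>k. (dist (abs_l2 (F k)) (abs_l2 f))\<^sup>2) \<longlonglongrightarrow> 0"
    by (simp add: dist_abs_l2 sf sF)
  then show "(\<lambda>k. abs_l2 (F k)) \<longlonglongrightarrow> abs_l2 f"
    by (rule tendsto_dist_power2)
qed

section \<open>Density of the indicators of initial intervals\<close>

definition chi :: "real \<Rightarrow> l2" where
  "chi a = abs_l2 (indicator {0<..a})"

lemma sqr_indicator:
  assumes "A \<in> sets borel" "A \<subseteq> {0<..R}"
  shows "sqr (indicator A)"
proof -
  have "integrable lborel (\<lambda>x. indicator A x :: real)"
  proof (rule Bochner_Integration.integrable_bound)
    show "integrable lborel (\<lambda>x. indicator {0..R} x :: real)"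
      by (simp add: emeasure_lborel_Icc_eq)
    show "AE x in lborel. norm (indicator A x :: real) \<le> norm (indicator {0..R} x :: real)"
      using assms(2) by (intro AE_I2) (auto simp: indicator_def)
  qed (use assms(1) in measurable)
  moreover have "(\<lambda>x. indicator {0<..} x *\<^sub>R (indicator A x :: real)\<^sup>2) = indicator A"
    using assms(2) by (auto simp: indicator_def fun_eq_iff)
  ultimately show ?thesis
    using assms(1) by (simp add: sqr_def integrable_hl)
qed

text \<open>A Dynkin argument on the half-lines \<open>{..a}\<close>, everything cut off at a fixed
  \<open>R\<close>, passes from initial intervals to all bounded Borel sets; disjoint unions use
  dominated convergence and the closedness of \<open>K\<close>. Simple functions then approximate an
  arbitrary representative.\<close>

lemma closed_subspace_l2_UNIV:
  assumes K: "subspace K" "closed K" and chi: "\<And>a. a > 0 \<Longrightarrow> chi a \<in> K"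
  shows "f \<in> K"
proof -
  have ind: "abs_l2 (indicator (B \<inter> {0<..R})) \<in> K" if "B \<in> sets borel" "R > 0" for B R
  proof -
    have "Int_stable (range (\<lambda>a::real. {..a}))"
      by (auto simp: Int_stable_def)
    moreover have "range (\<lambda>a::real. {..a}) \<subseteq> Pow UNIV" by simp
    moreover have "B \<in> sigma_sets UNIV (range (\<lambda>a::real. {..a}))"
      using that(1) by (simp add: borel_eq_atMost)
    ultimately show ?thesis
    proof (induction rule: sigma_sets_induct_disjoint)
      case (basic A)
      then obtain a where A: "A = {..a}" by auto
      show ?case
      proof (cases "a > 0")
        case True
        then have "chi (min a R) \<in> K" using that(2) by (intro chi) simp
        moreover have "A \<inter> {0<..R} = {0<..min a R}" by (auto simp: A)
        ultimately show ?thesis by (simp add: chi_def)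
      next
        case False
        then have "A \<inter> {0<..R} = {}" by (auto simp: A)
        then show ?thesis
          using subspace_0[OF K(1)] zero_abs_l2 by (simp add: indicator_def)
      qed
    next
      case empty
      then show ?case
        using subspace_0[OF K(1)] zero_abs_l2 by (simp add: indicator_def)
    next
      case (compl A)
      then have A: "A \<in> sets borel" by (simp add: borel_eq_atMost)
      have "abs_l2 (indicator {0<..R}) - abs_l2 (indicator (A \<inter> {0<..R}))
          = abs_l2 (\<lambda>x. indicator {0<..R} x - indicator (A \<inter> {0<..R}) x)"
        using A by (intro diff_abs_l2 sqr_indicator[of _ R]) auto
      also have "(\<lambda>x. indicator {0<..R} x - indicator (A \<inter> {0<..R}) x :: real)
          = indicator ((UNIV - A) \<inter> {0<..R})"
        by (auto simp: indicator_def fun_eq_iff)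
      finally show ?case
        using subspace_diff[OF K(1) chi[OF that(2)] compl(2)] by (simp add: chi_def)
    next
      case (union A)
      then have A [measurable]: "A i \<in> sets borel" for i by (auto simp: borel_eq_atMost)
      have lim: "(\<lambda>k. abs_l2 (\<lambda>x. \<Sum>i<k. indicator (A i \<inter> {0<..R}) x)) \<longlonglongrightarrow>
          abs_l2 (indicator ((\<Union>i. A i) \<inter> {0<..R}))"
      proof (rule l2_dominated_convergence(3))
        show "sqr (indicator {0<..R})" by (rule sqr_indicator[of _ R]) auto
        have eq: "(\<Sum>i<k. indicator (A i \<inter> {0<..R}) x :: real) = indicator (\<Union>i<k. A i \<inter> {0<..R}) x" for k x
          using union(1) by (subst indicator_UN_disjoint) (auto simp: disjoint_family_on_def)
        show "AE x in hl. \<bar>\<Sum>i<k. indicator (A i \<inter> {0<..R}) x\<bar> \<le> (indicator {0<..R} x :: real)" for k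
          unfolding eq by (intro AE_I2) (auto simp: indicator_def)
        have "(\<lambda>k. \<Sum>i<k. indicator (A i \<inter> {0<..R}) x) \<longlonglongrightarrow> (indicator ((\<Union>i. A i) \<inter> {0<..R}) x :: real)" for x
        proof -
          have "(\<lambda>k. indicator (\<Union>i<k. A i \<inter> {0<..R}) x) \<longlonglongrightarrow> (indicator (\<Union>i. A i \<inter> {0<..R}) x :: real)"
            by (rule LIMSEQ_indicator_UN)
          then show ?thesis unfolding eq by simp
        qed
        then show "AE x in hl. (\<lambda>k. \<Sum>i<k. indicator (A i \<inter> {0<..R}) x) \<longlonglongrightarrow> (indicator ((\<Union>i. A i) \<inter> {0<..R}) x :: real)"
          by (intro AE_I2)
      qed auto
      have "sqr (indicator (A i \<inter> {0<..R}))" for i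
        by (rule sqr_indicator[of _ R]) auto
      then have "abs_l2 (\<lambda>x. \<Sum>i<k. indicator (A i \<inter> {0<..R}) x) \<in> K" for k
        using subspace_abs_l2_sum[OF K(1), of "{..<k}" "\<lambda>i. indicator (A i \<inter> {0<..R})" "\<lambda>_. 1"] union(3)
        by simp
      then show ?case
        by (rule closed_sequentially[OF K(2) _ lim])
    qed
  qed
  define u where "u = rep_l2 f"
  have u: "sqr u" "u \<in> borel_measurable borel" by (simp_all add: u_def sqr_rep)
  obtain s where s: "\<And>i. simple_function borel (s i)"
    "\<And>x. (\<lambda>i. s i x) \<longlonglongrightarrow> u x" "\<And>i x. dist (s i x) 0 \<le> 2 * dist (u x) 0"
    using borel_measurable_implies_sequence_metric[OF u(2), of 0] by auto
  have sm [measurable]: "s i \<in> borel_measurable borel" for i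
    using borel_measurable_simple_function[OF s(1)] .
  \<comment> \<open>The cutoff makes all level sets bounded, so that \<open>ind\<close> applies to
    them; the majorant of the approximation is twice the absolute value of \<open>u\<close>.\<close>
  define v where "v i x = s i x * indicator {0<..real (Suc i)} x" for i x
  have lim: "(\<lambda>i. abs_l2 (v i)) \<longlonglongrightarrow> abs_l2 u"
  proof (rule l2_dominated_convergence(3))
    show "sqr (\<lambda>x. 2 * \<bar>u x\<bar>)"
      using u by (intro sqr_scale sqr_bound[OF u(1)]) auto
    show "AE x in hl. \<bar>v i x\<bar> \<le> 2 * \<bar>u x\<bar>" for i
      using s(3) by (intro AE_I2) (auto simp: v_def indicator_def)
    show "AE x in hl. (\<lambda>i. v i x) \<longlonglongrightarrow> u x"
      unfolding AE_hl
    proof (intro AE_I2 impI)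
      fix x :: real assume "0 < x"
      obtain n where n: "x < real n" using reals_Archimedean2 by blast
      then have "\<forall>\<^sub>F i in sequentially. v i x = s i x"
        using \<open>0 < x\<close> unfolding eventually_sequentially
        by (intro exI[of _ n]) (auto simp: v_def indicator_def)
      then show "(\<lambda>i. v i x) \<longlonglongrightarrow> u x"
        using s(2) by (simp add: filterlim_cong)
    qed
  qed (auto simp: v_def[abs_def] u)
  have mem: "abs_l2 (v i) \<in> K" for i
  proof -
    define J where "J = {0<..real (Suc i)}"
    have fin: "finite (range (s i))" using s(1)[of i] by (auto simp: simple_function_def)
    define e :: "real \<Rightarrow> real \<Rightarrow> real" where "e y = indicator (s i -` {y} \<inter> J)" for y
    have m: "s i -` {y} \<in> sets borel" for y
      using measurable_sets[OF sm, of "{y}" i] by simp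
    have "sqr (e y)" "abs_l2 (e y) \<in> K" for y
      unfolding e_def J_def using m by (auto intro!: sqr_indicator[of _ "Suc i"] ind)
    then have "abs_l2 (\<lambda>x. \<Sum>y\<in>range (s i). y * e y x) \<in> K"
      using subspace_abs_l2_sum[OF K(1) fin, of e "\<lambda>y. y"] by simp
    also have "(\<lambda>x. \<Sum>y\<in>range (s i). y * e y x) = v i"
    proof
      fix x
      have "(\<Sum>y\<in>range (s i). y * e y x)
          = (\<Sum>y\<in>range (s i). if y = s i x then v i x else 0)"
        by (intro sum.cong) (auto simp: v_def J_def e_def indicator_def)
      also have "\<dots> = v i x" using fin by simp
      finally show "(\<Sum>y\<in>range (s i). y * e y x) = v i x" .
    qed
    finally show ?thesis .
  qed
  have "abs_l2 u \<in> K"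
    by (rule closed_sequentially[OF K(2) mem lim])
  then show ?thesis by (simp add: u_def abs_rep_l2)
qed

lemma dense_chi: "closure (span (chi ` {0<..})) = UNIV"
proof -
  have "f \<in> closure (span (chi ` {0<..}))" for f
    by (rule closed_subspace_l2_UNIV)
      (auto intro!: subspace_closure closure_subset[THEN subsetD] span_base)
  then show ?thesis by auto
qed

lemma inner_chi:
  assumes "sqr f"
  shows "inner (abs_l2 f) (chi a) = (LINT x|lborel. indicator {0<..a} x * f x)"
proof -
  have "sqr (indicator {0<..a})" by (rule sqr_indicator[of _ a]) auto
  then have "inner (abs_l2 f) (chi a) = (LINT x|hl. f x * indicator {0<..a} x)"
    using assms by (simp add: chi_def inner_abs_l2)
  also have "\<dots> = (LINT x|lborel. indicator {0<..a} x * f x)"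
    using assms by (subst integral_hl) (auto simp: sqr_def indicator_def intro!: Bochner_Integration.integral_cong)
  finally show ?thesis .
qed

section \<open>The cosine part of the transform\<close>

text \<open>The scaling exponent of the whole development: by the substitution t = s x^(2n), the
  integral of exp (- s x^(2n)) over the half line is proportional to s to the power
  \<open>- mu n\<close>.\<close>

definition mu :: "nat \<Rightarrow> real" where
  "mu n = 1 / (2 * real n)"

text \<open>Generalised Gaussians, the usual ones for n = 1. They depend on x^(2n) only, which is
  also the variable of the power series \<open>c_kernel\<close>.\<close>

definition gauss :: "nat \<Rightarrow> real \<Rightarrow> real \<Rightarrow> real" where
  "gauss n s x = exp (- s * x ^ (2 * n))"

lemma mu_pos: "n \<ge> 1 \<Longrightarrow> mu n > 0"
  by (simp add: mu_def)

lemma gauss_measurable [measurable]: "gauss n s \<in> borel_measurable borel"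
  unfolding gauss_def[abs_def] by measurable

lemma gauss_pos: "0 < gauss n s x"
  by (simp add: gauss_def)

lemma gauss_le_1: "0 \<le> s \<Longrightarrow> gauss n s x \<le> 1"
  by (simp add: gauss_def)

lemma gauss_add: "gauss n (s + r) x = gauss n s x * gauss n r x"
  by (simp add: gauss_def algebra_simps flip: exp_add)

lemma gauss_antimono: "s \<le> r \<Longrightarrow> gauss n r x \<le> gauss n s x"
  by (simp add: gauss_def mult_right_mono)

lemma Gamma_absolutely_integrable:
  assumes "z > (0::real)"
  shows "(\<lambda>t. t powr (z - 1) / exp t) absolutely_integrable_on {0<..}"
    and "integral {0<..} (\<lambda>t. t powr (z - 1) / exp t) = Gamma z"
proof -
  have "((\<lambda>t. t powr (z - 1) / exp t) has_integral Gamma z) {0..}"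
    by (rule Gamma_integral_real[OF assms])
  then have *: "((\<lambda>t. t powr (z - 1) / exp t) has_integral Gamma z) {0<..}"
  proof (subst (asm) has_integral_spike_set_eq[where T = "{0<..}"])
    show "negligible {x \<in> {0..} - {0<..}. x powr (z - 1) / exp x \<noteq> 0}"
      by (rule negligible_subset[of "{0}"]) auto
    have "{x \<in> {0<..} - {0..}. x powr (z - 1) / exp x \<noteq> 0} = {}"
      by auto
    then show "negligible {x \<in> {0<..} - {0..}. x powr (z - 1) / exp x \<noteq> 0}"
      by (simp only: negligible_empty)
  qed
  then show "(\<lambda>t. t powr (z - 1) / exp t) absolutely_integrable_on {0<..}"
    by (intro nonnegative_absolutely_integrable_1) (auto simp: has_integral_integrable)
  show "integral {0<..} (\<lambda>t. t powr (z - 1) / exp t) = Gamma z"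
    using * by (rule integral_unique)
qed

text \<open>The substitution t = s x^(2n) in Euler's integral for
  \<open>Gamma (real l + mu n)\<close>. The power of x left over by the Jacobian is exactly 2nl
  because 2n \<open>mu n\<close> = 1; the constant \<open>c\<close> collects the remaining
  factors.\<close>

lemma gauss_moment:
  assumes n: "n \<ge> 1" and s: "s > 0"
  shows "has_bochner_integral hl (\<lambda>x. x ^ (2 * n * l) * gauss n s x)
    (Gamma (real l + mu n) / (2 * real n * s powr (real l + mu n)))"
proof -
  define z where "z = real l + mu n"
  have z: "z > 0" using mu_pos[OF n] by (simp add: z_def)
  define g where "g x = s * x ^ (2 * n)" for x :: real
  define g' where "g' x = s * (real (2 * n) * x ^ (2 * n - 1))" for x :: real
  define f where "f t = t powr (z - 1) / exp t" for t :: real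
  define c where "c = 2 * real n * s powr z"
  have c: "c > 0" using n s by (simp add: c_def)
  define h where "h x = c * (x ^ (2 * n * l) * gauss n s x)" for x
  have der: "(g has_field_derivative g' x) (at x within {0<..})" for x
    unfolding g_def g'_def by (auto intro!: derivative_eq_intros)
  have inj: "inj_on g {0<..}"
  proof (rule inj_onI)
    fix x y :: real assume "x \<in> {0<..}" "y \<in> {0<..}" "g x = g y"
    then show "x = y" using s n power_eq_imp_eq_base[of x "2 * n" y] by (simp add: g_def)
  qed
  have img: "g ` {0<..} = {0<..}"
  proof (intro equalityI subsetI)
    fix y :: real assume y: "y \<in> {0<..}"
    define x where "x = root (2 * n) (y / s)"
    have "x > 0" "g x = y"
      using y s n by (simp_all add: x_def g_def real_root_pow_pos2)
    then show "y \<in> g ` {0<..}" by force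
  qed (use s in \<open>auto simp: g_def\<close>)
  have eq: "\<bar>g' x\<bar> * f (g x) = h x" if "x \<in> {0<..}" for x
  proof -
    have x: "x > 0" using that by simp
    have "g x = s * x powr (2 * real n)"
      using powr_realpow[OF x, of "2 * n"] by (simp add: g_def)
    then have "(g x) powr (z - 1) = s powr (z - 1) * x powr (2 * real n * (z - 1))"
      using x s by (simp add: powr_mult powr_powr)
    moreover have "g' x = 2 * real n * s * x powr (2 * real n - 1)"
    proof -
      have "x ^ (2 * n - 1) = x powr (real (2 * n - 1))"
        using x by (simp add: powr_realpow)
      also have "real (2 * n - 1) = 2 * real n - 1" using n by (simp add: of_nat_diff)
      finally show ?thesis by (simp add: g'_def)
    qed
    ultimately have "g' x * (g x) powr (z - 1)
        = 2 * real n * (s * s powr (z - 1)) * (x powr (2 * real n - 1) * x powr (2 * real n * (z - 1)))"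
      by simp
    also have "s * s powr (z - 1) = s powr z"
      using s by (simp add: powr_diff)
    also have "x powr (2 * real n - 1) * x powr (2 * real n * (z - 1)) = x powr (2 * real n * z - 1)"
      by (simp add: algebra_simps flip: powr_add)
    also have "2 * real n * z - 1 = real (2 * n * l)"
      using n by (simp add: z_def mu_def field_simps)
    also have "x powr \<dots> = x ^ (2 * n * l)"
      using x by (simp only: powr_realpow)
    finally have *: "g' x * (g x) powr (z - 1) = c * x ^ (2 * n * l)"
      by (simp add: c_def)
    have "g' x \<ge> 0" using x s by (simp add: g'_def)
    then have "\<bar>g' x\<bar> * f (g x) = (g' x * (g x) powr (z - 1)) * exp (- g x)"
      by (simp add: f_def exp_minus field_simps)
    then show ?thesis unfolding * by (simp add: h_def g_def gauss_def)
  qed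
  have "(\<lambda>x. \<bar>g' x\<bar> * f (g x)) absolutely_integrable_on {0<..} \<and>
      integral {0<..} (\<lambda>x. \<bar>g' x\<bar> * f (g x)) = Gamma z"
    using has_absolute_integral_change_of_variables_1'[of "{0<..}" g g' f "Gamma z"] der inj img
      Gamma_absolutely_integrable[OF z] by (auto simp: f_def[abs_def])
  then have ai: "h absolutely_integrable_on {0<..}" and int: "integral {0<..} h = Gamma z"
    using eq set_integrable_cong[of lebesgue lebesgue "{0<..}" "{0<..}" "\<lambda>x. \<bar>g' x\<bar> * f (g x)" h]
      Henstock_Kurzweil_Integration.integral_cong[of "{0<..}" "\<lambda>x. \<bar>g' x\<bar> * f (g x)" h] by auto
  have hm [measurable]: "h \<in> borel_measurable borel"
    unfolding h_def by measurable
  have m: "(\<lambda>x. indicator {0<..} x *\<^sub>R h x) \<in> borel_measurable lborel"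
    by measurable
  have "integrable lborel (\<lambda>x. indicator {0<..} x *\<^sub>R h x)"
    using ai m unfolding set_integrable_def by (simp only: integrable_completion)
  then have 1: "integrable hl h"
    by (simp only: integrable_hl[OF hm])
  have "integral\<^sup>L hl h = (LINT x:{0<..}|lebesgue. h x)"
    unfolding set_lebesgue_integral_def integral_hl[OF hm] integral_completion[OF m] ..
  also have "\<dots> = Gamma z"
    using set_lebesgue_integral_eq_integral(2)[OF ai] int by simp
  finally have "has_bochner_integral hl h (Gamma z)"
    using 1 by (simp add: has_bochner_integral_iff)
  then have "has_bochner_integral hl (\<lambda>x. inverse c * h x) (inverse c * Gamma z)"
    by (intro has_bochner_integral_mult_right) auto
  moreover have "(\<lambda>x. inverse c * h x) = (\<lambda>x. x ^ (2 * n * l) * gauss n s x)"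
    using c by (simp add: h_def fun_eq_iff field_simps)
  ultimately show ?thesis
    unfolding z_def[symmetric] c_def[symmetric] by (simp add: field_simps)
qed

lemma gauss_integral:
  assumes "n \<ge> 1" "s > 0"
  shows "has_bochner_integral hl (gauss n s) (Gamma (mu n) / (2 * real n * s powr mu n))"
  using gauss_moment[OF assms, of 0] by simp

lemma sqr_gauss: "n \<ge> 1 \<Longrightarrow> s > 0 \<Longrightarrow> sqr (gauss n s)"
  using has_bochner_integral_iff[THEN iffD1, OF gauss_integral[of n "s + s"]]
  by (auto simp: sqr_def power2_eq_square simp flip: gauss_add)

definition G :: "nat \<Rightarrow> real \<Rightarrow> l2" where
  "G n s = abs_l2 (gauss n s)"

lemma inner_G:
  assumes "n \<ge> 1" "s > 0" "r > 0"
  shows "inner (G n s) (G n r) = Gamma (mu n) / (2 * real n * (s + r) powr mu n)"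
  using assms has_bochner_integral_iff[THEN iffD1, OF gauss_integral[of n "s + r"]]
  by (simp add: G_def inner_abs_l2 sqr_gauss flip: gauss_add)

section \<open>The power series of the kernel and its integral against Gaussians\<close>

definition q_coeff :: "nat \<Rightarrow> nat \<Rightarrow> real" where
  "q_coeff n l = real n / ((2 * real n) powr (2 * real l + mu n) * Gamma (real l + mu n) * fact l)"

text \<open>Splitting off the sign leaves positive coefficients. For x > 0 the sum is x^(n - 1/2)
  J(x^n / n) / 2 with the Bessel function J of order \<open>mu n - 1\<close>; for n = 1 it is cos x
  / sqrt (2 pi).\<close>

lemma c_kernel_eq: "c_kernel n x = (\<Sum>l. (-1) ^ l * q_coeff n l * x ^ (2 * n * l))"
  by (simp add: c_kernel_def q_coeff_def mu_def)

lemma powr_even_add: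
  assumes n: "n \<ge> 1"
  shows "(2 * real n) powr (2 * real l + m) = (4 * (real n)\<^sup>2) ^ l * (2 * real n) powr m"
proof -
  have "(2 * real n) powr (2 * real l) = (2 * real n) ^ (2 * l)"
    using n powr_realpow[of "2 * real n" "2 * l"] by simp
  also have "\<dots> = (4 * (real n)\<^sup>2) ^ l"
    by (simp add: power_mult power_mult_distrib)
  finally show ?thesis by (simp add: powr_add)
qed

lemma q_coeff_pos: "n \<ge> 1 \<Longrightarrow> q_coeff n l > 0"
  using mu_pos[of n] by (simp add: q_coeff_def)

definition q_const :: "nat \<Rightarrow> real" where
  "q_const n = real n / ((2 * real n) powr mu n * mu n * Gamma (mu n))"

lemma q_const_pos: "n \<ge> 1 \<Longrightarrow> q_const n > 0"
  using mu_pos[of n] by (simp add: q_const_def)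

text \<open>The Gamma factor in the denominator is bounded below by
  \<open>mu n * Gamma (mu n)\<close>, uniformly in \<open>l\<close>. What remains is the coefficient
  of an exponential series.\<close>

lemma q_coeff_le:
  assumes n: "n \<ge> 1"
  shows "q_coeff n l \<le> q_const n * (1 / (4 * (real n)\<^sup>2)) ^ l / fact l"
proof -
  have mu: "0 < mu n" "mu n \<le> 1" using n by (auto simp: mu_def)
  have "mu n * Gamma (mu n) \<le> Gamma (real l + mu n)"
  proof (induction l)
    case 0
    have "mu n * Gamma (mu n) \<le> 1 * Gamma (mu n)"
      using mu by (intro mult_right_mono) auto
    then show ?case by simp
  next
    case (Suc l)
    have *: "Gamma (real (Suc l) + mu n) = (real l + mu n) * Gamma (real l + mu n)"
      using mu Gamma_plus1[of "real l + mu n"]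
      by (auto simp: add_ac nonpos_Ints_def)
    \<comment> \<open>The factor l + \<open>mu n\<close> of the functional equation is at least 1
      only from l = 1 on; at l = 0 it is \<open>mu n\<close> and the claim is an equality.\<close>
    show ?case
    proof (cases l)
      case 0
      then show ?thesis using * by simp
    next
      case (Suc k)
      then have "1 * Gamma (real l + mu n) \<le> (real l + mu n) * Gamma (real l + mu n)"
        using mu by (intro mult_right_mono) auto
      with Suc.IH show ?thesis using * by simp
    qed
  qed
  then have "(2 * real n) powr mu n * (mu n * Gamma (mu n)) \<le> (2 * real n) powr mu n * Gamma (real l + mu n)"
    by (intro mult_left_mono) auto
  then have "real n / ((2 * real n) powr mu n * Gamma (real l + mu n)) \<le> q_const n"
    unfolding q_const_def using n mu
    by (intro divide_left_mono mult_pos_pos) (auto simp: mult.assoc)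
  then have "real n / ((2 * real n) powr mu n * Gamma (real l + mu n)) * ((1 / (4 * (real n)\<^sup>2)) ^ l / fact l)
      \<le> q_const n * ((1 / (4 * (real n)\<^sup>2)) ^ l / fact l)"
    by (intro mult_right_mono) auto
  then show ?thesis
    unfolding q_coeff_def powr_even_add[OF n] by (simp add: power_divide mult_ac)
qed

lemma c_kernel_summable:
  assumes n: "n \<ge> 1"
  shows "summable (\<lambda>l. q_coeff n l * \<bar>x\<bar> ^ (2 * n * l))"
    and "(\<Sum>l. q_coeff n l * \<bar>x\<bar> ^ (2 * n * l)) \<le> q_const n * exp (x ^ (2 * n) / (4 * (real n)\<^sup>2))"
proof -
  define y where "y = x ^ (2 * n) / (4 * (real n)\<^sup>2)"
  have y: "0 \<le> y" by (simp add: y_def)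
  have le: "q_coeff n l * \<bar>x\<bar> ^ (2 * n * l) \<le> q_const n * (y ^ l /\<^sub>R fact l)" for l
  proof -
    have x: "\<bar>x\<bar> ^ (2 * n * l) = (x ^ (2 * n)) ^ l"
      by (simp add: power_mult)
    have "q_coeff n l * (x ^ (2 * n)) ^ l \<le> q_const n * (1 / (4 * (real n)\<^sup>2)) ^ l / fact l * (x ^ (2 * n)) ^ l"
      by (intro mult_right_mono q_coeff_le n) auto
    also have "\<dots> = q_const n * (((1 / (4 * (real n)\<^sup>2)) * x ^ (2 * n)) ^ l /\<^sub>R fact l)"
    proof -
      have "A * B ^ l / F * X ^ l = A * ((B * X) ^ l /\<^sub>R F)" for A B F X :: real
        by (simp add: power_mult_distrib divide_inverse)
      then show ?thesis .
    qed
    also have "(1 / (4 * (real n)\<^sup>2)) * x ^ (2 * n) = y"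
      by (simp add: y_def)
    finally show ?thesis unfolding x .
  qed
  have sums: "(\<lambda>l. q_const n * (y ^ l /\<^sub>R fact l)) sums (q_const n * exp y)"
    by (intro sums_mult exp_converges)
  show S: "summable (\<lambda>l. q_coeff n l * \<bar>x\<bar> ^ (2 * n * l))"
  proof (rule summable_comparison_test')
    show "summable (\<lambda>l. q_const n * (y ^ l /\<^sub>R fact l))" using sums by (rule sums_summable)
    show "norm (q_coeff n l * \<bar>x\<bar> ^ (2 * n * l)) \<le> q_const n * (y ^ l /\<^sub>R fact l)" if "l \<ge> 0" for l
      using le[of l] q_coeff_pos[OF n, of l] by (simp add: abs_mult power_abs)
  qed
  show "(\<Sum>l. q_coeff n l * \<bar>x\<bar> ^ (2 * n * l)) \<le> q_const n * exp (x ^ (2 * n) / (4 * (real n)\<^sup>2))"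
    using suminf_le[OF le S sums_summable[OF sums]] sums_unique[OF sums] by (simp add: y_def)
qed

text \<open>The triangle inequality in the series. The bound ignores all cancellation, but it is the
  reciprocal of a generalised Gaussian up to a constant, so a narrow enough Gaussian compensates for
  it.\<close>

lemma c_kernel_bound:
  assumes n: "n \<ge> 1"
  shows "\<bar>c_kernel n x\<bar> \<le> q_const n * exp (x ^ (2 * n) / (4 * (real n)\<^sup>2))"
proof -
  have *: "\<bar>(-1) ^ l * q_coeff n l * x ^ (2 * n * l)\<bar> = q_coeff n l * \<bar>x\<bar> ^ (2 * n * l)" for l
    using q_coeff_pos[OF n, of l] by (simp add: abs_mult power_abs)
  have "\<bar>c_kernel n x\<bar> \<le> (\<Sum>l. \<bar>(-1) ^ l * q_coeff n l * x ^ (2 * n * l)\<bar>)"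
    unfolding c_kernel_eq by (rule summable_rabs) (simp only: * c_kernel_summable(1)[OF n])
  also have "\<dots> \<le> q_const n * exp (x ^ (2 * n) / (4 * (real n)\<^sup>2))"
    unfolding * by (rule c_kernel_summable(2)[OF n])
  finally show ?thesis .
qed

lemma c_kernel_measurable [measurable]: "c_kernel n \<in> borel_measurable borel"
  unfolding c_kernel_eq[abs_def] by measurable

lemma c_kernel_minus: "c_kernel n (- x) = c_kernel n x"
  unfolding c_kernel_eq by (simp add: power_mult)

text \<open>Weber's first exponential integral, in the variable \<open>x ^ n\<close>.\<close>

lemma c_kernel_gauss_integral:
  assumes n: "n \<ge> 1" and s: "s > 0"
  shows "(LINT x|hl. c_kernel n (w * x) * gauss n s x)
    = (2 * real n * s) powr (- mu n) / 2 * gauss n (1 / (4 * (real n)\<^sup>2 * s)) w"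
proof -
  define y where "y = w ^ (2 * n) / (4 * (real n)\<^sup>2 * s)"
  have y: "0 \<le> y" using s by (simp add: y_def)
  define C where "C = (2 * real n * s) powr (- mu n) / 2"
  define f where "f l x = (-1) ^ l * q_coeff n l * w ^ (2 * n * l) * (x ^ (2 * n * l) * gauss n s x)" for l x
  have val: "q_coeff n l * w ^ (2 * n * l) * (Gamma (real l + mu n) / (2 * real n * s powr (real l + mu n)))
      = C * (y ^ l /\<^sub>R fact l)" for l
  proof -
    have G: "Gamma (real l + mu n) > 0" using mu_pos[OF n] by simp
    note p = powr_even_add[OF n, of l "mu n"]
    have p2: "s powr (real l + mu n) = s ^ l * s powr mu n"
      using s by (simp add: powr_add powr_realpow)
    have p3: "C = 1 / (2 * ((2 * real n) powr mu n * s powr mu n))"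
    proof -
      have "(2 * real n * s) powr mu n = (2 * real n) powr mu n * s powr mu n"
        by (rule powr_mult)
      then show ?thesis by (simp add: C_def powr_minus_divide)
    qed
    have y: "y ^ l = w ^ (2 * n * l) / ((4 * (real n)\<^sup>2) ^ l * s ^ l)"
      by (simp add: y_def power_divide power_mult power_mult_distrib)
    have alg: "N / (a * b * g * f) * P * (g / (2 * N * (c * d))) = 1 / (2 * (b * d)) * (P / (a * c) /\<^sub>R f)"
      if "N \<noteq> 0" "g \<noteq> 0" "f \<noteq> 0" for N a b g f P c d :: real
      using that by (simp add: field_simps)
    show ?thesis
      unfolding q_coeff_def p p2 p3 y by (rule alg) (use G n in auto)
  qed
  have bi: "has_bochner_integral hl (f l) ((-1) ^ l * (C * (y ^ l /\<^sub>R fact l)))" for l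
  proof -
    have "has_bochner_integral hl (f l) ((-1) ^ l * q_coeff n l * w ^ (2 * n * l)
        * (Gamma (real l + mu n) / (2 * real n * s powr (real l + mu n))))"
      unfolding f_def by (intro has_bochner_integral_mult_right gauss_moment n s)
    then show ?thesis using val[of l] by (simp only: mult.assoc)
  qed
  have sgn: "(-1) ^ l * ((-1) ^ l * z) = z" for l and z :: real
    by (cases "even l") auto
  \<comment> \<open>Apart from the sign all factors are nonnegative, the powers being even. The
    integrals of the norms are therefore the same moments without sign, and they sum to an
    exponential series, which justifies termwise integration.\<close>
  have nf: "norm (f l x) = (-1) ^ l * f l x" for l x
  proof -
    define r where "r = q_coeff n l * w ^ (2 * n * l) * (x ^ (2 * n * l) * gauss n s x)"
    have "0 \<le> r"
      unfolding r_def using q_coeff_pos[OF n, of l] gauss_pos[of n s x]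
      by (intro mult_nonneg_nonneg zero_le_even_power) auto
    moreover have "f l x = (-1) ^ l * r" by (simp add: f_def r_def)
    ultimately show ?thesis by (simp add: abs_mult sgn)
  qed
  have "(\<lambda>l. integral\<^sup>L hl (f l)) sums (LINT x|hl. (\<Sum>l. f l x))"
  proof (rule sums_integral)
    show "integrable hl (f l)" for l using bi by (auto simp: has_bochner_integral_iff)
    show "AE x in hl. summable (\<lambda>l. norm (f l x))"
    proof (rule AE_I2)
      fix x
      have "norm (f l x) = q_coeff n l * \<bar>w * x\<bar> ^ (2 * n * l) * gauss n s x" for l
        using q_coeff_pos[OF n, of l] gauss_pos[of n s x]
        by (simp add: f_def abs_mult power_abs power_mult_distrib)
      then show "summable (\<lambda>l. norm (f l x))"
        using summable_mult2[OF c_kernel_summable(1)[OF n]] by simp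
    qed
    have "(LINT x|hl. norm (f l x)) = C * (y ^ l /\<^sub>R fact l)" for l
      unfolding nf using bi[of l] by (simp add: has_bochner_integral_iff sgn)
    then show "summable (\<lambda>l. LINT x|hl. norm (f l x))"
      using summable_mult[OF summable_exp_generic[of y]] by simp
  qed
  moreover have "(\<lambda>l. integral\<^sup>L hl (f l)) sums (C * exp (- y))"
  proof -
    have "integral\<^sup>L hl (f l) = C * ((- y) ^ l /\<^sub>R fact l)" for l
      unfolding power_minus[of y l] using bi[of l] by (simp add: has_bochner_integral_iff)
    then show ?thesis using sums_mult[OF exp_converges[of "- y"], of C] by simp
  qed
  ultimately have "(LINT x|hl. (\<Sum>l. f l x)) = C * exp (- y)"
    by (rule sums_unique2)
  moreover have "(\<Sum>l. f l x) = c_kernel n (w * x) * gauss n s x" for x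
  proof -
    have "summable (\<lambda>l. (-1) ^ l * q_coeff n l * (w * x) ^ (2 * n * l))"
    proof (rule summable_norm_cancel)
      have "norm ((-1) ^ l * q_coeff n l * (w * x) ^ (2 * n * l)) = q_coeff n l * \<bar>w * x\<bar> ^ (2 * n * l)" for l
        using q_coeff_pos[OF n, of l] by (simp add: abs_mult power_abs)
      then show "summable (\<lambda>l. norm ((-1) ^ l * q_coeff n l * (w * x) ^ (2 * n * l)))"
        using c_kernel_summable(1)[OF n, of "w * x"] by simp
    qed
    from suminf_mult2[OF this, of "gauss n s x"]
    have "c_kernel n (w * x) * gauss n s x
        = (\<Sum>l. (-1) ^ l * q_coeff n l * (w * x) ^ (2 * n * l) * gauss n s x)"
      unfolding c_kernel_eq .
    moreover have "(-1) ^ l * q_coeff n l * (w * x) ^ (2 * n * l) * gauss n s x = f l x" for l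
      unfolding f_def power_mult_distrib by (simp only: mult.assoc)
    ultimately show ?thesis by simp
  qed
  ultimately show ?thesis by (simp add: C_def y_def gauss_def)
qed

lemma gauss_power: "gauss n 1 x * gauss n 1 x ^ i = gauss n (real (Suc i)) x"
  unfolding gauss_def by (simp add: algebra_simps flip: exp_add exp_of_nat_mult)

text \<open>Multiples of \<open>gauss n 1\<close> by powers of itself are again Gaussians, so
  Weierstrass approximation on [0, 1] yields every product of \<open>gauss n 1\<close> with a
  continuous function of it; the extra factor keeps the products square integrable. As
  \<open>gauss n 1\<close> is strictly decreasing on the half line, indicators of (0, a] are limits
  of such products.\<close>

lemma dense_G:
  assumes n: "n \<ge> 1"
  shows "closure (span (G n ` {0<..})) = UNIV"
proof -
  define K where "K = closure (span (G n ` {0<..}))"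
  have sub: "subspace K" unfolding K_def by (intro subspace_closure subspace_span)
  have cl: "closed K" by (simp add: K_def)
  have GK: "G n s \<in> K" if "s > 0" for s
    unfolding K_def using that by (intro closure_subset[THEN subsetD] span_base) auto
  have g1: "gauss n 1 x \<in> {0..1}" for x
    using gauss_pos[of n 1 x] gauss_le_1[of 1 n x] by simp
  have poly: "abs_l2 (\<lambda>x. gauss n 1 x * p (gauss n 1 x)) \<in> K" if p: "real_polynomial_function p" for p
  proof -
    obtain a N where p: "p = (\<lambda>x. \<Sum>i\<le>N. a i * x ^ i)"
      using p real_polynomial_function_iff_sum by blast
    have "sqr (gauss n (real (Suc i)))" "abs_l2 (gauss n (real (Suc i))) \<in> K" for i
      using GK[of "real (Suc i)"] n by (auto intro: sqr_gauss simp: G_def simp del: of_nat_Suc)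
    then have "abs_l2 (\<lambda>x. \<Sum>i\<le>N. a i * gauss n (real (Suc i)) x) \<in> K"
      using subspace_abs_l2_sum[OF sub, of "{..N}" "\<lambda>i. gauss n (real (Suc i))" a] by blast
    also have "(\<lambda>x. \<Sum>i\<le>N. a i * gauss n (real (Suc i)) x) = (\<lambda>x. gauss n 1 x * p (gauss n 1 x))"
      unfolding p gauss_power[symmetric] by (simp add: sum_distrib_left mult_ac)
    finally show ?thesis .
  qed
  have cont: "abs_l2 (\<lambda>x. gauss n 1 x * \<phi> (gauss n 1 x)) \<in> K" if \<phi>: "continuous_on UNIV \<phi>" for \<phi> :: "real \<Rightarrow> real"
  proof -
    have c01: "continuous_on {0..1} \<phi>" using \<phi> by (rule continuous_on_subset) simp
    have "\<exists>g. real_polynomial_function g \<and> (\<forall>x\<in>{0..1}. \<bar>\<phi> x - g x\<bar> < 1 / real (Suc k))" for k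
    proof -
      have "0 < 1 / real (Suc k)" by simp
      then show ?thesis
        using Stone_Weierstrass_real_polynomial_function[OF compact_Icc c01] by metis
    qed
    then obtain g where g: "\<And>k. real_polynomial_function (g k)"
      "\<And>k x. x \<in> {0..1} \<Longrightarrow> \<bar>\<phi> x - g k x\<bar> < 1 / real (Suc k)"
      by metis
    have "bounded (\<phi> ` {0..1})"
      using c01 by (intro compact_imp_bounded compact_continuous_image) auto
    then obtain B where "\<forall>y\<in>\<phi> ` {0..1}. norm y \<le> B"
      unfolding bounded_iff by blast
    then have B: "\<bar>\<phi> x\<bar> \<le> B" if "x \<in> {0..1}" for x
      using that by auto
    have gm: "g k \<in> borel_measurable borel" for k
      using g(1)[of k] by (auto simp: real_polynomial_function_iff_sum)
    have \<phi>m: "\<phi> \<in> borel_measurable borel"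
      using \<phi> by (rule borel_measurable_continuous_onI)
    have lim: "(\<lambda>k. abs_l2 (\<lambda>x. gauss n 1 x * g k (gauss n 1 x))) \<longlonglongrightarrow> abs_l2 (\<lambda>x. gauss n 1 x * \<phi> (gauss n 1 x))"
    proof (rule l2_dominated_convergence(3))
      show "sqr (\<lambda>x. (B + 1) * gauss n 1 x)"
        by (intro sqr_scale sqr_gauss n) simp
      show "AE x in hl. (\<lambda>k. gauss n 1 x * g k (gauss n 1 x)) \<longlonglongrightarrow> gauss n 1 x * \<phi> (gauss n 1 x)"
      proof (intro AE_I2 tendsto_mult tendsto_const)
        fix x
        show "(\<lambda>k. g k (gauss n 1 x)) \<longlonglongrightarrow> \<phi> (gauss n 1 x)"
        proof (rule LIM_zero_cancel, rule Lim_null_comparison)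
          show "\<forall>\<^sub>F k in sequentially. norm (g k (gauss n 1 x) - \<phi> (gauss n 1 x)) \<le> 1 / real (Suc k)"
            using g(2)[OF g1[of x]] by (intro always_eventually) (auto simp: abs_minus_commute less_imp_le)
          show "(\<lambda>k. 1 / real (Suc k)) \<longlonglongrightarrow> 0"
            using LIMSEQ_inverse_real_of_nat by (simp add: inverse_eq_divide)
        qed
      qed
      show "AE x in hl. \<bar>gauss n 1 x * g k (gauss n 1 x)\<bar> \<le> (B + 1) * gauss n 1 x" for k
      proof (rule AE_I2)
        fix x
        have "1 / real (Suc k) \<le> 1" by simp
        with g(2)[OF g1[of x], of k] B[OF g1[of x]] have "\<bar>g k (gauss n 1 x)\<bar> \<le> B + 1"
          by linarith
        then show "\<bar>gauss n 1 x * g k (gauss n 1 x)\<bar> \<le> (B + 1) * gauss n 1 x"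
          using gauss_pos[of n 1 x] by (simp add: abs_mult mult.commute mult_right_mono)
      qed
    qed (use gm \<phi>m in measurable)
    show ?thesis
      by (rule closed_sequentially[OF cl _ lim]) (rule poly[OF g(1)])
  qed
  have "chi a \<in> K" if a: "a > 0" for a
  proof -
    define u where "u = gauss n 1 a"
    have u: "u > 0" by (simp add: u_def gauss_pos)
    \<comment> \<open>A continuous approximation of 1/v on v >= u and of 0 on v < u, so that v times
      it tends to the indicator of \<open>u \<le> v\<close>. The \<open>max\<close> keeps the
      quotient bounded by 1/u.\<close>
    define \<phi> where "\<phi> m v = 1 / max v u * min 1 (max 0 (1 - real m * (u - v)))" for m :: nat and v :: real
    have c: "continuous_on UNIV (\<phi> m)" for m
      unfolding \<phi>_def using u by (intro continuous_intros) auto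
    have [measurable]: "\<phi> m \<in> borel_measurable borel" for m
      using c by (rule borel_measurable_continuous_onI)
    have \<phi>_bd: "\<bar>\<phi> m v\<bar> \<le> 1 / u" for m v
    proof -
      have "\<phi> m v \<le> 1 / u * 1"
        unfolding \<phi>_def using u by (intro mult_mono divide_left_mono) auto
      moreover have "0 \<le> \<phi> m v"
        unfolding \<phi>_def using u by (intro mult_nonneg_nonneg divide_nonneg_nonneg) auto
      ultimately show ?thesis by simp
    qed
    have lim: "(\<lambda>m. abs_l2 (\<lambda>x. gauss n 1 x * \<phi> m (gauss n 1 x))) \<longlonglongrightarrow> abs_l2 (indicator {0<..a})"
    proof (rule l2_dominated_convergence(3))
      show "sqr (\<lambda>x. (1 / u) * gauss n 1 x)"
        by (intro sqr_scale sqr_gauss n) simp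
      show "AE x in hl. (\<lambda>m. gauss n 1 x * \<phi> m (gauss n 1 x)) \<longlonglongrightarrow> indicator {0<..a} x"
        unfolding AE_hl
      proof (intro AE_I2 impI)
        fix x :: real assume x: "0 < x"
        define v where "v = gauss n 1 x"
        have v: "v > 0" by (simp add: v_def gauss_pos)
        show "(\<lambda>m. gauss n 1 x * \<phi> m (gauss n 1 x)) \<longlonglongrightarrow> indicator {0<..a} x"
        proof (cases "x \<le> a")
          case True
          then have "u \<le> v"
            using x n by (simp add: u_def v_def gauss_def power_mono)
          have "v * \<phi> m v = 1" for m
          proof -
            have "real m * (u - v) \<le> 0"
              using \<open>u \<le> v\<close> by (intro mult_nonneg_nonpos) auto
            then show ?thesis
              using v \<open>u \<le> v\<close> by (simp add: \<phi>_def max_def min_def)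
          qed
          then show ?thesis using True x by (simp add: v_def indicator_def)
        next
          case False
          then have "a ^ (2 * n) < x ^ (2 * n)"
            using a n by (intro power_strict_mono) auto
          then have uv: "v < u" by (simp add: u_def v_def gauss_def)
          obtain N where N: "1 / (u - v) < real N" using reals_Archimedean2 by blast
          have "\<forall>\<^sub>F m in sequentially. v * \<phi> m v = 0"
            unfolding eventually_sequentially
          proof (intro exI[of _ N] allI impI)
            fix m assume "N \<le> m"
            then have "1 / (u - v) < real m" using N by linarith
            then have "1 < real m * (u - v)" using uv by (simp add: field_simps)
            then show "v * \<phi> m v = 0" by (simp add: \<phi>_def)
          qed
          then have "(\<lambda>m. v * \<phi> m v) \<longlonglongrightarrow> 0" by (rule tendsto_eventually)
          then show ?thesis using False by (simp add: v_def indicator_def)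
        qed
      qed
      show "AE x in hl. \<bar>gauss n 1 x * \<phi> m (gauss n 1 x)\<bar> \<le> (1 / u) * gauss n 1 x" for m
      proof (rule AE_I2)
        fix x
        have "\<bar>\<phi> m (gauss n 1 x)\<bar> * gauss n 1 x \<le> (1 / u) * gauss n 1 x"
          using gauss_pos[of n 1 x] by (intro mult_right_mono \<phi>_bd) auto
        then show "\<bar>gauss n 1 x * \<phi> m (gauss n 1 x)\<bar> \<le> (1 / u) * gauss n 1 x"
          using gauss_pos[of n 1 x] by (simp add: abs_mult mult.commute)
      qed
    qed measurable
    show ?thesis
      unfolding chi_def by (rule closed_sequentially[OF cl _ lim]) (rule cont[OF c])
  qed
  then have "x \<in> K" for x
    by (rule closed_subspace_l2_UNIV[OF sub cl])
  then show ?thesis by (auto simp: K_def)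
qed

section \<open>The isometric involution A\<close>

definition G_scale :: "nat \<Rightarrow> real \<Rightarrow> real" where
  "G_scale n s = (2 * real n * s) powr (- mu n)"

text \<open>Together with \<open>G_scale\<close> this is the right side of
  \<open>c_kernel_gauss_integral\<close>, doubled because an even function on the line is twice its
  half-line integral.\<close>

definition G_dual :: "nat \<Rightarrow> real \<Rightarrow> real" where
  "G_dual n s = 1 / (4 * (real n)\<^sup>2 * s)"

lemma G_dual_pos: "n \<ge> 1 \<Longrightarrow> s > 0 \<Longrightarrow> G_dual n s > 0"
  by (simp add: G_dual_def)

lemma G_dual_dual: "n \<ge> 1 \<Longrightarrow> s > 0 \<Longrightarrow> G_dual n (G_dual n s) = s"
  by (simp add: G_dual_def field_simps)

lemma G_scale_dual:
  assumes "n \<ge> 1" "s > 0"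
  shows "G_scale n s * G_scale n (G_dual n s) = 1"
proof -
  have "G_scale n s * G_scale n (G_dual n s) = ((2 * real n * s) * (2 * real n * G_dual n s)) powr (- mu n)"
    using assms G_dual_pos[OF assms] by (simp only: G_scale_def powr_mult)
  also have "(2 * real n * s) * (2 * real n * G_dual n s) = 1"
    using assms by (simp add: G_dual_def field_simps power2_eq_square)
  finally show ?thesis by simp
qed

lemma G_scale_mult:
  assumes "n \<ge> 1" "s > 0" "r > 0"
  shows "G_scale n s * G_scale n r = (4 * (real n)\<^sup>2 * s * r) powr (- mu n)"
proof -
  have "G_scale n s * G_scale n r = ((2 * real n * s) * (2 * real n * r)) powr (- mu n)"
    using assms by (simp only: G_scale_def powr_mult)
  also have "(2 * real n * s) * (2 * real n * r) = 4 * (real n)\<^sup>2 * s * r"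
    by (simp add: power2_eq_square)
  finally show ?thesis .
qed

definition cos_op :: "nat \<Rightarrow> l2 \<Rightarrow> l2" where
  "cos_op n = (SOME U. linear U \<and> (\<forall>x y. inner (U x) (U y) = inner x y) \<and>
     (\<forall>s>0. U (G n s) = G_scale n s *\<^sub>R G n (G_dual n s)))"

text \<open>Gram matrices: the inner product of two Gaussians depends on s + r to the power
  \<open>- mu n\<close>. The dual parameters add up to (s + r) / (4 n^2 s r), and the product of the
  two scale factors cancels exactly that denominator.\<close>

lemma cos_op_exists:
  assumes n: "n \<ge> 1"
  shows "linear (cos_op n) \<and> (\<forall>x y. inner (cos_op n x) (cos_op n y) = inner x y) \<and>
     (\<forall>s>0. cos_op n (G n s) = G_scale n s *\<^sub>R G n (G_dual n s))"
proof -
  have iso: "inner (G_scale n s *\<^sub>R G n (G_dual n s)) (G_scale n r *\<^sub>R G n (G_dual n r)) = inner (G n s) (G n r)"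
    if "s \<in> {0<..}" "r \<in> {0<..}" for s r
  proof -
    define D where "D = 4 * (real n)\<^sup>2 * s * r"
    have sr: "s > 0" "r > 0" "D > 0" using that n by (auto simp: D_def)
    have "G_dual n s + G_dual n r = (s + r) / D"
      using sr n by (simp add: G_dual_def D_def field_simps)
    moreover have "((s + r) / D) powr mu n = (s + r) powr mu n / D powr mu n"
      by (rule powr_divide)
    ultimately have *: "D powr (- mu n) / (G_dual n s + G_dual n r) powr mu n = 1 / (s + r) powr mu n"
      using sr by (simp add: powr_minus)
    have "inner (G_scale n s *\<^sub>R G n (G_dual n s)) (G_scale n r *\<^sub>R G n (G_dual n r))
        = (G_scale n s * G_scale n r) * (Gamma (mu n) / (2 * real n * (G_dual n s + G_dual n r) powr mu n))"
      by (simp add: inner_G[OF n G_dual_pos[OF n sr(1)] G_dual_pos[OF n sr(2)]])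
    also have "\<dots> = Gamma (mu n) / (2 * real n) * (D powr (- mu n) / (G_dual n s + G_dual n r) powr mu n)"
      using G_scale_mult[OF n sr(1,2)] by (simp add: D_def)
    also have "\<dots> = inner (G n s) (G n r)"
      unfolding * using inner_G[OF n sr(1,2)] by simp
    finally show ?thesis .
  qed
  obtain U where "linear U" "\<And>x y. inner (U x) (U y) = inner x y"
    "\<And>s. s \<in> {0<..} \<Longrightarrow> U (G n s) = G_scale n s *\<^sub>R G n (G_dual n s)"
    using isometry_extension[OF iso dense_G[OF n]] by auto
  then have "\<exists>U. linear U \<and> (\<forall>x y. inner (U x) (U y) = inner x y) \<and>
     (\<forall>s>0. U (G n s) = G_scale n s *\<^sub>R G n (G_dual n s))" by auto
  from someI_ex[OF this] show ?thesis unfolding cos_op_def .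
qed

lemmas cos_op_linear = conjunct1[OF cos_op_exists]
lemmas cos_op_inner = conjunct1[OF conjunct2[OF cos_op_exists], rule_format]
lemmas cos_op_G = conjunct2[OF conjunct2[OF cos_op_exists], rule_format]

lemma cos_op_bounded_linear: "n \<ge> 1 \<Longrightarrow> bounded_linear (cos_op n)"
  by (intro isometry_bounded_linear cos_op_linear cos_op_inner)

lemma cos_op_cos_op:
  assumes n: "n \<ge> 1"
  shows "cos_op n (cos_op n x) = x"
proof (rule bounded_linear_eq_on_dense[OF dense_G[OF n]])
  show "bounded_linear (\<lambda>x. cos_op n (cos_op n x))"
    by (intro bounded_linear_compose[OF cos_op_bounded_linear[OF n]] cos_op_bounded_linear n)
  show "bounded_linear (\<lambda>x :: l2. x)" by (rule bounded_linear_ident)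
  fix z assume "z \<in> G n ` {0<..}"
  then obtain s where s: "s > 0" "z = G n s" by auto
  then show "cos_op n (cos_op n z) = z"
    using n by (simp add: cos_op_G linear_scale[OF cos_op_linear] G_dual_pos G_dual_dual G_scale_dual)
qed

lemma cos_op_sym: "n \<ge> 1 \<Longrightarrow> inner (cos_op n x) y = inner x (cos_op n y)"
  using cos_op_inner[of n x "cos_op n y"] by (simp add: cos_op_cos_op)

section \<open>The operator A on indicators of intervals\<close>

definition cos_int :: "nat \<Rightarrow> real \<Rightarrow> real \<Rightarrow> real" where
  "cos_int n a w = 2 * (LINT t|lborel. indicator {0<..a} t * c_kernel n (w * t))"

lemma cos_int_measurable [measurable]: "cos_int n a \<in> borel_measurable borel"
  unfolding cos_int_def[abs_def] by measurable

lemma c_kernel_bound_interval: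
  assumes n: "n \<ge> 1" and t: "0 < t" "t \<le> a"
  shows "\<bar>c_kernel n (w * t)\<bar> \<le> q_const n * exp (a ^ (2 * n) / (4 * (real n)\<^sup>2) * w ^ (2 * n))"
proof -
  have "(w * t) ^ (2 * n) \<le> a ^ (2 * n) * w ^ (2 * n)"
    unfolding power_mult_distrib mult.commute[of "w ^ (2 * n)"]
    using t by (intro mult_right_mono power_mono zero_le_even_power) auto
  then have "(w * t) ^ (2 * n) / (4 * (real n)\<^sup>2) \<le> a ^ (2 * n) / (4 * (real n)\<^sup>2) * w ^ (2 * n)"
    by (simp add: divide_right_mono)
  then have "q_const n * exp ((w * t) ^ (2 * n) / (4 * (real n)\<^sup>2))
      \<le> q_const n * exp (a ^ (2 * n) / (4 * (real n)\<^sup>2) * w ^ (2 * n))"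
    using q_const_pos[OF n] by (intro mult_left_mono) auto
  with c_kernel_bound[OF n, of "w * t"] show ?thesis by linarith
qed

lemma integrable_indicator_Ioc: "integrable lborel (\<lambda>t. indicator {0<..a::real} t :: real)"
proof (cases "0 \<le> a")
  case True
  then show ?thesis by (intro integrable_real_indicator) simp_all
next
  case False
  then show ?thesis by simp
qed

lemma c_kernel_integrable_interval:
  assumes n: "n \<ge> 1"
  shows "integrable lborel (\<lambda>t. indicator {0<..a} t * c_kernel n (w * t))"
proof (rule Bochner_Integration.integrable_bound)
  define B where "B = q_const n * exp (a ^ (2 * n) / (4 * (real n)\<^sup>2) * w ^ (2 * n))"
  show "integrable lborel (\<lambda>t. indicator {0<..a} t * B)"
    by (intro integrable_mult_left integrable_indicator_Ioc)
  show "AE t in lborel. norm (indicator {0<..a} t * c_kernel n (w * t)) \<le> norm (indicator {0<..a} t * B)"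
    using c_kernel_bound_interval[OF n, of _ a w] q_const_pos[OF n]
    by (intro AE_I2) (auto simp: indicator_def B_def)
qed measurable

lemma cos_int_bound:
  assumes n: "n \<ge> 1" and a: "a > 0"
  shows "\<bar>cos_int n a w\<bar> \<le> 2 * a * q_const n * exp (a ^ (2 * n) / (4 * (real n)\<^sup>2) * w ^ (2 * n))"
proof -
  define B where "B = q_const n * exp (a ^ (2 * n) / (4 * (real n)\<^sup>2) * w ^ (2 * n))"
  have "\<bar>LINT t|lborel. indicator {0<..a} t * c_kernel n (w * t)\<bar>
      \<le> (LINT t|lborel. \<bar>indicator {0<..a} t * c_kernel n (w * t)\<bar>)"
    by (rule integral_abs_bound)
  also have "\<dots> \<le> (LINT t|lborel. indicator {0<..a} t * B)"
  proof (rule integral_mono)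
    show "integrable lborel (\<lambda>t. \<bar>indicator {0<..a} t * c_kernel n (w * t)\<bar>)"
      by (intro integrable_abs c_kernel_integrable_interval n)
    show "integrable lborel (\<lambda>t. indicator {0<..a} t * B)"
      by (intro integrable_mult_left integrable_indicator_Ioc)
    show "\<bar>indicator {0<..a} t * c_kernel n (w * t)\<bar> \<le> indicator {0<..a} t * B" for t
      using c_kernel_bound_interval[OF n, of t a w] by (auto simp: indicator_def B_def)
  qed
  also have "\<dots> = a * B"
    using a by simp
  finally show ?thesis by (simp add: cos_int_def B_def abs_mult)
qed

lemma integrable_prod_mult:
  fixes g h :: "real \<Rightarrow> real"
  assumes "integrable lborel g" "integrable lborel h"
  shows "integrable (lborel \<Otimes>\<^sub>M lborel) (\<lambda>p. g (fst p) * h (snd p))"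
proof (rule lborel_pair.Fubini_integrable)
  have [measurable]: "g \<in> borel_measurable borel" "h \<in> borel_measurable borel"
    using assms by auto
  show "(\<lambda>p. g (fst p) * h (snd p)) \<in> borel_measurable (lborel \<Otimes>\<^sub>M lborel)"
    by measurable
  show "integrable lborel (\<lambda>x. LINT y|lborel. norm (g (fst (x, y)) * h (snd (x, y))))"
    using assms by (simp add: abs_mult)
  show "AE x in lborel. integrable lborel (\<lambda>y. g (fst (x, y)) * h (snd (x, y)))"
    using assms by simp
qed

text \<open>Fubini, followed by Weber's integral in the frequency variable. The lower bound on
  \<open>r\<close> lets \<open>gauss n r\<close> absorb the growth of the kernel for t up to a and
  still leaves a factor \<open>gauss n 1\<close> as integrable majorant.\<close>

lemma cos_int_gauss:
  assumes n: "n \<ge> 1" and a: "a > 0" and r: "r \<ge> a ^ (2 * n) / (4 * (real n)\<^sup>2) + 1"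
  shows "(LINT w|hl. cos_int n a w * gauss n r w)
    = G_scale n r * (LINT t|lborel. indicator {0<..a} t * gauss n (G_dual n r) t)"
proof -
  have "0 \<le> a ^ (2 * n) / (4 * (real n)\<^sup>2)" using a by simp
  then have r0: "r > 0" using r by linarith
  define f where "f w t = 2 * (indicator {0<..} w * gauss n r w * (indicator {0<..a} t * c_kernel n (w * t)))" for w t :: real
  have fm: "case_prod f \<in> borel_measurable (lborel \<Otimes>\<^sub>M lborel)"
    unfolding f_def by measurable
  have "integrable (lborel \<Otimes>\<^sub>M lborel) (case_prod f)"
  proof (rule Bochner_Integration.integrable_bound)
    have "integrable hl (gauss n 1)"
      using gauss_integral[OF n, of 1] by (auto simp: has_bochner_integral_iff)
    then have "integrable lborel (\<lambda>w. indicator {0<..} w * gauss n 1 w)"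
      by (simp add: integrable_hl)
    then show "integrable (lborel \<Otimes>\<^sub>M lborel)
        (\<lambda>p. (2 * q_const n * (indicator {0<..} (fst p) * gauss n 1 (fst p))) * indicator {0<..a} (snd p))"
      by (intro integrable_prod_mult integrable_mult_right integrable_indicator_Ioc)
    have "\<bar>f w t\<bar> \<le> 2 * q_const n * (indicator {0<..} w * gauss n 1 w) * indicator {0<..a} t" for w t
    proof (cases "t \<in> {0<..a} \<and> w > 0")
      case True
      define k where "k = a ^ (2 * n) / (4 * (real n)\<^sup>2)"
      have "gauss n r w * \<bar>c_kernel n (w * t)\<bar> \<le> gauss n (k + 1) w * (q_const n * exp (k * w ^ (2 * n)))"
        using True r c_kernel_bound_interval[OF n, of t a w] gauss_pos[of n r w]
        by (intro mult_mono gauss_antimono) (auto simp: k_def gauss_pos less_imp_le)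
      also have "\<dots> = q_const n * gauss n 1 w"
        by (simp add: gauss_def algebra_simps flip: exp_add)
      finally show ?thesis
        using True gauss_pos[of n r w] by (simp add: f_def abs_mult)
    next
      case False
      then show ?thesis by (auto simp: f_def indicator_def)
    qed
    then show "AE p in lborel \<Otimes>\<^sub>M lborel. norm (case_prod f p) \<le> norm ((2 * q_const n * (indicator {0<..} (fst p) * gauss n 1 (fst p))) * indicator {0<..a} (snd p))"
      by (intro AE_I2) (auto simp: case_prod_beta intro: order_trans[OF _ abs_ge_self])
  qed (fact fm)
  then have Fub: "(LINT w|lborel. LINT t|lborel. f w t) = (LINT t|lborel. LINT w|lborel. f w t)"
    by (rule lborel_pair.Fubini_integral[symmetric])
  have "(LINT w|hl. cos_int n a w * gauss n r w) = (LINT w|lborel. LINT t|lborel. f w t)"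
  proof -
    have "(LINT t|lborel. f w t) = indicator {0<..} w *\<^sub>R (cos_int n a w * gauss n r w)" for w
      by (simp add: f_def cos_int_def)
    then show ?thesis by (simp add: integral_hl)
  qed
  also have "\<dots> = (LINT t|lborel. LINT w|lborel. f w t)" by (rule Fub)
  also have "\<dots> = (LINT t|lborel. G_scale n r * (indicator {0<..a} t * gauss n (G_dual n r) t))"
  proof (rule Bochner_Integration.integral_cong[OF refl])
    fix t :: real
    have "(LINT w|lborel. f w t) = 2 * indicator {0<..a} t * (LINT w|lborel. indicator {0<..} w * (c_kernel n (t * w) * gauss n r w))"
      by (simp add: f_def mult_ac flip: integral_mult_right_zero)
    also have "(LINT w|lborel. indicator {0<..} w * (c_kernel n (t * w) * gauss n r w))
        = (LINT w|hl. c_kernel n (t * w) * gauss n r w)"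
      by (simp add: integral_hl)
    also have "\<dots> = G_scale n r / 2 * gauss n (G_dual n r) t"
      unfolding c_kernel_gauss_integral[OF n r0] G_scale_def G_dual_def ..
    finally show "(LINT w|lborel. f w t) = G_scale n r * (indicator {0<..a} t * gauss n (G_dual n r) t)"
      by simp
  qed
  finally show ?thesis by simp
qed

text \<open>\<^term>\<open>cos_int n a\<close> is not visibly square integrable, but its product with a narrow
  Gaussian is, and density of the Gaussians can be applied to that product.\<close>

lemma cos_op_chi:
  assumes n: "n \<ge> 1" and a: "a > 0"
  shows "sqr (cos_int n a)" "cos_op n (chi a) = abs_l2 (cos_int n a)"
proof -
  define k where "k = a ^ (2 * n) / (4 * (real n)\<^sup>2)"
  have k: "k \<ge> 0" using a by (simp add: k_def)
  define g where "g = gauss n (k + 1)"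
  define u where "u = rep_l2 (cos_op n (chi a))"
  have u: "sqr u" "abs_l2 u = cos_op n (chi a)" by (simp_all add: u_def sqr_rep abs_rep_l2)
  have [measurable]: "u \<in> borel_measurable borel" "g \<in> borel_measurable borel"
    using u by (simp_all add: g_def sqr_def)
  have g: "0 < g x" "g x \<le> 1" for x
    using k by (simp_all add: g_def gauss_pos gauss_le_1)
  have su: "sqr (\<lambda>x. u x * g x)"
  proof (rule sqr_bound[OF u(1)])
    show "AE x in hl. \<bar>u x * g x\<bar> \<le> \<bar>u x\<bar>"
    proof (rule AE_I2)
      fix x
      show "\<bar>u x * g x\<bar> \<le> \<bar>u x\<bar>"
        unfolding abs_mult using g[of x] by (intro mult_left_le) auto
    qed
  qed measurable
  have sU: "sqr (\<lambda>x. cos_int n a x * g x)"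
  proof (rule sqr_bound)
    show "sqr (\<lambda>x. 2 * a * q_const n * gauss n 1 x)"
      by (intro sqr_scale sqr_gauss n) simp
    show "AE x in hl. \<bar>cos_int n a x * g x\<bar> \<le> \<bar>2 * a * q_const n * gauss n 1 x\<bar>"
    proof (rule AE_I2)
      fix x
      have "\<bar>cos_int n a x * g x\<bar> \<le> (2 * a * q_const n * exp (k * x ^ (2 * n))) * g x"
        unfolding abs_mult using g[of x] cos_int_bound[OF n a, of x]
        by (intro mult_mono) (auto simp: k_def)
      also have "\<dots> = 2 * a * q_const n * gauss n 1 x"
        by (simp add: g_def gauss_def algebra_simps flip: exp_add)
      finally show "\<bar>cos_int n a x * g x\<bar> \<le> \<bar>2 * a * q_const n * gauss n 1 x\<bar>"
        by linarith
    qed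
  qed measurable
  have "abs_l2 (\<lambda>x. u x * g x) = abs_l2 (\<lambda>x. cos_int n a x * g x)"
  proof (rule inner_eq_imp_eq[OF dense_G[OF n]])
    fix z assume "z \<in> G n ` {0<..}"
    then obtain s where s: "s > 0" "z = G n s" by auto
    \<comment> \<open>The weight \<open>g\<close> and the test function \<open>gauss n s\<close>
      merge into \<open>gauss n r\<close>, and \<open>r\<close> is above the threshold of
      \<open>cos_int_gauss\<close> for every s > 0.\<close>
    define r where "r = k + 1 + s"
    have r: "r > 0" using k s by (simp add: r_def)
    have gr: "v * g x * gauss n s x = v * gauss n r x" for v x
      by (simp add: g_def r_def gauss_add)
    have "inner (abs_l2 (\<lambda>x. u x * g x)) z = inner (abs_l2 u) (G n r)"
      using s su u(1) r n by (simp add: G_def inner_abs_l2 sqr_gauss gr)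
    also have "\<dots> = inner (chi a) (G_scale n r *\<^sub>R G n (G_dual n r))"
      by (simp only: u(2) cos_op_sym[OF n] cos_op_G[OF n r])
    also have "\<dots> = G_scale n r * (LINT t|lborel. indicator {0<..a} t * gauss n (G_dual n r) t)"
      using n r by (simp add: G_def inner_commute[of "chi a"] inner_chi sqr_gauss G_dual_pos)
    also have "\<dots> = (LINT w|hl. cos_int n a w * gauss n r w)"
      using s by (intro cos_int_gauss[symmetric] n a) (simp add: r_def k_def)
    also have "\<dots> = inner (abs_l2 (\<lambda>x. cos_int n a x * g x)) z"
      using s sU n by (simp add: G_def inner_abs_l2 sqr_gauss gr)
    finally show "inner (abs_l2 (\<lambda>x. u x * g x)) z = inner (abs_l2 (\<lambda>x. cos_int n a x * g x)) z" .
  qed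
  then have "AE x in hl. u x * g x = cos_int n a x * g x"
    using abs_l2_eq_iff[OF su sU] by simp
  then have ae: "AE x in hl. u x = cos_int n a x"
  proof eventually_elim
    case (elim x)
    then show ?case using g(1)[of x] by simp
  qed
  show "sqr (cos_int n a)"
    by (rule sqr_bound[OF u(1)]) (use ae in \<open>auto elim: eventually_mono\<close>)
  then show "cos_op n (chi a) = abs_l2 (cos_int n a)"
    using ae abs_l2_eq_iff[OF u(1)] by (simp add: u(2))
qed

section \<open>The logarithmic kernel\<close>

lemma lborel_split_halflines:
  fixes f :: "real \<Rightarrow> 'a::{banach, second_countable_topology}"
  assumes f [measurable]: "f \<in> borel_measurable borel"
    and int: "integrable hl f" "integrable hl (\<lambda>x. f (- x))"
  shows "integrable lborel f" "integral\<^sup>L lborel f = integral\<^sup>L hl f + integral\<^sup>L hl (\<lambda>x. f (- x))"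
proof -
  have 1: "integrable lborel (\<lambda>x. indicator {0<..} x *\<^sub>R f x)"
    using int(1) by (simp add: integrable_hl)
  have 2: "integrable lborel (\<lambda>x. indicator {0<..} x *\<^sub>R f (- x))"
    using int(2) by (simp add: integrable_hl)
  have 3: "integrable lborel (\<lambda>x. indicator {..<0} x *\<^sub>R f x)"
    using lborel_integrable_real_affine[OF 2, of "-1" 0] by (simp add: indicator_def)
  have 4: "(LINT x|lborel. indicator {..<0} x *\<^sub>R f x) = (LINT x|lborel. indicator {0<..} x *\<^sub>R f (- x))"
    using lborel_integral_real_affine[of "-1" "\<lambda>x. indicator {0<..} x *\<^sub>R f (- x)" 0] by (simp add: indicator_def)
  have ae: "AE x in lborel. f x = indicator {0<..} x *\<^sub>R f x + indicator {..<0} x *\<^sub>R f x"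
    using AE_lborel_singleton[of "0::real"] by eventually_elim (auto simp: indicator_def)
  show "integrable lborel f"
    using Bochner_Integration.integrable_add[OF 1 3] integrable_cong_AE[OF _ _ ae] by simp
  have "integral\<^sup>L lborel f = (LINT x|lborel. indicator {0<..} x *\<^sub>R f x + indicator {..<0} x *\<^sub>R f x)"
    using ae by (intro integral_cong_AE) auto
  also have "\<dots> = integral\<^sup>L hl f + integral\<^sup>L hl (\<lambda>x. f (- x))"
    using 1 3 4 by (simp add: integral_hl)
  finally show "integral\<^sup>L lborel f = integral\<^sup>L hl f + integral\<^sup>L hl (\<lambda>x. f (- x))" .
qed

lemma integrable_hl_of_lborel:
  fixes f :: "real \<Rightarrow> 'a::{banach, second_countable_topology}"
  assumes "integrable lborel f"
  shows "integrable hl f" "integrable hl (\<lambda>x. f (- x))"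
proof -
  have [measurable]: "f \<in> borel_measurable borel" using assms by auto
  have *: "integrable lborel (\<lambda>x. indicator {0<..} x *\<^sub>R g x)"
    if "integrable lborel g" for g :: "real \<Rightarrow> 'a"
    using that by (intro integrable_mult_indicator) auto
  show "integrable hl f" using *[OF assms] by (simp add: integrable_hl)
  show "integrable hl (\<lambda>x. f (- x))"
    using *[OF lborel_integrable_real_affine[OF assms, of "-1" 0]] by (simp add: integrable_hl)
qed

lemma lborel_even:
  fixes f :: "real \<Rightarrow> 'a::{banach, second_countable_topology}"
  assumes "f \<in> borel_measurable borel" "\<And>x. f (- x) = f x" "integrable hl f"
  shows "integrable lborel f" "integral\<^sup>L lborel f = 2 *\<^sub>R integral\<^sup>L hl f"
  using lborel_split_halflines[of f] assms by (simp_all add: scaleR_2)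

text \<open>Since \<open>x / 0 = 0\<close> and \<open>ln 0 = 0\<close>, oddness and scaling of \<open>ell\<close> hold at the singularities, too.\<close>

definition ell :: "real \<Rightarrow> real \<Rightarrow> real" where
  "ell p s = ln (\<bar>p + s\<bar> / \<bar>p - s\<bar>)"

lemma ell_measurable [measurable]:
  assumes [measurable]: "f \<in> borel_measurable M" "g \<in> borel_measurable M"
  shows "(\<lambda>x. ell (f x) (g x)) \<in> borel_measurable M"
  unfolding ell_def by measurable

lemma ell_commute: "ell p s = ell s p"
  by (simp add: ell_def abs_minus_commute add.commute)

lemma ln_inverse_total: "ln (inverse x) = - ln (x::real)" if "x \<ge> 0"
  using that by (cases "x = 0") (auto simp: ln_inverse)

lemma ell_minus_left: "ell (- p) s = - ell p s"
proof -
  have "\<bar>- p + s\<bar> / \<bar>- p - s\<bar> = inverse (\<bar>p + s\<bar> / \<bar>p - s\<bar>)"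
    by (simp add: abs_minus_commute add.commute)
  then show ?thesis unfolding ell_def by (simp only: ln_inverse_total abs_ge_zero divide_nonneg_nonneg)
qed

lemma ell_minus_right: "ell p (- s) = - ell p s"
  using ell_minus_left[of s p] by (simp only: ell_commute[of p])

lemma ell_zero [simp]: "ell 0 s = 0" "ell s 0 = 0"
  by (simp_all add: ell_def)

lemma ell_nonneg:
  assumes "p \<ge> 0" "s \<ge> 0"
  shows "0 \<le> ell p s"
proof (cases "p = s")
  case False
  then have "1 \<le> \<bar>p + s\<bar> / \<bar>p - s\<bar>" using assms by (auto simp: field_simps)
  then show ?thesis by (simp only: ell_def ln_ge_zero)
qed (simp add: ell_def)

lemma ell_scale: "c \<noteq> 0 \<Longrightarrow> ell (c * p) (c * s) = ell p s"
  by (simp add: ell_def abs_mult flip: distrib_left right_diff_distrib)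

text \<open>Euler's sum of inverse squares grouped in pairs; the even terms make up a quarter of the
  whole and are subtracted.\<close>

lemma sums_odd_inverse_squares: "(\<lambda>k. 1 / (2 * real k + 1)\<^sup>2) sums (pi\<^sup>2 / 8)"
proof -
  define f :: "nat \<Rightarrow> real" where "f n = 1 / (real n + 1)\<^sup>2" for n
  have f: "f sums (pi\<^sup>2 / 6)" using inverse_squares_sums by (simp add: f_def[abs_def] add_ac)
  have "(\<lambda>n. sum f {n * 2..<n * 2 + 2}) sums (pi\<^sup>2 / 6)" by (rule sums_group[OF f]) simp
  moreover have "sum f {n * 2..<n * 2 + 2} = f (2 * n) + f (2 * n + 1)" for n
    by (simp add: numeral_2_eq_2 mult.commute)
  ultimately have 1: "(\<lambda>n. f (2 * n) + f (2 * n + 1)) sums (pi\<^sup>2 / 6)" by simp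
  have 2: "(\<lambda>n. f n / 4) sums (pi\<^sup>2 / 6 / 4)" using f by (rule sums_divide)
  have "f (2 * n) + f (2 * n + 1) - f n / 4 = 1 / (2 * real n + 1)\<^sup>2" for n
  proof -
    have "f (2 * n + 1) = 1 / (2 * (real n + 1))\<^sup>2" by (simp add: f_def add_ac)
    also have "\<dots> = f n / 4" unfolding f_def power_mult_distrib by simp
    finally show ?thesis by (simp add: f_def)
  qed
  with sums_diff[OF 1 2] show ?thesis by simp
qed

text \<open>Twice the artanh series, divided by s: \<open>ell 1 s\<close> is the logarithm of (1 +
  s) / (1 - s).\<close>

lemma ell_1_series:
  assumes "0 < s" "s < 1"
  shows "(\<lambda>k. 2 / (2 * real k + 1) * s ^ (2 * k)) sums (ell 1 s / s)"
proof -
  define x where "x = (1 + s) / (1 - s)"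
  have x: "x > 0" using assms by (simp add: x_def)
  have "(x - 1) / (x + 1) = s" using assms by (simp add: x_def field_simps)
  then have "(\<lambda>k. 2 * s ^ (2 * k + 1) / real (2 * k + 1)) sums ln x"
    using ln_series_quadratic[OF x] by simp
  moreover have "ln x = ell 1 s" using assms by (simp add: x_def ell_def)
  ultimately have "(\<lambda>k. 2 * s ^ (2 * k + 1) / real (2 * k + 1) / s) sums (ell 1 s / s)"
    by (intro sums_divide) simp
  moreover have "2 * s ^ (2 * k + 1) / real (2 * k + 1) / s = 2 / (2 * real k + 1) * s ^ (2 * k)" for k
    using assms by simp
  ultimately show ?thesis by simp
qed

lemma nn_integral_sums:
  fixes g :: "real \<Rightarrow> real"
  assumes f: "\<And>k. f k \<in> borel_measurable borel" "\<And>k s. s \<in> A \<Longrightarrow> 0 \<le> f k s"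
    and A: "A \<in> sets borel"
    and I: "\<And>k. (\<integral>\<^sup>+s. ennreal (f k s) * indicator A s \<partial>lborel) = ennreal (c k)"
    and sums: "\<And>s. s \<in> A \<Longrightarrow> (\<lambda>k. f k s) sums g s"
    and c: "\<And>k. 0 \<le> c k" "c sums C"
  shows "(\<integral>\<^sup>+s. ennreal (g s) * indicator A s \<partial>lborel) = ennreal C"
proof -
  have "ennreal (g s) * indicator A s = (\<Sum>k. ennreal (f k s) * indicator A s)" for s
    using suminf_ennreal_eq[OF f(2) sums, of s] by (cases "s \<in> A") auto
  then have "(\<integral>\<^sup>+s. ennreal (g s) * indicator A s \<partial>lborel)
      = (\<integral>\<^sup>+s. (\<Sum>k. ennreal (f k s) * indicator A s) \<partial>lborel)"
    by (simp only:)
  also have "\<dots> = (\<Sum>k. \<integral>\<^sup>+s. ennreal (f k s) * indicator A s \<partial>lborel)"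
    using f(1) A by (intro nn_integral_suminf) auto
  also have "\<dots> = ennreal C"
    unfolding I by (rule suminf_ennreal_eq[OF c])
  finally show ?thesis .
qed

text \<open>Termwise integration of \<open>ell_1_series\<close> gives 2 / (2k + 1)^2, and these sum
  to 2 (pi^2 / 8).\<close>

lemma nn_integral_ell_lower:
  "(\<integral>\<^sup>+s. ennreal (ell 1 s / s) * indicator {0<..<1} s \<partial>lborel) = ennreal (pi\<^sup>2 / 4)"
proof -
  define f where "f k s = 2 / (2 * real k + 1) * s ^ (2 * k)" for k and s :: real
  have [measurable]: "f k \<in> borel_measurable borel" for k unfolding f_def[abs_def] by measurable
  have f0: "0 \<le> f k s" for k s unfolding f_def by (intro mult_nonneg_nonneg zero_le_even_power) auto
  have I: "(\<integral>\<^sup>+s. ennreal (f k s) * indicator {0<..<1} s \<partial>lborel) = ennreal (2 / (2 * real k + 1)\<^sup>2)" for k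
  proof -
    have "AE s in lborel. ennreal (f k s) * indicator {0<..<1} s = ennreal (f k s) * indicator {0..1} s"
      using AE_lborel_singleton[of "0::real"] AE_lborel_singleton[of "1::real"]
      by eventually_elim (auto simp: indicator_def)
    then have "(\<integral>\<^sup>+s. ennreal (f k s) * indicator {0<..<1} s \<partial>lborel) = (\<integral>\<^sup>+s. ennreal (f k s) * indicator {0..1} s \<partial>lborel)"
      by (rule nn_integral_cong_AE)
    also have "\<dots> = ennreal (2 / (2 * real k + 1)\<^sup>2 * 1 ^ (2 * k + 1) - 2 / (2 * real k + 1)\<^sup>2 * 0 ^ (2 * k + 1))"
    proof (rule nn_integral_FTC_Icc)
      show "((\<lambda>s. 2 / (2 * real k + 1)\<^sup>2 * s ^ (2 * k + 1)) has_real_derivative f k s) (at s)" for s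
        unfolding f_def
        by (rule derivative_eq_intros refl)+ (simp add: power2_eq_square add.commute)
    qed (use f0 in auto)
    finally show ?thesis by simp
  qed
  show ?thesis
  proof (rule nn_integral_sums[where f = f, OF _ _ _ I])
    show "(\<lambda>k. f k s) sums (ell 1 s / s)" if "s \<in> {0<..<1}" for s
      using that ell_1_series[of s] by (simp add: f_def)
    show "(\<lambda>k. 2 / (2 * real k + 1)\<^sup>2) sums (pi\<^sup>2 / 4)"
      using sums_mult[OF sums_odd_inverse_squares, of 2] by simp
  qed (use f0 in auto)
qed

text \<open>Since \<open>ell 1 s = ell 1 (1 / s)\<close>, the same series in 1/s applies, with terms
  proportional to s^(-2k-2); they have the same integrals as on (0, 1).\<close>

lemma nn_integral_ell_upper:
  "(\<integral>\<^sup>+s. ennreal (ell 1 s / s) * indicator {1<..} s \<partial>lborel) = ennreal (pi\<^sup>2 / 4)"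
proof -
  define f where "f k s = 2 / (2 * real k + 1) * (1 / s ^ (2 * k + 2))" for k and s :: real
  have [measurable]: "f k \<in> borel_measurable borel" for k unfolding f_def[abs_def] by measurable
  have f0: "0 \<le> f k s" if "s > 0" for k s using that unfolding f_def by simp
  have I: "(\<integral>\<^sup>+s. ennreal (f k s) * indicator {1<..} s \<partial>lborel) = ennreal (2 / (2 * real k + 1)\<^sup>2)" for k
  proof -
    have "AE s in lborel. ennreal (f k s) * indicator {1<..} s = ennreal (f k s) * indicator {1..} s"
      using AE_lborel_singleton[of "1::real"]
      by eventually_elim (auto simp: indicator_def)
    then have "(\<integral>\<^sup>+s. ennreal (f k s) * indicator {1<..} s \<partial>lborel) = (\<integral>\<^sup>+s. ennreal (f k s) * indicator {1..} s \<partial>lborel)"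
      by (rule nn_integral_cong_AE)
    also have "\<dots> = ennreal (0 - (- (2 / (2 * real k + 1)\<^sup>2) * (1 / 1) ^ (2 * k + 1)))"
    proof (rule nn_integral_FTC_atLeast[where T = 0 and
            F = "\<lambda>s. - (2 / (2 * real k + 1)\<^sup>2) * (1 / s) ^ (2 * k + 1)"])
      show "DERIV (\<lambda>s. - (2 / (2 * real k + 1)\<^sup>2) * (1 / s) ^ (2 * k + 1)) s :> f k s" if "1 \<le> s" for s :: real
      proof -
        have s: "s \<noteq> 0" using that by simp
        have "DERIV (\<lambda>s. - (2 / (2 * real k + 1)\<^sup>2) * (1 / s) ^ (2 * k + 1)) s
            :> - (2 / (2 * real k + 1)\<^sup>2) * (real (2 * k + 1) * (1 / s) ^ (2 * k) * (- 1 / (s * s)))"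
          by (rule derivative_eq_intros refl s)+ (simp add: mult_ac)
        moreover have "- (2 / (2 * real k + 1)\<^sup>2) * (real (2 * k + 1) * (1 / s) ^ (2 * k) * (- 1 / (s * s))) = f k s"
        proof -
          have alg: "- (2 / c\<^sup>2) * (c * P * (- 1 / (s * s))) = 2 / c * (P * (1 / (s * s)))"
            if "c \<noteq> 0" for c P :: real
            using that by (simp add: power2_eq_square)
          have "(1 / s) ^ (2 * k) * (1 / (s * s)) = 1 / s ^ (2 * k + 2)"
            by (simp add: power_one_over power_add power2_eq_square)
          then show ?thesis
            using alg[of "2 * real k + 1" "(1 / s) ^ (2 * k)"] by (simp add: f_def add.commute)
        qed
        ultimately show ?thesis by simp
      qed
      have "((\<lambda>s::real. 1 / s) \<longlongrightarrow> 0) at_top"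
        using tendsto_inverse_0_at_top[OF filterlim_ident] by (simp add: inverse_eq_divide)
      then have "((\<lambda>s::real. - (2 / (2 * real k + 1)\<^sup>2) * (1 / s) ^ (2 * k + 1))
          \<longlongrightarrow> - (2 / (2 * real k + 1)\<^sup>2) * 0 ^ (2 * k + 1)) at_top"
        by (intro tendsto_intros)
      then show "((\<lambda>s::real. - (2 / (2 * real k + 1)\<^sup>2) * (1 / s) ^ (2 * k + 1)) \<longlongrightarrow> 0) at_top"
        by simp
    qed (use f0 in auto)
    finally show ?thesis by simp
  qed
  show ?thesis
  proof (rule nn_integral_sums[where f = f, OF _ _ _ I])
    show "(\<lambda>k. f k s) sums (ell 1 s / s)" if "s \<in> {1<..}" for s
    proof -
      have s: "s > 1" using that by simp
      have "ell 1 s = ell (s * (1 / s)) (s * 1)" using s by simp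
      also have "\<dots> = ell 1 (1 / s)" using s by (subst ell_scale) (simp_all add: ell_commute)
      finally have e: "ell 1 s = ell 1 (1 / s)" .
      have "(\<lambda>k. 2 / (2 * real k + 1) * (1 / s) ^ (2 * k) * (1 / s\<^sup>2)) sums (ell 1 (1 / s) / (1 / s) * (1 / s\<^sup>2))"
        using s by (intro sums_mult2 ell_1_series) auto
      moreover have "ell 1 (1 / s) / (1 / s) * (1 / s\<^sup>2) = ell 1 s / s"
        using s by (simp add: e power2_eq_square)
      moreover have "2 / (2 * real k + 1) * (1 / s) ^ (2 * k) * (1 / s\<^sup>2) = f k s" for k
        by (simp add: f_def power_one_over power_add power2_eq_square)
      ultimately show ?thesis by simp
    qed
    show "(\<lambda>k. 2 / (2 * real k + 1)\<^sup>2) sums (pi\<^sup>2 / 4)"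
      using sums_mult[OF sums_odd_inverse_squares, of 2] by simp
  qed (use f0 in auto)
qed

lemma ell_1_integral: "has_bochner_integral hl (\<lambda>s. ell 1 s / s) (pi\<^sup>2 / 2)"
proof (rule has_bochner_integral_nn_integral)
  show "AE s in hl. 0 \<le> ell 1 s / s"
    unfolding AE_hl by (intro AE_I2 impI divide_nonneg_pos ell_nonneg) auto
  have "(\<integral>\<^sup>+s. ennreal (ell 1 s / s) \<partial>hl) = (\<integral>\<^sup>+s. ennreal (ell 1 s / s) * indicator {0<..} s \<partial>lborel)"
    by (subst nn_integral_hl) (auto simp: mult.commute)
  also have "\<dots> = (\<integral>\<^sup>+s. ennreal (ell 1 s / s) * indicator {0<..<1} s + ennreal (ell 1 s / s) * indicator {1<..} s \<partial>lborel)"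
  proof (rule nn_integral_cong_AE)
    show "AE s in lborel. ennreal (ell 1 s / s) * indicator {0<..} s
        = ennreal (ell 1 s / s) * indicator {0<..<1} s + ennreal (ell 1 s / s) * indicator {1<..} s"
      using AE_lborel_singleton[of "1::real"]
      by eventually_elim (auto simp: indicator_def)
  qed
  also have "\<dots> = ennreal (pi\<^sup>2 / 4) + ennreal (pi\<^sup>2 / 4)"
    by (subst nn_integral_add) (simp_all only: nn_integral_ell_lower nn_integral_ell_upper, measurable)
  also have "\<dots> = ennreal (pi\<^sup>2 / 2)"
    by (simp flip: ennreal_plus)
  finally show "(\<integral>\<^sup>+s. ennreal (ell 1 s / s) \<partial>hl) = ennreal (pi\<^sup>2 / 2)" .
qed auto

text \<open>The measure ds/s is invariant under dilations and \<open>ell\<close> is homogeneous of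
  degree 0, so only the sign of \<open>p\<close> matters. This is the one integral from which all
  later ones are derived.\<close>

lemma ell_integral: "has_bochner_integral hl (\<lambda>s. ell p s / s) (sgn p * (pi\<^sup>2 / 2))"
proof -
  have hb: "has_bochner_integral hl f x \<longleftrightarrow> has_bochner_integral lborel (\<lambda>s. indicator {0<..} s *\<^sub>R f s) x"
    if "f \<in> borel_measurable borel" for f :: "real \<Rightarrow> real" and x
    using that by (simp add: has_bochner_integral_iff integrable_hl integral_hl)
  have pos: "has_bochner_integral hl (\<lambda>s. ell p s / s) (pi\<^sup>2 / 2)" if p: "p > 0" for p
  proof -
    have "has_bochner_integral lborel (\<lambda>s. indicator {0<..} s *\<^sub>R (ell 1 s / s)) (pi\<^sup>2 / 2)"
      using ell_1_integral by (subst (asm) hb) auto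
    then have "has_bochner_integral lborel (\<lambda>s. inverse p * (indicator {0<..} s *\<^sub>R (ell 1 s / s))) (inverse p * (pi\<^sup>2 / 2))"
      by (intro has_bochner_integral_mult_right) auto
    moreover have "inverse p * (indicator {0<..} s *\<^sub>R (ell 1 s / s)) = indicator {0<..} (0 + p * s) *\<^sub>R (ell p (0 + p * s) / (0 + p * s))" for s
      using p ell_scale[of p 1 s] by (auto simp: indicator_def field_simps zero_less_mult_iff)
    ultimately have "has_bochner_integral lborel (\<lambda>s. indicator {0<..} (0 + p * s) *\<^sub>R (ell p (0 + p * s) / (0 + p * s))) (pi\<^sup>2 / 2 /\<^sub>R \<bar>p\<bar>)"
      using p by simp
    then have "has_bochner_integral lborel (\<lambda>s. indicator {0<..} s *\<^sub>R (ell p s / s)) (pi\<^sup>2 / 2)"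
      using p by (subst lborel_has_bochner_integral_real_affine_iff[where c = p and t = 0]) auto
    then show ?thesis by (subst hb) auto
  qed
  consider "p > 0" | "p = 0" | "p < 0" by linarith
  then show ?thesis
  proof cases
    case 3
    then have "has_bochner_integral hl (\<lambda>s. - (ell (- p) s / s)) (- (pi\<^sup>2 / 2))"
      by (intro has_bochner_integral_minus pos) simp
    then show ?thesis using 3 by (simp add: ell_minus_left)
  qed (use pos in auto)
qed

lemma ell_integrable: "integrable hl (\<lambda>s. ell p s / s)"
  using ell_integral by (auto simp: has_bochner_integral_iff)

text \<open>Provides the absolute integrability on the product space that Fubini asks for in
  \<open>ell_window_integral\<close>.\<close>

lemma ell_abs_integral: "has_bochner_integral hl (\<lambda>s. \<bar>ell p s / s\<bar>) (\<bar>sgn p\<bar> * (pi\<^sup>2 / 2))"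
proof -
  have "has_bochner_integral hl (\<lambda>s. ell \<bar>p\<bar> s / s) (sgn \<bar>p\<bar> * (pi\<^sup>2 / 2))"
    by (rule ell_integral)
  moreover have "AE s in hl. \<bar>ell p s / s\<bar> = ell \<bar>p\<bar> s / s"
    unfolding AE_hl
  proof (intro AE_I2 impI)
    fix s :: real assume s: "0 < s"
    have "ell \<bar>p\<bar> s \<ge> 0" using s by (intro ell_nonneg) auto
    moreover have "\<bar>ell p s\<bar> = \<bar>ell \<bar>p\<bar> s\<bar>" by (cases "p \<ge> 0") (auto simp: ell_minus_left)
    ultimately show "\<bar>ell p s / s\<bar> = ell \<bar>p\<bar> s / s" using s by simp
  qed
  ultimately show ?thesis
    by (subst has_bochner_integral_cong_AE) (auto simp: abs_sgn_eq sgn_if)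
qed

lemma ell_div_integrable_lborel: "integrable lborel (\<lambda>s. ell p s / s)"
  by (rule lborel_even(1)) (auto simp: ell_minus_right ell_integrable)

lemma ell_locally_integrable: "integrable lborel (\<lambda>s. indicator {-R..R} s * ell p s)"
proof (rule Bochner_Integration.integrable_bound)
  show "integrable lborel (\<lambda>s. R * (ell p s / s))"
    by (intro integrable_mult_right ell_div_integrable_lborel)
  show "AE s in lborel. norm (indicator {-R..R} s * ell p s) \<le> norm (R * (ell p s / s))"
  proof (rule AE_I2)
    fix s
    show "norm (indicator {-R..R} s * ell p s) \<le> norm (R * (ell p s / s))"
    proof (cases "s \<in> {-R..R} \<and> s \<noteq> 0")
      case True
      then have "\<bar>s\<bar> * \<bar>ell p s / s\<bar> \<le> \<bar>R\<bar> * \<bar>ell p s / s\<bar>"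
        by (intro mult_right_mono) auto
      then show ?thesis using True by (simp add: abs_mult)
    next
      case False
      then show ?thesis by (auto simp: indicator_def)
    qed
  qed
qed auto

text \<open>Both sides are combinations of the same four logarithms, paired differently; the
  exclusions keep all four arguments nonzero. The point of the regrouping is that \<open>s\<close>
  is left alone in the second argument, where \<open>ell_integral\<close> can act.\<close>

lemma ell_shift_diff:
  assumes "s \<noteq> b + y" "s \<noteq> - (b + y)" "s \<noteq> b - y" "s \<noteq> y - b"
  shows "ell b (y + s) - ell b (y - s) = ell (b + y) s + ell (b - y) s"
proof -
  have nz: "\<bar>b + y + s\<bar> > 0" "\<bar>b - y - s\<bar> > 0" "\<bar>b + y - s\<bar> > 0" "\<bar>b - y + s\<bar> > 0"
    using assms by auto
  have L: "ln (\<bar>u\<bar> / \<bar>v\<bar>) = ln \<bar>u\<bar> - ln \<bar>v\<bar>" if "\<bar>u\<bar> > 0" "\<bar>v\<bar> > 0" for u v :: real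
    using that by (subst ln_div) auto
  have "ell b (y + s) = ln \<bar>b + y + s\<bar> - ln \<bar>b - y - s\<bar>"
    using L[OF nz(1) nz(2)] by (simp add: ell_def algebra_simps)
  moreover have "ell b (y - s) = ln \<bar>b + y - s\<bar> - ln \<bar>b - y + s\<bar>"
    using L[OF nz(3) nz(4)] by (simp add: ell_def algebra_simps)
  moreover have "ell (b + y) s = ln \<bar>b + y + s\<bar> - ln \<bar>b + y - s\<bar>"
    using L[OF nz(1) nz(3)] by (simp add: ell_def)
  moreover have "ell (b - y) s = ln \<bar>b - y + s\<bar> - ln \<bar>b - y - s\<bar>"
    using L[OF nz(4) nz(2)] by (simp add: ell_def)
  ultimately show ?thesis by simp
qed

text \<open>The symmetry in \<open>x\<close> and \<open>s\<close> of the domain \<open>\<bar>x - a\<bar> \<le> s \<le> x + a\<close> is what makes Tonelli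
  applicable to \<open>\<integral> ell a \<cdot> ell b\<close>.\<close>

lemma ell_nn_integral:
  assumes a: "a > 0" and x: "x > 0" "x \<noteq> a"
  shows "(\<integral>\<^sup>+s. ennreal (1 / s) * indicator {\<bar>x - a\<bar>..x + a} s \<partial>lborel) = ennreal (ell a x)"
proof -
  have "(\<integral>\<^sup>+s. ennreal (1 / s) * indicator {\<bar>x - a\<bar>..x + a} s \<partial>lborel) = ennreal (ln (x + a) - ln \<bar>x - a\<bar>)"
  proof (rule nn_integral_FTC_Icc)
    show "(ln has_real_derivative 1 / s) (at s)" if "s \<in> {\<bar>x - a\<bar>..x + a}" for s
      using that x by (intro DERIV_ln_divide) auto
    show "0 \<le> 1 / s" if "s \<in> {\<bar>x - a\<bar>..x + a}" for s
      using that by auto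
    show "\<bar>x - a\<bar> \<le> x + a" using a x by auto
  qed measurable
  also have "ln (x + a) - ln \<bar>x - a\<bar> = ell a x"
    using a x by (simp add: ell_def ln_div add.commute abs_minus_commute)
  finally show ?thesis .
qed

section \<open>The Gram matrix of the logarithmic kernels\<close>

definition ell_window :: "real \<Rightarrow> real \<Rightarrow> real \<Rightarrow> real" where
  "ell_window a b s = (LINT y|lborel. indicator {-a..a} y * ell b (y + s))"

lemma integrable_ell_window: "integrable lborel (\<lambda>y. indicator {-a..a} y * ell b (y + s))"
proof -
  define R where "R = \<bar>a\<bar> + \<bar>s\<bar>"
  have "integrable lborel (\<lambda>y. indicator {-R..R} (s + 1 * y) * ell b (s + 1 * y))"
    by (rule lborel_integrable_real_affine[OF ell_locally_integrable]) simp
  then have "integrable lborel (\<lambda>y. indicator {-a..a} y *\<^sub>R (indicator {-R..R} (s + 1 * y) * ell b (s + 1 * y)))"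
    by (intro integrable_mult_indicator) auto
  moreover have "indicator {-a..a} y *\<^sub>R (indicator {-R..R} (s + 1 * y) * ell b (s + 1 * y)) = indicator {-a..a} y * ell b (y + s)" for y
    by (auto simp: indicator_def R_def add.commute)
  ultimately show ?thesis by (simp only:)
qed

text \<open>The window integrates the odd function \<open>ell b\<close> over [s - a, s + a].
  Whatever part is symmetric about 0 cancels, leaving the interval from the absolute value of s - a
  to s + a: the inner integral that appears after Tonelli in \<open>ell_inner\<close>.\<close>

lemma ell_window_nn_integral:
  assumes a: "a > 0" and b: "b > 0" and s: "s > 0"
  shows "(\<integral>\<^sup>+x. indicator {0<..} x * (indicator {\<bar>s - a\<bar>..s + a} x * ennreal (ell b x)) \<partial>lborel)
      = ennreal (ell_window a b s)"
    and "0 \<le> ell_window a b s"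
proof -
  define g where "g x = indicator {-a..a} (x - s) * ell b x" for x
  have g: "integrable lborel g"
    using lborel_integrable_real_affine[OF integrable_ell_window[of a b s], where c = 1 and t = "- s"]
    by (simp add: g_def[abs_def])
  have gm [measurable]: "g \<in> borel_measurable borel" unfolding g_def[abs_def] by measurable
  have "ell_window a b s = (LINT x|lborel. indicator {-a..a} (x - s) * ell b x)"
    using lborel_integral_real_affine[of 1 g s] by (simp add: ell_window_def g_def add.commute)
  also have "\<dots> = integral\<^sup>L lborel g"
    by (simp add: g_def[abs_def])
  also have "\<dots> = integral\<^sup>L hl g + integral\<^sup>L hl (\<lambda>x. g (- x))"
    by (rule lborel_split_halflines(2)[OF gm integrable_hl_of_lborel[OF g]])
  also have "\<dots> = (LINT x|hl. g x + g (- x))"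
    by (intro Bochner_Integration.integral_add[symmetric] integrable_hl_of_lborel g)
  also have "\<dots> = (LINT x|hl. indicator {\<bar>s - a\<bar>..s + a} x * ell b x)"
  proof (rule integral_cong_AE)
    show "AE x in hl. g x + g (- x) = indicator {\<bar>s - a\<bar>..s + a} x * ell b x"
      unfolding AE_hl using AE_lborel_singleton[of "a - s"] AE_lborel_singleton[of "s - a"]
    proof eventually_elim
      case (elim x)
      then show ?case
        using a s by (auto simp: g_def ell_minus_right indicator_def split: if_splits)
    qed
  qed measurable
  finally have *: "ell_window a b s = (LINT x|hl. indicator {\<bar>s - a\<bar>..s + a} x * ell b x)" .
  have int: "integrable hl (\<lambda>x. indicator {\<bar>s - a\<bar>..s + a} x * ell b x)"
  proof -
    have "integrable lborel (\<lambda>x. indicator {\<bar>s - a\<bar>..s + a} x *\<^sub>R (indicator {-(s + a)..s + a} x * ell b x))"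
      by (intro integrable_mult_indicator ell_locally_integrable) auto
    moreover have "indicator {\<bar>s - a\<bar>..s + a} x *\<^sub>R (indicator {-(s + a)..s + a} x * ell b x)
        = indicator {\<bar>s - a\<bar>..s + a} x * ell b x" for x
      by (auto simp: indicator_def)
    ultimately have "integrable lborel (\<lambda>x. indicator {\<bar>s - a\<bar>..s + a} x * ell b x)"
      by (simp only:)
    then show ?thesis by (rule integrable_hl_of_lborel)
  qed
  have nn: "AE x in hl. 0 \<le> indicator {\<bar>s - a\<bar>..s + a} x * ell b x"
    unfolding AE_hl using b by (intro AE_I2 impI mult_nonneg_nonneg ell_nonneg) auto
  show "0 \<le> ell_window a b s"
    unfolding * using nn by (rule integral_nonneg_AE)
  have "(\<integral>\<^sup>+x. indicator {0<..} x * (indicator {\<bar>s - a\<bar>..s + a} x * ennreal (ell b x)) \<partial>lborel)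
      = (\<integral>\<^sup>+x. ennreal (indicator {\<bar>s - a\<bar>..s + a} x * ell b x) \<partial>hl)"
    by (subst nn_integral_hl) (auto simp: ennreal_mult' ennreal_indicator)
  also have "\<dots> = ennreal (ell_window a b s)"
    unfolding * by (rule nn_integral_eq_integral[OF int nn])
  finally show "(\<integral>\<^sup>+x. indicator {0<..} x * (indicator {\<bar>s - a\<bar>..s + a} x * ennreal (ell b x)) \<partial>lborel)
      = ennreal (ell_window a b s)" .
qed

text \<open>Replacing y by -y shows that the window is odd in \<open>s\<close>. Averaging it with
  its reflection puts the integrand into the form of \<open>ell_shift_diff\<close>.\<close>

lemma ell_window_eq:
  "ell_window a b s = (LINT y|lborel. indicator {-a..a} y * ((ell (b + y) s + ell (b - y) s) / 2))"
proof -
  have int: "integrable lborel (\<lambda>y. indicator {-a..a} y * ell b (y + s))" for s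
    by (rule integrable_ell_window)
  have "ell_window a b s = (LINT y|lborel. indicator {-a..a} (- y) * ell b (- y + s))"
    using lborel_integral_real_affine[of "-1" "\<lambda>y. indicator {-a..a} y * ell b (y + s)" 0]
    by (simp add: ell_window_def)
  also have "\<dots> = (LINT y|lborel. - (indicator {-a..a} y * ell b (y + - s)))"
    using ell_minus_right[of b "_ - s"]
    by (intro Bochner_Integration.integral_cong) (auto simp: indicator_def)
  also have "\<dots> = - ell_window a b (- s)"
    by (simp add: ell_window_def)
  finally have "ell_window a b s = (ell_window a b s - ell_window a b (- s)) / 2"
    by simp
  also have "\<dots> = (LINT y|lborel. (indicator {-a..a} y * ell b (y + s) - indicator {-a..a} y * ell b (y + - s)) / 2)"
    unfolding ell_window_def integral_divide_zero Bochner_Integration.integral_diff[OF int int] ..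
  also have "\<dots> = (LINT y|lborel. indicator {-a..a} y * ((ell (b + y) s + ell (b - y) s) / 2))"
  proof (rule integral_cong_AE)
    show "AE y in lborel. (indicator {-a..a} y * ell b (y + s) - indicator {-a..a} y * ell b (y + - s)) / 2
        = indicator {-a..a} y * ((ell (b + y) s + ell (b - y) s) / 2)"
      using AE_lborel_singleton[of "s - b"] AE_lborel_singleton[of "- s - b"]
        AE_lborel_singleton[of "b - s"] AE_lborel_singleton[of "s + b"]
    proof eventually_elim
      case (elim y)
      then have "ell b (y + s) - ell b (y - s) = ell (b + y) s + ell (b - y) s"
        by (intro ell_shift_diff) auto
      then show ?case by (auto simp: indicator_def)
    qed
  qed measurable
  finally show ?thesis .
qed

text \<open>By Fubini the integral ds/s is done first and turns the two kernels into signs. The sum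
  of the signs of b + y and b - y is 2 inside the interval (-b, b) and 0 outside its closure, so the
  remaining integral measures [- min a b, min a b]. In \<open>f\<close> the parameter
  \<open>c\<close> is 1 or -1 for the two kernels.\<close>

lemma ell_window_integral:
  assumes a: "a > 0" and b: "b > 0"
  shows "has_bochner_integral hl (\<lambda>s. ell_window a b s / s) (pi\<^sup>2 * min a b)"
proof -
  define f where "f c y s = indicator {-a..a} y * (indicator {0<..} s * (ell (b + c * y) s / s))" for c y s :: real
  have fm [measurable]: "case_prod (f c) \<in> borel_measurable (lborel \<Otimes>\<^sub>M lborel)" for c
    unfolding f_def by measurable
  have f_s: "has_bochner_integral lborel (f c y) (indicator {-a..a} y * (sgn (b + c * y) * (pi\<^sup>2 / 2)))" for c y
    unfolding f_def using ell_integral[of "b + c * y"]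
    by (intro has_bochner_integral_mult_right) (simp add: has_bochner_integral_iff integrable_hl integral_hl)
  have f_abs: "(LINT s|lborel. norm (f c y s)) = indicator {-a..a} y * (\<bar>sgn (b + c * y)\<bar> * (pi\<^sup>2 / 2))" for c y
  proof -
    have "norm (f c y s) = indicator {-a..a} y * (indicator {0<..} s *\<^sub>R \<bar>ell (b + c * y) s / s\<bar>)" for s
      by (simp add: f_def abs_mult)
    then have "(LINT s|lborel. norm (f c y s)) = indicator {-a..a} y * (LINT s|lborel. indicator {0<..} s *\<^sub>R \<bar>ell (b + c * y) s / s\<bar>)"
      by (simp only: integral_mult_right_zero)
    also have "(LINT s|lborel. indicator {0<..} s *\<^sub>R \<bar>ell (b + c * y) s / s\<bar>) = (LINT s|hl. \<bar>ell (b + c * y) s / s\<bar>)"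
      by (rule integral_hl[symmetric]) measurable
    also have "\<dots> = \<bar>sgn (b + c * y)\<bar> * (pi\<^sup>2 / 2)"
      using ell_abs_integral[of "b + c * y"] by (simp only: has_bochner_integral_iff)
    finally show ?thesis .
  qed
  have int: "integrable (lborel \<Otimes>\<^sub>M lborel) (case_prod (f c))" for c
  proof (rule lborel_pair.Fubini_integrable[OF fm])
    show "integrable lborel (\<lambda>y. LINT s|lborel. norm (case (y, s) of (y, s) \<Rightarrow> f c y s))"
      unfolding prod.case f_abs
    proof (rule Bochner_Integration.integrable_bound)
      show "integrable lborel (\<lambda>y. indicator {-a..a} y * (pi\<^sup>2 / 2))"
        by (intro integrable_mult_left integrable_real_indicator) (use a in auto)
      show "AE y in lborel. norm (indicator {-a..a} y * (\<bar>sgn (b + c * y)\<bar> * (pi\<^sup>2 / 2))) \<le> norm (indicator {-a..a} y * (pi\<^sup>2 / 2))"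
        by (intro AE_I2) (auto simp: indicator_def sgn_if)
    qed (unfold sgn_if, measurable)
    show "AE y in lborel. integrable lborel (\<lambda>s. case (y, s) of (y, s) \<Rightarrow> f c y s)"
      using f_s by (auto simp: has_bochner_integral_iff)
  qed
  define h where "h y s = (f 1 y s + f (-1) y s) / 2" for y s
  have h: "integrable (lborel \<Otimes>\<^sub>M lborel) (case_prod h)"
    using Bochner_Integration.integrable_add[OF int[of 1] int[of "-1"]]
    by (simp add: h_def case_prod_beta')
  have inner: "(LINT y|lborel. h y s) = indicator {0<..} s *\<^sub>R (ell_window a b s / s)" for s
  proof -
    have "h y s = (indicator {0<..} s / s) * (indicator {-a..a} y * ((ell (b + y) s + ell (b - y) s) / 2))" for y
      by (simp add: h_def f_def algebra_simps add_divide_distrib)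
    then show ?thesis by (simp add: ell_window_eq)
  qed
  have outer: "(LINT s|lborel. h y s) = indicator {-a..a} y * ((sgn (b + y) + sgn (b - y)) * (pi\<^sup>2 / 4))" for y
    unfolding h_def using f_s[of 1 y] f_s[of "-1" y] by (simp add: has_bochner_integral_iff algebra_simps)
  have wm: "ell_window a b \<in> borel_measurable borel"
    unfolding ell_window_def[abs_def] by measurable
  have "integrable lborel (\<lambda>s. indicator {0<..} s *\<^sub>R (ell_window a b s / s))"
    using lborel_pair.integrable_snd[OF h] by (simp add: inner)
  then have 1: "integrable hl (\<lambda>s. ell_window a b s / s)"
    using wm by (subst integrable_hl) auto
  have "(LINT s|hl. ell_window a b s / s) = (LINT s|lborel. LINT y|lborel. h y s)"
    using wm by (subst integral_hl) (auto simp: inner)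
  also have "\<dots> = (LINT y|lborel. LINT s|lborel. h y s)"
    by (rule lborel_pair.Fubini_integral[OF h])
  also have "\<dots> = (LINT y|lborel. indicator {- min a b..min a b} y * (pi\<^sup>2 / 2))"
    unfolding outer
  proof (rule integral_cong_AE)
    show "AE y in lborel. indicator {-a..a} y * ((sgn (b + y) + sgn (b - y)) * (pi\<^sup>2 / 4))
        = indicator {- min a b..min a b} y * (pi\<^sup>2 / 2)"
      using AE_lborel_singleton[of b] AE_lborel_singleton[of "- b"]
      by eventually_elim (use b in \<open>auto simp: indicator_def sgn_if\<close>)
  qed (unfold sgn_if, measurable)
  also have "\<dots> = pi\<^sup>2 * min a b"
  proof -
    define m where "m = min a b"
    have "m > 0" using a b by (simp add: m_def)
    then have "(LINT y|lborel. indicator {- m..m} y * (pi\<^sup>2 / 2)) = pi\<^sup>2 * m"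
      by simp
    then show ?thesis by (simp only: m_def)
  qed
  finally show ?thesis using 1 by (simp add: has_bochner_integral_iff)
qed

text \<open>\<open>ell a x\<close> is written as the integral of 1/s by
  \<open>ell_nn_integral\<close>; exchanging the order leaves the integral of the window against
  ds/s. The value is pi^2 times the Gram matrix of the indicators of (0, a], which is why
  \<open>ell a x / pi\<close> can serve as an isometric image of \<open>chi a\<close>.\<close>

lemma ell_inner:
  assumes a: "a > 0" and b: "b > 0"
  shows "(\<integral>\<^sup>+x. ennreal (ell a x * ell b x) \<partial>hl) = ennreal (pi\<^sup>2 * min a b)"
proof -
  define D where "D x s \<longleftrightarrow> \<bar>x - a\<bar> \<le> s \<and> s \<le> x + a" for x s
  have D_sym: "D x s = D s x" for x s by (auto simp: D_def)
  define f where "f x s = indicator {0<..} x * (indicator {0<..} s * (indicator {p. D (fst p) (snd p)} (x, s) * (ennreal (ell b x) * ennreal (1 / s))))" for x s :: real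
  have [measurable]: "{p :: real \<times> real. D (fst p) (snd p)} \<in> sets (borel \<Otimes>\<^sub>M borel)"
  proof -
    have "Measurable.pred (borel \<Otimes>\<^sub>M borel) (\<lambda>p :: real \<times> real. D (fst p) (snd p))"
      unfolding D_def by measurable
    then show ?thesis by (simp add: pred_def space_pair_measure)
  qed
  have fm: "case_prod f \<in> borel_measurable (lborel \<Otimes>\<^sub>M lborel)"
    unfolding f_def by measurable
  have "(\<integral>\<^sup>+x. ennreal (ell a x * ell b x) \<partial>hl) = (\<integral>\<^sup>+x. indicator {0<..} x * ennreal (ell a x * ell b x) \<partial>lborel)"
    by (subst nn_integral_hl) auto
  also have "\<dots> = (\<integral>\<^sup>+x. \<integral>\<^sup>+s. f x s \<partial>lborel \<partial>lborel)"
  proof (rule nn_integral_cong_AE)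
    show "AE x in lborel. indicator {0<..} x * ennreal (ell a x * ell b x) = (\<integral>\<^sup>+s. f x s \<partial>lborel)"
      using AE_lborel_singleton[of a]
    proof eventually_elim
      case (elim x)
      show ?case
      proof (cases "x > 0")
        case True
        have "f x s = ennreal (ell b x) * (ennreal (1 / s) * indicator {\<bar>x - a\<bar>..x + a} s)" for s
          using True elim by (auto simp: f_def D_def indicator_def)
        then have "(\<integral>\<^sup>+s. f x s \<partial>lborel) = ennreal (ell b x) * (\<integral>\<^sup>+s. ennreal (1 / s) * indicator {\<bar>x - a\<bar>..x + a} s \<partial>lborel)"
          by (simp add: nn_integral_cmult)
        also have "\<dots> = ennreal (ell b x) * ennreal (ell a x)"
          using ell_nn_integral[OF a True elim] by simp
        also have "\<dots> = ennreal (ell a x * ell b x)"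
          using True a b by (subst ennreal_mult[symmetric]) (auto intro!: ell_nonneg simp: mult.commute)
        finally show ?thesis using True by simp
      qed (simp add: f_def)
    qed
  qed
  also have "\<dots> = (\<integral>\<^sup>+s. \<integral>\<^sup>+x. f x s \<partial>lborel \<partial>lborel)"
    using fm by (rule lborel_pair.Fubini'[symmetric])
  also have "\<dots> = (\<integral>\<^sup>+s. indicator {0<..} s * ennreal (ell_window a b s / s) \<partial>lborel)"
  proof (rule nn_integral_cong)
    fix s :: real
    show "(\<integral>\<^sup>+x. f x s \<partial>lborel) = indicator {0<..} s * ennreal (ell_window a b s / s)"
    proof (cases "s > 0")
      case True
      have "f x s = ennreal (1 / s) * (indicator {0<..} x * (indicator {\<bar>s - a\<bar>..s + a} x * ennreal (ell b x)))" for x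
        using True D_sym[of x s] by (auto simp: f_def D_def indicator_def mult.commute)
      then have "(\<integral>\<^sup>+x. f x s \<partial>lborel) = ennreal (1 / s) * ennreal (ell_window a b s)"
        using ell_window_nn_integral(1)[OF a b True] by (simp add: nn_integral_cmult)
      also have "\<dots> = ennreal (ell_window a b s / s)"
        using True ell_window_nn_integral(2)[OF a b True] by (subst ennreal_mult[symmetric]) auto
      finally show ?thesis using True by simp
    qed (simp add: f_def)
  qed
  also have "\<dots> = (\<integral>\<^sup>+s. ennreal (ell_window a b s / s) \<partial>hl)"
    by (subst nn_integral_hl) (auto simp: ell_window_def[abs_def])
  also have "\<dots> = ennreal (pi\<^sup>2 * min a b)"
  proof -
    have "AE s in hl. 0 \<le> ell_window a b s / s"
      unfolding AE_hl using ell_window_nn_integral(2)[OF a b] by (intro AE_I2 impI) simp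
    then show ?thesis
      using ell_window_integral[OF a b] by (subst nn_integral_eq_integral) (auto simp: has_bochner_integral_iff)
  qed
  finally show ?thesis .
qed

lemma ell_mult_integral:
  assumes "a > 0" "b > 0"
  shows "has_bochner_integral hl (\<lambda>x. ell a x * ell b x) (pi\<^sup>2 * min a b)"
proof (rule has_bochner_integral_nn_integral)
  show "AE x in hl. 0 \<le> ell a x * ell b x"
    unfolding AE_hl using assms by (intro AE_I2 impI mult_nonneg_nonneg ell_nonneg) auto
qed (use assms in \<open>auto simp: ell_inner\<close>)

lemma sqr_ell: "a > 0 \<Longrightarrow> sqr (ell a)"
  using ell_mult_integral[of a a] by (auto simp: sqr_def power2_eq_square has_bochner_integral_iff)

section \<open>The Hilbert transform on the half line\<close>

lemma integrable_hl_dilation: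
  fixes f :: "real \<Rightarrow> real"
  assumes c: "c > 0" and f: "f \<in> borel_measurable borel" "integrable hl f"
  shows "integrable hl (\<lambda>x. f (c * x))" "(LINT x|hl. f (c * x)) = (LINT x|hl. f x) / c"
proof -
  have fm: "(\<lambda>x. f (c * x)) \<in> borel_measurable borel" using f(1) by measurable
  have "integrable lborel (\<lambda>x. indicator {0<..} x *\<^sub>R f x)"
    using f by (simp only: integrable_hl)
  then have "integrable lborel (\<lambda>x. indicator {0<..} (0 + c * x) *\<^sub>R f (0 + c * x))"
    using c by (intro lborel_integrable_real_affine) auto
  moreover have *: "indicator {0<..} (0 + c * x) *\<^sub>R f (0 + c * x) = indicator {0<..} x *\<^sub>R f (c * x)" for x
    using c by (simp add: indicator_def zero_less_mult_iff)
  ultimately show "integrable hl (\<lambda>x. f (c * x))"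
    unfolding integrable_hl[OF fm] by (simp only:)
  have "(LINT x|hl. f x) = c * (LINT x|lborel. indicator {0<..} (0 + c * x) *\<^sub>R f (0 + c * x))"
    using lborel_integral_real_affine[of c "\<lambda>x. indicator {0<..} x *\<^sub>R f x" 0] c
    by (simp add: integral_hl[OF f(1)])
  also have "\<dots> = c * (LINT x|hl. f (c * x))"
    unfolding * integral_hl[OF fm] ..
  finally show "(LINT x|hl. f (c * x)) = (LINT x|hl. f x) / c"
    using c by (simp add: field_simps)
qed

lemma sqr_dilation: "c > 0 \<Longrightarrow> sqr f \<Longrightarrow> sqr (\<lambda>x. f (c * x))"
  using integrable_hl_dilation(1)[of c "\<lambda>x. (f x)\<^sup>2"] by (auto simp: sqr_def)

definition dil :: "real \<Rightarrow> l2 \<Rightarrow> l2" where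
  "dil c f = abs_l2 (\<lambda>x. rep_l2 f (c * x))"

lemma dil_abs_l2:
  assumes c: "c > 0" and f: "sqr f"
  shows "dil c (abs_l2 f) = abs_l2 (\<lambda>x. f (c * x))"
proof -
  define u where "u = rep_l2 (abs_l2 f)"
  have u: "sqr u" "abs_l2 u = abs_l2 f" by (simp_all add: u_def sqr_rep abs_rep_l2)
  have d: "sqr (\<lambda>x. u x - f x)" using u f by (intro sqr_diff)
  have "(dist (abs_l2 (\<lambda>x. u (c * x))) (abs_l2 (\<lambda>x. f (c * x))))\<^sup>2 = (LINT x|hl. (u (c * x) - f (c * x))\<^sup>2)"
    by (intro dist_abs_l2 sqr_dilation c u f)
  also have "\<dots> = (LINT x|hl. (u x - f x)\<^sup>2) / c"
    using d by (intro integrable_hl_dilation(2)[OF c, of "\<lambda>x. (u x - f x)\<^sup>2"]) (auto simp: sqr_def)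
  also have "(LINT x|hl. (u x - f x)\<^sup>2) = 0"
    using dist_abs_l2[OF u(1) f] u(2) by simp
  finally show ?thesis by (simp add: dil_def u_def)
qed

lemma inner_dil:
  assumes c: "c > 0"
  shows "inner (dil c f) (dil c g) = inner f g / c"
proof -
  have "inner (dil c f) (dil c g) = (LINT x|hl. rep_l2 f (c * x) * rep_l2 g (c * x))"
    unfolding dil_def by (intro inner_abs_l2 sqr_dilation c sqr_rep)
  also have "\<dots> = (LINT x|hl. rep_l2 f x * rep_l2 g x) / c"
    by (intro integrable_hl_dilation(2)[OF c, of "\<lambda>x. rep_l2 f x * rep_l2 g x"] sqr_integrable_mult sqr_rep) auto
  also have "(LINT x|hl. rep_l2 f x * rep_l2 g x) = inner f g"
    using inner_abs_l2[OF sqr_rep sqr_rep, of f g] by (simp add: abs_rep_l2)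
  finally show ?thesis .
qed

lemma dil_bounded_linear:
  assumes c: "c > 0"
  shows "bounded_linear (dil c)"
proof (rule bounded_linear_intro[where K = "sqrt (1 / c)"])
  fix f g :: l2 and a :: real
  have "dil c (f + g) = dil c (abs_l2 (\<lambda>x. rep_l2 f x + rep_l2 g x))"
    using add_abs_l2[OF sqr_rep sqr_rep, of f g] by (simp add: abs_rep_l2)
  also have "\<dots> = dil c f + dil c g"
    unfolding dil_abs_l2[OF c sqr_add[OF sqr_rep sqr_rep]] unfolding dil_def
    by (intro add_abs_l2[symmetric] sqr_dilation c sqr_rep)
  finally show "dil c (f + g) = dil c f + dil c g" .
  have "dil c (a *\<^sub>R f) = dil c (abs_l2 (\<lambda>x. a * rep_l2 f x))"
    using scaleR_abs_l2[OF sqr_rep, of a f] by (simp add: abs_rep_l2)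
  also have "\<dots> = a *\<^sub>R dil c f"
    unfolding dil_abs_l2[OF c sqr_scale[OF sqr_rep]] unfolding dil_def
    by (intro scaleR_abs_l2[symmetric] sqr_dilation c sqr_rep)
  finally show "dil c (a *\<^sub>R f) = a *\<^sub>R dil c f" .
  show "norm (dil c f) \<le> norm f * sqrt (1 / c)"
    by (simp add: norm_eq_sqrt_inner inner_dil[OF c] real_sqrt_divide)
qed

lemma sqr_Ioc: "sqr (indicator {0<..a})"
  by (rule sqr_indicator[of _ a]) auto

lemma dil_chi:
  assumes c: "c > 0"
  shows "dil c (chi a) = chi (a / c)"
proof -
  have "(\<lambda>x. indicator {0<..a} (c * x) :: real) = indicator {0<..a / c}"
    using c by (auto simp: indicator_def fun_eq_iff zero_less_mult_iff pos_le_divide_eq mult.commute)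
  then show ?thesis
    unfolding chi_def dil_abs_l2[OF c sqr_Ioc] by simp
qed

lemma dil_G:
  assumes c: "c > 0" and n: "n \<ge> 1" and s: "s > 0"
  shows "dil c (G n s) = G n (c ^ (2 * n) * s)"
proof -
  have "(\<lambda>x. gauss n s (c * x)) = gauss n (c ^ (2 * n) * s)"
    unfolding gauss_def fun_eq_iff power_mult_distrib by (simp add: mult_ac)
  then show ?thesis
    unfolding G_def dil_abs_l2[OF c sqr_gauss[OF n s]] by simp
qed

lemma inner_chi_chi:
  assumes "a > 0" "b > 0"
  shows "inner (chi a) (chi b) = min a b"
proof -
  have "inner (chi a) (chi b) = (LINT x|lborel. indicator {0<..b} x * indicator {0<..a} x)"
    unfolding chi_def[of a] by (rule inner_chi) (rule sqr_Ioc)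
  also have "(\<lambda>x. indicator {0<..b} x * indicator {0<..a} x :: real) = indicator {0<..min a b}"
    by (auto simp: indicator_def fun_eq_iff)
  also have "(LINT x|lborel. indicator {0<..min a b} x) = min a b"
    using assms by simp
  finally show ?thesis .
qed

lemma sqr_ell_pi: "a > 0 \<Longrightarrow> sqr (\<lambda>x. ell a x / pi)"
  using sqr_scale[OF sqr_ell, of a "1 / pi"] by simp

text \<open>Even and odd functions are both represented by their restrictions to the half line:
  \<open>chi a\<close> stands for the indicator of [-a, a], and \<open>ell a x / pi\<close> is its
  Hilbert transform, as \<open>hilbert_even_step\<close> confirms.\<close>

definition hilb_op :: "l2 \<Rightarrow> l2" where
  "hilb_op = (SOME U. linear U \<and> (\<forall>x y. inner (U x) (U y) = inner x y) \<and>
     (\<forall>a>0. U (chi a) = abs_l2 (\<lambda>x. ell a x / pi)))"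

lemma hilb_op_exists:
  "linear hilb_op \<and> (\<forall>x y. inner (hilb_op x) (hilb_op y) = inner x y) \<and>
     (\<forall>a>0. hilb_op (chi a) = abs_l2 (\<lambda>x. ell a x / pi))"
proof -
  have iso: "inner (abs_l2 (\<lambda>x. ell a x / pi)) (abs_l2 (\<lambda>x. ell b x / pi)) = inner (chi a) (chi b)"
    if "a \<in> {0<..}" "b \<in> {0<..}" for a b
  proof -
    have ab: "a > 0" "b > 0" using that by auto
    have "inner (abs_l2 (\<lambda>x. ell a x / pi)) (abs_l2 (\<lambda>x. ell b x / pi)) = (LINT x|hl. (ell a x / pi) * (ell b x / pi))"
      by (intro inner_abs_l2 sqr_ell_pi ab)
    also have "\<dots> = (LINT x|hl. (ell a x * ell b x) / pi\<^sup>2)"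
      by (simp add: power2_eq_square)
    also have "\<dots> = min a b"
      using ell_mult_integral[OF ab] by (simp add: has_bochner_integral_iff)
    finally show ?thesis using inner_chi_chi[OF ab] by simp
  qed
  obtain U where "linear U" "\<And>x y. inner (U x) (U y) = inner x y"
    "\<And>a. a \<in> {0<..} \<Longrightarrow> U (chi a) = abs_l2 (\<lambda>x. ell a x / pi)"
    using isometry_extension[of "{0<..}" "\<lambda>a. abs_l2 (\<lambda>x. ell a x / pi)" chi, OF iso dense_chi] by auto
  then have "\<exists>U. linear U \<and> (\<forall>x y. inner (U x) (U y) = inner x y) \<and>
     (\<forall>a>0. U (chi a) = abs_l2 (\<lambda>x. ell a x / pi))" by auto
  from someI_ex[OF this] show ?thesis unfolding hilb_op_def .
qed

lemmas hilb_op_linear = conjunct1[OF hilb_op_exists]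
lemmas hilb_op_inner = conjunct1[OF conjunct2[OF hilb_op_exists], rule_format]
lemmas hilb_op_chi = conjunct2[OF conjunct2[OF hilb_op_exists], rule_format]

lemma hilb_op_bounded_linear: "bounded_linear hilb_op"
  by (intro isometry_bounded_linear hilb_op_linear hilb_op_inner)

lemma hilb_op_dil:
  assumes c: "c > 0"
  shows "hilb_op (dil c f) = dil c (hilb_op f)"
proof (rule bounded_linear_eq_on_dense[OF dense_chi, where f = "\<lambda>f. hilb_op (dil c f)"
      and g = "\<lambda>f. dil c (hilb_op f)"])
  show "bounded_linear (\<lambda>f. hilb_op (dil c f))" "bounded_linear (\<lambda>f. dil c (hilb_op f))"
    by (intro bounded_linear_compose[OF hilb_op_bounded_linear] bounded_linear_compose[OF dil_bounded_linear[OF c]]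
        hilb_op_bounded_linear dil_bounded_linear c)+
  fix z assume "z \<in> chi ` {0<..}"
  then obtain a where a: "a > 0" "z = chi a" by auto
  have "ell (a / c) x = ell a (c * x)" for x
    using ell_scale[of c "a / c" x] c by simp
  then show "hilb_op (dil c z) = dil c (hilb_op z)"
    using a c by (simp add: dil_chi hilb_op_chi dil_abs_l2 sqr_ell_pi)
qed

text \<open>Both sides are homogeneous of degree \<open>- mu n\<close> in \<open>(s, r)\<close> because \<open>hilb_op\<close> commutes
  with dilations, and \<open>G_dual\<close> swaps \<open>s\<close> and \<open>r\<close> up to the common factor \<open>4 n\<^sup>2 s r\<close>.\<close>

lemma hilb_cos_G:
  assumes n: "n \<ge> 1" and s: "s > 0" and r: "r > 0"
  shows "inner (hilb_op (cos_op n (G n s))) (cos_op n (G n r)) = inner (G n s) (hilb_op (G n r))"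
proof -
  define D where "D = 4 * (real n)\<^sup>2 * s * r"
  have D: "D > 0" using n s r by (simp add: D_def)
  \<comment> \<open>A dilation by \<open>c\<close> multiplies Gaussian parameters by
    \<open>c ^ (2 * n)\<close>. This choice makes the factor \<open>D\<close>, which takes the dual
    of \<open>s\<close> to \<open>r\<close> and the dual of \<open>r\<close> to \<open>s\<close>;
    moreover 1/c is the product of the two scale factors.\<close>
  define c where "c = D powr mu n"
  have c: "c > 0" using D by (simp add: c_def)
  have "c ^ (2 * n) = c powr (2 * real n)" using powr_realpow[OF c, of "2 * n"] by simp
  also have "\<dots> = D" using D n by (simp add: c_def powr_powr mu_def)
  finally have cD: "c ^ (2 * n) = D" .
  have dual: "D * G_dual n s = r" "D * G_dual n r = s"
    using n s r by (simp_all add: D_def G_dual_def)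
  have ds: "dil c (G n (G_dual n s)) = G n r" "dil c (G n (G_dual n r)) = G n s"
    using n s r c by (simp_all add: dil_G G_dual_pos cD dual)
  have "inner (hilb_op (cos_op n (G n s))) (cos_op n (G n r))
      = (G_scale n s * G_scale n r) * inner (hilb_op (G n (G_dual n s))) (G n (G_dual n r))"
    by (simp add: cos_op_G[OF n s] cos_op_G[OF n r] linear_scale[OF hilb_op_linear])
  also have "G_scale n s * G_scale n r = 1 / c"
    unfolding G_scale_mult[OF n s r] c_def D_def by (rule powr_minus_divide)
  also have "1 / c * inner (hilb_op (G n (G_dual n s))) (G n (G_dual n r))
      = inner (dil c (hilb_op (G n (G_dual n s)))) (dil c (G n (G_dual n r)))"
    by (simp add: inner_dil[OF c])
  also have "\<dots> = inner (hilb_op (G n r)) (G n s)"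
    unfolding hilb_op_dil[OF c, symmetric] ds ..
  finally show ?thesis by (simp only: inner_commute)
qed

text \<open>Both sides are continuous and linear in each variable, so the identity extends from
  Gaussians one variable at a time. As A is symmetric, it says that A W A is the adjoint of
  W.\<close>

lemma hilb_cos_adjoint:
  assumes n: "n \<ge> 1"
  shows "inner (hilb_op (cos_op n f)) (cos_op n g) = inner f (hilb_op g)"
proof -
  have C: "bounded_linear (cos_op n)" by (rule cos_op_bounded_linear[OF n])
  have 1: "inner (hilb_op (cos_op n f)) (cos_op n (G n r)) = inner f (hilb_op (G n r))" if r: "r > 0" for r f
  proof (rule bounded_linear_eq_on_dense[OF dense_G[OF n], where
        f = "\<lambda>f. inner (hilb_op (cos_op n f)) (cos_op n (G n r))" and g = "\<lambda>f. inner f (hilb_op (G n r))"])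
    show "bounded_linear (\<lambda>f. inner (hilb_op (cos_op n f)) (cos_op n (G n r)))"
      by (intro bounded_linear_inner_left_comp bounded_linear_compose[OF hilb_op_bounded_linear] C)
    show "bounded_linear (\<lambda>f. inner f (hilb_op (G n r)))"
      by (rule bounded_linear_inner_left)
  qed (use hilb_cos_G[OF n _ r] in auto)
  show ?thesis
  proof (rule bounded_linear_eq_on_dense[OF dense_G[OF n], where
        f = "\<lambda>g. inner (hilb_op (cos_op n f)) (cos_op n g)" and g = "\<lambda>g. inner f (hilb_op g)"])
    show "bounded_linear (\<lambda>g. inner (hilb_op (cos_op n f)) (cos_op n g))"
      by (intro bounded_linear_inner_right_comp C)
    show "bounded_linear (\<lambda>g. inner f (hilb_op g))"
      by (intro bounded_linear_inner_right_comp hilb_op_bounded_linear)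
  qed (use 1 in auto)
qed

text \<open>With A A = 1, W A W = A (A W A) W. Here A W A is the adjoint of W, and the adjoint of an
  isometry followed after it gives the identity, so only A remains.\<close>

lemma hilb_cos_hilb:
  assumes n: "n \<ge> 1"
  shows "hilb_op (cos_op n (hilb_op f)) = cos_op n f"
proof -
  define d where "d = hilb_op (cos_op n (hilb_op f)) - cos_op n f"
  have "inner (hilb_op (cos_op n (hilb_op f))) y = inner (cos_op n f) y" for y
  proof -
    have "inner (hilb_op (cos_op n (hilb_op f))) y = inner (hilb_op f) (hilb_op (cos_op n y))"
      using hilb_cos_adjoint[OF n, of "hilb_op f" "cos_op n y"] by (simp only: cos_op_cos_op[OF n])
    also have "\<dots> = inner (cos_op n f) y"
      by (simp only: hilb_op_inner cos_op_sym[OF n])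
    finally show ?thesis .
  qed
  from this[of d] have "inner d d = 0" by (simp add: d_def inner_diff_left)
  then show ?thesis by (simp add: d_def)
qed

section \<open>Principal values\<close>

text \<open>Substituting \<open>s = \<bar>x - t\<bar>\<close> turns the principal value into an absolutely convergent integral,
  and the logarithmic kernel becomes its own shift difference there (\<open>ell_shift_diff\<close>).\<close>

definition has_hilbert :: "(real \<Rightarrow> complex) \<Rightarrow> real \<Rightarrow> complex \<Rightarrow> bool" where
  "has_hilbert f x I \<longleftrightarrow> f \<in> borel_measurable borel \<and>
     (\<forall>\<epsilon>>0. integrable lborel (\<lambda>t. indicator {t. \<epsilon> < \<bar>x - t\<bar>} t *\<^sub>R (f t / complex_of_real (x - t)))) \<and>
     has_bochner_integral hl (\<lambda>s. (f (x - s) - f (x + s)) / complex_of_real s) I"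

lemma has_hilbert_truncation:
  assumes h: "has_hilbert f x I" and e: "\<epsilon> > 0"
  shows "(LINT t|lborel. indicator {t. \<epsilon> < \<bar>x - t\<bar>} t *\<^sub>R (f t / complex_of_real (x - t)))
    = (LINT s|hl. indicator {\<epsilon><..} s *\<^sub>R ((f (x - s) - f (x + s)) / complex_of_real s))"
proof -
  have fm [measurable]: "f \<in> borel_measurable borel" using h by (simp add: has_hilbert_def)
  define g where "g t = indicator {t. \<epsilon> < \<bar>x - t\<bar>} t *\<^sub>R (f t / complex_of_real (x - t))" for t
  have g: "integrable lborel g"
    using h e unfolding has_hilbert_def g_def[abs_def] by blast
  define k where "k s = g (x + - 1 * s)" for s
  have k: "integrable lborel k"
    unfolding k_def[abs_def] using g by (rule lborel_integrable_real_affine) simp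
  have km: "k \<in> borel_measurable borel" using k by auto
  have "integral\<^sup>L lborel g = integral\<^sup>L lborel k"
    unfolding k_def[abs_def] using lborel_integral_real_affine[of "-1" g x] by simp
  also have "\<dots> = integral\<^sup>L hl k + integral\<^sup>L hl (\<lambda>s. k (- s))"
    by (rule lborel_split_halflines(2)[OF km integrable_hl_of_lborel[OF k]])
  also have "\<dots> = (LINT s|hl. k s + k (- s))"
    by (rule Bochner_Integration.integral_add[symmetric, OF integrable_hl_of_lborel[OF k]])
  also have "\<dots> = (LINT s|hl. indicator {\<epsilon><..} s *\<^sub>R ((f (x - s) - f (x + s)) / complex_of_real s))"
  proof (rule integral_cong_AE)
    show "AE s in hl. k s + k (- s) = indicator {\<epsilon><..} s *\<^sub>R ((f (x - s) - f (x + s)) / complex_of_real s)"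
      unfolding AE_hl by (intro AE_I2 impI) (auto simp: k_def g_def indicator_def diff_divide_distrib)
  qed (use km in measurable)
  finally show ?thesis unfolding g_def .
qed

lemma hilbert_eq:
  assumes h: "has_hilbert f x I"
  shows "hilbert f x = complex_of_real (1 / pi) * I"
proof -
  have fm [measurable]: "f \<in> borel_measurable borel" using h by (simp add: has_hilbert_def)
  define T where "T \<epsilon> = (LINT t|lborel. indicator {t. \<epsilon> < \<bar>x - t\<bar>} t *\<^sub>R (f t / complex_of_real (x - t)))" for \<epsilon>
  define F where "F s = (f (x - s) - f (x + s)) / complex_of_real s" for s
  have F: "integrable hl F" "integral\<^sup>L hl F = I"
    using h unfolding has_hilbert_def F_def[abs_def] has_bochner_integral_iff by auto
  have [measurable]: "F \<in> borel_measurable borel" using F by auto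
  have "(T \<longlongrightarrow> I) (at_right 0)"
    unfolding tendsto_at_iff_sequentially
  proof (intro allI impI)
    fix X :: "nat \<Rightarrow> real" assume X: "\<forall>i. X i \<in> {0<..} - {0}" "X \<longlonglongrightarrow> 0"
    have "(\<lambda>i. LINT s|hl. indicator {X i<..} s *\<^sub>R F s) \<longlonglongrightarrow> integral\<^sup>L hl F"
    proof (rule integral_dominated_convergence[where w = "\<lambda>s. norm (F s)"])
      show "AE s in hl. (\<lambda>i. indicator {X i<..} s *\<^sub>R F s) \<longlonglongrightarrow> F s"
        unfolding AE_hl
      proof (intro AE_I2 impI)
        fix s :: real assume "0 < s"
        then have "\<forall>\<^sub>F i in sequentially. X i < s" using X(2) by (simp add: order_tendstoD)
        then have "\<forall>\<^sub>F i in sequentially. indicator {X i<..} s *\<^sub>R F s = F s"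
          by eventually_elim simp
        then show "(\<lambda>i. indicator {X i<..} s *\<^sub>R F s) \<longlonglongrightarrow> F s"
          by (rule tendsto_eventually)
      qed
    qed (use F in \<open>auto simp: indicator_def\<close>)
    moreover have "T (X i) = (LINT s|hl. indicator {X i<..} s *\<^sub>R F s)" for i
      using has_hilbert_truncation[OF h, of "X i"] X(1) by (simp add: T_def F_def)
    ultimately show "(T \<circ> X) \<longlonglongrightarrow> I" using F(2) by (simp add: o_def)
  qed
  then have "Lim (at_right 0) T = I"
    by (intro tendsto_Lim) auto
  then show ?thesis by (simp add: hilbert_def T_def[abs_def])
qed

lemma has_hilbert_zero: "has_hilbert (\<lambda>_. 0) x 0"
  by (simp add: has_hilbert_def has_bochner_integral_zero)

lemma has_hilbert_add:
  assumes f: "has_hilbert f x I" and g: "has_hilbert g x J"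
  shows "has_hilbert (\<lambda>t. f t + g t) x (I + J)"
proof -
  have "integrable lborel (\<lambda>t. indicator {t. \<epsilon> < \<bar>x - t\<bar>} t *\<^sub>R ((f t + g t) / complex_of_real (x - t)))" if "\<epsilon> > 0" for \<epsilon>
  proof -
    have "integrable lborel (\<lambda>t. indicator {t. \<epsilon> < \<bar>x - t\<bar>} t *\<^sub>R (f t / complex_of_real (x - t))
        + indicator {t. \<epsilon> < \<bar>x - t\<bar>} t *\<^sub>R (g t / complex_of_real (x - t)))"
      using f g that by (intro Bochner_Integration.integrable_add) (auto simp: has_hilbert_def)
    then show ?thesis by (simp only: add_divide_distrib scaleR_add_right)
  qed
  moreover have "has_bochner_integral hl (\<lambda>s. (f (x - s) - f (x + s)) / complex_of_real s
      + (g (x - s) - g (x + s)) / complex_of_real s) (I + J)"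
    using f g by (intro has_bochner_integral_add) (auto simp: has_hilbert_def)
  moreover have "(f (x - s) - f (x + s)) / complex_of_real s + (g (x - s) - g (x + s)) / complex_of_real s
      = (f (x - s) + g (x - s) - (f (x + s) + g (x + s))) / complex_of_real s" for s
    by (simp add: add_divide_distrib diff_divide_distrib)
  moreover have "(\<lambda>t. f t + g t) \<in> borel_measurable borel"
    using f g by (auto simp: has_hilbert_def)
  ultimately show ?thesis
    unfolding has_hilbert_def by (intro conjI allI impI) (simp_all only:)
qed

lemma has_hilbert_cmult:
  assumes f: "has_hilbert f x I"
  shows "has_hilbert (\<lambda>t. c * f t) x (c * I)"
proof -
  have "integrable lborel (\<lambda>t. indicator {t. \<epsilon> < \<bar>x - t\<bar>} t *\<^sub>R ((c * f t) / complex_of_real (x - t)))" if "\<epsilon> > 0" for \<epsilon>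
  proof -
    have "integrable lborel (\<lambda>t. c * (indicator {t. \<epsilon> < \<bar>x - t\<bar>} t *\<^sub>R (f t / complex_of_real (x - t))))"
      using f that by (intro integrable_mult_right) (auto simp: has_hilbert_def)
    then show ?thesis by simp
  qed
  moreover have "has_bochner_integral hl (\<lambda>s. c * ((f (x - s) - f (x + s)) / complex_of_real s)) (c * I)"
    using f by (intro has_bochner_integral_mult_right) (auto simp: has_hilbert_def)
  moreover have "c * ((f (x - s) - f (x + s)) / complex_of_real s) = (c * f (x - s) - c * f (x + s)) / complex_of_real s" for s
    by (simp add: right_diff_distrib)
  moreover have "(\<lambda>t. c * f t) \<in> borel_measurable borel"
    using f by (auto simp: has_hilbert_def)
  ultimately show ?thesis
    unfolding has_hilbert_def by (intro conjI allI impI) (simp_all only:)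
qed

lemma has_hilbert_sum:
  assumes "finite S" "\<And>a. a \<in> S \<Longrightarrow> has_hilbert (f a) x (I a)"
  shows "has_hilbert (\<lambda>t. \<Sum>a\<in>S. \<alpha> a * f a t) x (\<Sum>a\<in>S. \<alpha> a * I a)"
  using assms
proof (induction S)
  case empty
  then show ?case by (simp add: has_hilbert_zero)
next
  case (insert a S)
  then show ?case by (simp add: has_hilbert_add has_hilbert_cmult)
qed

text \<open>The truncated integrals do not see null sets, so the transforms agree at every point.
  This allows an inner transform to be replaced by its almost everywhere formula before the outer
  one is taken.\<close>

lemma hilbert_cong_AE:
  assumes "f \<in> borel_measurable borel" "g \<in> borel_measurable borel" "AE t in lborel. f t = g t"
  shows "hilbert f = hilbert g"
proof -
  have "(LINT t|lborel. indicator {t. \<epsilon> < \<bar>x - t\<bar>} t *\<^sub>R (f t / complex_of_real (x - t)))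
      = (LINT t|lborel. indicator {t. \<epsilon> < \<bar>x - t\<bar>} t *\<^sub>R (g t / complex_of_real (x - t)))" for \<epsilon> x
  proof (rule integral_cong_AE)
    show "AE t in lborel. indicator {t. \<epsilon> < \<bar>x - t\<bar>} t *\<^sub>R (f t / complex_of_real (x - t))
        = indicator {t. \<epsilon> < \<bar>x - t\<bar>} t *\<^sub>R (g t / complex_of_real (x - t))"
      using assms(3) by eventually_elim simp
  qed (use assms(1,2) in measurable)
  then show ?thesis by (simp add: hilbert_def fun_eq_iff)
qed

section \<open>Hilbert transforms of symmetric indicators and of the logarithmic kernel\<close>

definition sym_ind :: "real \<Rightarrow> real \<Rightarrow> real" where
  "sym_ind a t = indicator {-a..a} t"

lemma sym_ind_measurable [measurable]: "sym_ind a \<in> borel_measurable borel"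
  unfolding sym_ind_def[abs_def] by measurable

lemma sym_ind_minus: "sym_ind a (- t) = sym_ind a t"
  by (auto simp: sym_ind_def indicator_def)

text \<open>For x > 0 the difference of the two indicators is, up to an endpoint, the indicator in
  \<open>s\<close> of the interval from the absolute value of x - a to x + a, and
  \<open>ell_nn_integral\<close> applies. Negative x follows by oddness.\<close>

lemma sym_ind_diff_integral:
  assumes a: "a > 0" and x: "\<bar>x\<bar> \<noteq> a"
  shows "has_bochner_integral hl (\<lambda>s. (sym_ind a (x - s) - sym_ind a (x + s)) / s) (ell a x)"
proof -
  have pos: "has_bochner_integral hl (\<lambda>s. (sym_ind a (x - s) - sym_ind a (x + s)) / s) (ell a x)"
    if x: "x > 0" "x \<noteq> a" for x
  proof -
    have "has_bochner_integral hl (\<lambda>s. indicator {\<bar>x - a\<bar>..x + a} s * (1 / s)) (ell a x)"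
    proof (rule has_bochner_integral_nn_integral)
      show "AE s in hl. 0 \<le> indicator {\<bar>x - a\<bar>..x + a} s * (1 / s)"
        unfolding AE_hl by (intro AE_I2 impI) simp
      have "(\<integral>\<^sup>+s. ennreal (indicator {\<bar>x - a\<bar>..x + a} s * (1 / s)) \<partial>hl)
          = (\<integral>\<^sup>+s. ennreal (1 / s) * indicator {\<bar>x - a\<bar>..x + a} s \<partial>lborel)"
        using x by (subst nn_integral_hl) (auto simp: indicator_def intro!: nn_integral_cong)
      then show "(\<integral>\<^sup>+s. ennreal (indicator {\<bar>x - a\<bar>..x + a} s * (1 / s)) \<partial>hl) = ennreal (ell a x)"
        using ell_nn_integral[OF a x] by simp
    qed (use a x in \<open>auto intro: ell_nonneg\<close>)
    moreover have "AE s in hl. (sym_ind a (x - s) - sym_ind a (x + s)) / s = indicator {\<bar>x - a\<bar>..x + a} s * (1 / s)"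
      unfolding AE_hl using AE_lborel_singleton[of "a - x"]
    proof eventually_elim
      case (elim s)
      show ?case
      proof
        assume "0 < s"
        then have "sym_ind a (x - s) - sym_ind a (x + s) = indicator {\<bar>x - a\<bar>..x + a} s"
          using elim x a by (auto simp: sym_ind_def indicator_def)
        then show "(sym_ind a (x - s) - sym_ind a (x + s)) / s = indicator {\<bar>x - a\<bar>..x + a} s * (1 / s)"
          by simp
      qed
    qed
    ultimately show ?thesis
      by (subst has_bochner_integral_cong_AE) auto
  qed
  consider "x > 0" | "x = 0" | "x < 0" by linarith
  then show ?thesis
  proof cases
    case 1
    then show ?thesis using x by (intro pos) auto
  next
    case 2
    then show ?thesis by (simp add: sym_ind_minus has_bochner_integral_zero)
  next
    case 3
    then have "has_bochner_integral hl (\<lambda>s. - ((sym_ind a (- x - s) - sym_ind a (- x + s)) / s)) (- ell a (- x))"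
      using x by (intro has_bochner_integral_minus pos) auto
    moreover have "- ((sym_ind a (- x - s) - sym_ind a (- x + s)) / s) = (sym_ind a (x - s) - sym_ind a (x + s)) / s" for s
      using sym_ind_minus[of a "x + s"] sym_ind_minus[of a "x - s"]
      by (simp add: minus_divide_left)
    ultimately show ?thesis by (simp add: ell_minus_right)
  qed
qed

lemma has_hilbert_of_real:
  assumes fm [measurable]: "f \<in> borel_measurable borel"
    and int: "\<And>\<epsilon>. \<epsilon> > 0 \<Longrightarrow> integrable lborel (\<lambda>t. indicator {t. \<epsilon> < \<bar>x - t\<bar>} t * (f t / (x - t)))"
    and I: "has_bochner_integral hl (\<lambda>s. (f (x - s) - f (x + s)) / s) I"
  shows "has_hilbert (\<lambda>t. complex_of_real (f t)) x (complex_of_real I)"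
  unfolding has_hilbert_def
proof (intro conjI allI impI)
  show "integrable lborel (\<lambda>t. indicator {t. \<epsilon> < \<bar>x - t\<bar>} t *\<^sub>R (complex_of_real (f t) / complex_of_real (x - t)))" if "\<epsilon> > 0" for \<epsilon>
  proof -
    have "integrable lborel (\<lambda>t. complex_of_real (indicator {t. \<epsilon> < \<bar>x - t\<bar>} t * (f t / (x - t))))"
      using int[OF that] by (rule integrable_of_real)
    then show ?thesis by (simp add: scaleR_conv_of_real)
  qed
  have "has_bochner_integral hl (\<lambda>s. complex_of_real ((f (x - s) - f (x + s)) / s)) (complex_of_real I)"
    using I by (rule has_bochner_integral_of_real)
  then show "has_bochner_integral hl (\<lambda>s. (complex_of_real (f (x - s)) - complex_of_real (f (x + s))) / complex_of_real s) (complex_of_real I)"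
    by simp
qed measurable

lemma has_hilbert_sym_ind:
  assumes a: "a > 0" and x: "\<bar>x\<bar> \<noteq> a"
  shows "has_hilbert (\<lambda>t. complex_of_real (sym_ind a t)) x (complex_of_real (ell a x))"
proof (rule has_hilbert_of_real)
  fix \<epsilon> :: real assume e: "\<epsilon> > 0"
  show "integrable lborel (\<lambda>t. indicator {t. \<epsilon> < \<bar>x - t\<bar>} t * (sym_ind a t / (x - t)))"
  proof (rule Bochner_Integration.integrable_bound)
    show "integrable lborel (\<lambda>t. indicator {-a..a} t * (1 / \<epsilon>))"
      by (intro integrable_mult_left integrable_real_indicator) (use a in auto)
    show "AE t in lborel. norm (indicator {t. \<epsilon> < \<bar>x - t\<bar>} t * (sym_ind a t / (x - t))) \<le> norm (indicator {-a..a} t * (1 / \<epsilon>))"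
    proof (rule AE_I2)
      fix t
      show "norm (indicator {t. \<epsilon> < \<bar>x - t\<bar>} t * (sym_ind a t / (x - t))) \<le> norm (indicator {-a..a} t * (1 / \<epsilon>))"
      proof (cases "\<epsilon> < \<bar>x - t\<bar> \<and> t \<in> {-a..a}")
        case True
        then have "1 / \<bar>x - t\<bar> \<le> 1 / \<epsilon>" using e by (intro divide_left_mono) auto
        then show ?thesis using True e by (simp add: sym_ind_def)
      next
        case False
        then show ?thesis by (auto simp: sym_ind_def indicator_def)
      qed
    qed
  qed measurable
qed (use sym_ind_diff_integral[OF a x] in auto)

text \<open>After \<open>ell_shift_diff\<close> the integral ds/s produces the signs of a + x and a
  - x, whose sum is 2 for x inside (-a, a) and 0 beyond.\<close>

lemma has_hilbert_ell:
  assumes a: "a > 0" and x: "\<bar>x\<bar> \<noteq> a"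
  shows "has_hilbert (\<lambda>t. complex_of_real (ell a t)) x (complex_of_real (- pi\<^sup>2 * sym_ind a x))"
proof (rule has_hilbert_of_real)
  fix \<epsilon> :: real assume e: "\<epsilon> > 0"
  show "integrable lborel (\<lambda>t. indicator {t. \<epsilon> < \<bar>x - t\<bar>} t * (ell a t / (x - t)))"
  proof (rule Bochner_Integration.integrable_bound)
    \<comment> \<open>Where the distance of x and t exceeds \<epsilon>, the triangle inequality
      bounds \<open>\<bar>t\<bar>\<close> by this constant times \<open>\<bar>x - t\<bar>\<close>,
      so the known integrability of \<open>ell a t / t\<close> controls the truncated
      kernel.\<close>
    show "integrable lborel (\<lambda>t. (\<bar>x\<bar> / \<epsilon> + 1) * (ell a t / t))"
      by (intro integrable_mult_right ell_div_integrable_lborel)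
    show "AE t in lborel. norm (indicator {t. \<epsilon> < \<bar>x - t\<bar>} t * (ell a t / (x - t))) \<le> norm ((\<bar>x\<bar> / \<epsilon> + 1) * (ell a t / t))"
    proof (rule AE_I2)
      fix t
      show "norm (indicator {t. \<epsilon> < \<bar>x - t\<bar>} t * (ell a t / (x - t))) \<le> norm ((\<bar>x\<bar> / \<epsilon> + 1) * (ell a t / t))"
      proof (cases "\<epsilon> < \<bar>x - t\<bar> \<and> t \<noteq> 0")
        case True
        have "\<bar>t\<bar> \<le> \<bar>x\<bar> + \<bar>x - t\<bar>" by linarith
        also have "\<bar>x\<bar> = \<bar>x\<bar> / \<epsilon> * \<epsilon>" using e by simp
        also have "\<bar>x\<bar> / \<epsilon> * \<epsilon> + \<bar>x - t\<bar> \<le> \<bar>x\<bar> / \<epsilon> * \<bar>x - t\<bar> + \<bar>x - t\<bar>"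
          using True e by (intro add_right_mono mult_left_mono) auto
        finally have "\<bar>t\<bar> \<le> (\<bar>x\<bar> / \<epsilon> + 1) * \<bar>x - t\<bar>" by (simp add: distrib_right)
        then have "1 / \<bar>x - t\<bar> \<le> (\<bar>x\<bar> / \<epsilon> + 1) / \<bar>t\<bar>"
          using True e by (subst frac_le_eq) (auto simp: divide_le_0_iff mult.commute)
        then have "\<bar>ell a t\<bar> * (1 / \<bar>x - t\<bar>) \<le> \<bar>ell a t\<bar> * ((\<bar>x\<bar> / \<epsilon> + 1) / \<bar>t\<bar>)"
          by (intro mult_left_mono) auto
        moreover have "0 \<le> \<bar>x\<bar> / \<epsilon> + 1" using e by simp
        ultimately show ?thesis using True by (simp add: abs_mult mult.commute)
      next
        case False
        then show ?thesis by (auto simp: indicator_def)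
      qed
    qed
  qed measurable
next
  have "has_bochner_integral hl (\<lambda>s. - (ell (a + x) s / s + ell (a - x) s / s)) (- (sgn (a + x) * (pi\<^sup>2 / 2) + sgn (a - x) * (pi\<^sup>2 / 2)))"
    by (intro has_bochner_integral_minus has_bochner_integral_add ell_integral)
  moreover have "- (sgn (a + x) * (pi\<^sup>2 / 2) + sgn (a - x) * (pi\<^sup>2 / 2)) = - pi\<^sup>2 * sym_ind a x"
    using a x by (auto simp: sym_ind_def indicator_def sgn_if)
  moreover have "AE s in hl. (ell a (x - s) - ell a (x + s)) / s = - (ell (a + x) s / s + ell (a - x) s / s)"
    unfolding AE_hl
    using AE_lborel_singleton[of "a + x"] AE_lborel_singleton[of "- (a + x)"]
      AE_lborel_singleton[of "a - x"] AE_lborel_singleton[of "x - a"]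
  proof eventually_elim
    case (elim s)
    then have "ell a (x + s) - ell a (x - s) = ell (a + x) s + ell (a - x) s"
      by (intro ell_shift_diff) auto
    then have "ell a (x - s) - ell a (x + s) = - (ell (a + x) s + ell (a - x) s)" by linarith
    then show ?case by (simp add: add_divide_distrib diff_divide_distrib)
  qed
  ultimately show "has_bochner_integral hl (\<lambda>s. (ell a (x - s) - ell a (x + s)) / s) (- pi\<^sup>2 * sym_ind a x)"
    by (subst has_bochner_integral_cong_AE) auto
qed measurable

section \<open>Even step functions and the Haar spaces\<close>

definition even_step :: "(real \<Rightarrow> complex) \<Rightarrow> real set \<Rightarrow> (real \<Rightarrow> complex) \<Rightarrow> bool" where
  "even_step u S \<alpha> \<longleftrightarrow> finite S \<and> S \<subseteq> {0<..} \<and> u \<in> borel_measurable borel \<and>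
     (AE t in lborel. u t = (\<Sum>a\<in>S. \<alpha> a * complex_of_real (sym_ind a t)))"

lemma AE_abs_notin:
  assumes "finite S"
  shows "AE x in lborel. \<bar>x\<bar> \<notin> (S :: real set)"
proof -
  have "AE x in lborel. \<bar>x\<bar> \<noteq> a" for a :: real
    using AE_lborel_singleton[of a] AE_lborel_singleton[of "- a"] by eventually_elim auto
  then have "AE x in lborel. \<forall>a\<in>S. \<bar>x\<bar> \<noteq> a"
    using assms by (simp add: AE_ball_countable countable_finite)
  then show ?thesis by eventually_elim auto
qed

lemma hilbert_even_step:
  assumes u: "even_step u S \<alpha>" and x: "\<bar>x\<bar> \<notin> S"
  shows "hilbert u x = (\<Sum>a\<in>S. \<alpha> a * complex_of_real (ell a x / pi))"
proof -
  have fin: "finite S" using u by (simp add: even_step_def)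
  have "hilbert u x = hilbert (\<lambda>t. \<Sum>a\<in>S. \<alpha> a * complex_of_real (sym_ind a t)) x"
    using u by (intro fun_cong[OF hilbert_cong_AE]) (auto simp: even_step_def)
  also have "\<dots> = complex_of_real (1 / pi) * (\<Sum>a\<in>S. \<alpha> a * complex_of_real (ell a x))"
    using u x by (intro hilbert_eq has_hilbert_sum has_hilbert_sym_ind) (auto simp: even_step_def)
  also have "\<dots> = (\<Sum>a\<in>S. \<alpha> a * complex_of_real (ell a x / pi))"
    by (simp add: sum_distrib_left mult_ac)
  finally show ?thesis .
qed

lemma measurable_off_finite_abs:
  assumes "g \<in> borel_measurable borel" "finite S" and eq: "\<And>x. \<bar>x\<bar> \<notin> S \<Longrightarrow> f x = g (x :: real)"
  shows "f \<in> borel_measurable borel"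
proof (rule measurable_discrete_difference[OF assms(1), where X = "S \<union> uminus ` S"])
  show "countable (S \<union> uminus ` S)" using assms(2) by (auto simp: countable_finite)
  show "g x = f x" if "x \<notin> S \<union> uminus ` S" for x
    using that by (intro eq[symmetric]) (auto simp: abs_if image_iff split: if_splits)
qed auto

lemma hilbert_even_step_measurable: "even_step u S \<alpha> \<Longrightarrow> hilbert u \<in> borel_measurable borel"
  by (rule measurable_off_finite_abs[OF _ _ hilbert_even_step]) (auto simp: even_step_def)

text \<open>Off finitely many points the first transform is a sum of logarithms, and
  \<open>has_hilbert_ell\<close> sends these back with the factor \<open>- pi\<^sup>2\<close>. The
  two factors 1/pi leave -1.\<close>

lemma hilbert_hilbert_even_step:
  assumes u: "even_step u S \<alpha>"
  shows "hilbert (hilbert u) \<in> borel_measurable borel"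
    and "AE x in lborel. hilbert (hilbert u) x = - (\<Sum>a\<in>S. \<alpha> a * complex_of_real (sym_ind a x))"
proof -
  have fin: "finite S" using u by (simp add: even_step_def)
  define v where "v t = (\<Sum>a\<in>S. (\<alpha> a / complex_of_real pi) * complex_of_real (ell a t))" for t
  have "hilbert (hilbert u) = hilbert v"
  proof (rule hilbert_cong_AE)
    show "hilbert u \<in> borel_measurable borel" by (rule hilbert_even_step_measurable[OF u])
    show "v \<in> borel_measurable borel" unfolding v_def[abs_def] by measurable
    show "AE t in lborel. hilbert u t = v t"
      using AE_abs_notin[OF fin] by eventually_elim (simp add: hilbert_even_step[OF u] v_def)
  qed
  moreover have "hilbert v x = - (\<Sum>a\<in>S. \<alpha> a * complex_of_real (sym_ind a x))" if "\<bar>x\<bar> \<notin> S" for x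
  proof -
    have "hilbert v x = complex_of_real (1 / pi) *
        (\<Sum>a\<in>S. (\<alpha> a / complex_of_real pi) * complex_of_real (- pi\<^sup>2 * sym_ind a x))"
      unfolding v_def using u that
      by (intro hilbert_eq has_hilbert_sum has_hilbert_ell) (auto simp: even_step_def)
    also have "\<dots> = - (\<Sum>a\<in>S. \<alpha> a * complex_of_real (sym_ind a x))"
      by (simp add: sum_distrib_left sum_negf power2_eq_square)
    finally show ?thesis .
  qed
  ultimately have *: "hilbert (hilbert u) x = - (\<Sum>a\<in>S. \<alpha> a * complex_of_real (sym_ind a x))" if "\<bar>x\<bar> \<notin> S" for x
    using that by simp
  show "AE x in lborel. hilbert (hilbert u) x = - (\<Sum>a\<in>S. \<alpha> a * complex_of_real (sym_ind a x))"
    using AE_abs_notin[OF fin] by eventually_elim (rule *)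
  show "hilbert (hilbert u) \<in> borel_measurable borel"
    by (rule measurable_off_finite_abs[OF _ fin *]) auto
qed

lemma AE_lborel_uminus:
  assumes "AE x in lborel. P (x :: real)"
  shows "AE x in lborel. P (- x)"
proof -
  have "AE x in distr lborel borel uminus. P (x :: real)"
    using assms by (simp only: lborel_distr_uminus)
  then show ?thesis by (intro AE_distrD[of uminus lborel borel]) auto
qed

lemma even_step_zero: "even_step (\<lambda>_. 0) {} \<alpha>"
  by (simp add: even_step_def)

lemma even_step_add:
  assumes "even_step u S \<alpha>" "even_step v S' \<beta>"
  shows "even_step (\<lambda>t. u t + v t) (S \<union> S')
    (\<lambda>a. (if a \<in> S then \<alpha> a else 0) + (if a \<in> S' then \<beta> a else 0))"
proof -
  have fin: "finite S" "finite S'" using assms by (auto simp: even_step_def)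
  have sum_if: "(\<Sum>a\<in>S \<union> S'. (if a \<in> S0 then \<gamma> a else 0) * f a) = (\<Sum>a\<in>S0. \<gamma> a * f a)"
    if "S0 \<subseteq> S \<union> S'" for S0 and \<gamma> f :: "real \<Rightarrow> complex"
  proof -
    have "(\<Sum>a\<in>S0. \<gamma> a * f a) = (\<Sum>a\<in>S0. (if a \<in> S0 then \<gamma> a else 0) * f a)"
      by (rule sum.cong) auto
    also have "\<dots> = (\<Sum>a\<in>S \<union> S'. (if a \<in> S0 then \<gamma> a else 0) * f a)"
      using that fin by (intro sum.mono_neutral_left) auto
    finally show ?thesis by simp
  qed
  have "AE t in lborel. u t = (\<Sum>a\<in>S. \<alpha> a * complex_of_real (sym_ind a t))"
    "AE t in lborel. v t = (\<Sum>a\<in>S'. \<beta> a * complex_of_real (sym_ind a t))"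
    using assms by (auto simp: even_step_def)
  then have "AE t in lborel. u t + v t = (\<Sum>a\<in>S \<union> S'. ((if a \<in> S then \<alpha> a else 0) + (if a \<in> S' then \<beta> a else 0)) * complex_of_real (sym_ind a t))"
    by eventually_elim (simp only: distrib_right sum.distrib sum_if Un_upper1 Un_upper2)
  then show ?thesis using assms by (auto simp: even_step_def)
qed

lemma even_step_cmult:
  assumes "even_step u S \<alpha>"
  shows "even_step (\<lambda>t. c * u t) S (\<lambda>a. c * \<alpha> a)"
proof -
  have "AE t in lborel. u t = (\<Sum>a\<in>S. \<alpha> a * complex_of_real (sym_ind a t))"
    using assms by (auto simp: even_step_def)
  then have "AE t in lborel. c * u t = (\<Sum>a\<in>S. c * \<alpha> a * complex_of_real (sym_ind a t))"
    by eventually_elim (simp add: sum_distrib_left mult.assoc)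
  then show ?thesis using assms by (auto simp: even_step_def)
qed

lemma even_step_cong_AE:
  assumes "even_step u S \<alpha>" "v \<in> borel_measurable borel" "AE t in lborel. v t = u t"
  shows "even_step v S \<alpha>"
proof -
  have "AE t in lborel. u t = (\<Sum>a\<in>S. \<alpha> a * complex_of_real (sym_ind a t))"
    using assms by (auto simp: even_step_def)
  with assms(3) have "AE t in lborel. v t = (\<Sum>a\<in>S. \<alpha> a * complex_of_real (sym_ind a t))"
    by eventually_elim simp
  then show ?thesis using assms by (auto simp: even_step_def)
qed

lemma even_step_sym_ind:
  assumes "a \<ge> 0"
  shows "\<exists>S \<alpha>. even_step (\<lambda>t. complex_of_real (sym_ind a t)) S \<alpha>"
proof (cases "a = 0")
  case True
  have "AE t in lborel. complex_of_real (sym_ind a t) = 0"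
    using AE_lborel_singleton[of "0::real"] by eventually_elim (auto simp: sym_ind_def True indicator_def)
  then have "even_step (\<lambda>t. complex_of_real (sym_ind a t)) {} (\<lambda>_. 0)"
    by (intro even_step_cong_AE[OF even_step_zero]) auto
  then show ?thesis by blast
next
  case False
  then have "even_step (\<lambda>t. complex_of_real (sym_ind a t)) {a} (\<lambda>_. 1)"
    using assms by (auto simp: even_step_def)
  then show ?thesis by blast
qed

lemma haar_measurable [measurable]: "haar_phi j k \<in> borel_measurable borel"
  unfolding haar_phi_def[abs_def] by measurable

lemma AE_not_dyadic: "AE t in lborel. \<forall>m::int. (2::real) powr real_of_int j * t \<noteq> real_of_int m"
proof -
  have "AE t in lborel. (2::real) powr real_of_int j * t \<noteq> real_of_int m" for m
    using AE_lborel_singleton[of "real_of_int m / 2 powr real_of_int j"]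
    by eventually_elim (auto simp: field_simps)
  then show ?thesis by (simp add: AE_all_countable)
qed

lemma indicator_unit_shift:
  assumes "\<forall>m::int. y \<noteq> real_of_int m"
  shows "indicator {0..1} (y - real_of_int k) = (if k = \<lfloor>y\<rfloor> then 1 else 0 :: 'a::{zero_neq_one})"
proof -
  have "y - real_of_int k \<in> {0..1} \<longleftrightarrow> real_of_int k \<le> y \<and> y < real_of_int k + 1"
    using assms[rule_format, of "k + 1"] by auto
  also have "\<dots> \<longleftrightarrow> k = \<lfloor>y\<rfloor>" by (auto simp: eq_commute[of k] floor_eq_iff)
  finally show ?thesis by (simp add: indicator_def)
qed

text \<open>A dyadic interval together with its mirror image is an interval with a symmetric hole, a
  difference of two symmetric intervals. The identity is almost everywhere because the Haar
  intervals are closed and share endpoints.\<close>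

lemma haar_even_part:
  obtains a b where "a \<ge> 0" "b \<ge> 0"
    "AE t in lborel. haar_phi j k t + haar_phi j k (- t)
      = complex_of_real (sym_ind a t) - complex_of_real (sym_ind b t)"
proof -
  define h where "h = (2::real) powr real_of_int j"
  have h: "h > 0" by (simp add: h_def)
  \<comment> \<open>The distance from 0 of [k, k + 1], and so of its mirror image, in units of the
    dyadic mesh: k for k >= 0 and -k - 1 otherwise.\<close>
  define m where "m = max (real_of_int k) (- real_of_int k - 1)"
  have m: "m \<ge> 0" unfolding m_def by (cases "k \<ge> 0") (auto simp: max_def)
  have "AE t in lborel. haar_phi j k t + haar_phi j k (- t)
      = complex_of_real (sym_ind ((m + 1) / h) t) - complex_of_real (sym_ind (m / h) t)"
    using AE_not_dyadic[of j]
  proof eventually_elim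
    case (elim t)
    define y where "y = h * t"
    have y: "y \<noteq> real_of_int i" for i using elim by (simp add: y_def h_def)
    have s: "sym_ind (c / h) t = (if \<bar>y\<bar> \<le> c then 1 else 0)" for c
    proof -
      have "t \<in> {- (c / h)..c / h} \<longleftrightarrow> \<bar>y\<bar> \<le> c"
        using h by (auto simp: y_def field_simps abs_le_iff)
      then show ?thesis by (simp add: sym_ind_def indicator_def)
    qed
    have k1: "y \<noteq> real_of_int k" "y \<noteq> real_of_int k + 1" "- y \<noteq> real_of_int k" "- y \<noteq> real_of_int k + 1"
      using y[of k] y[of "k + 1"] y[of "- k"] y[of "- k - 1"] by auto
    have "haar_phi j k t + haar_phi j k (- t)
        = (if real_of_int k \<le> y \<and> y \<le> real_of_int k + 1 then 1 else 0)
        + (if real_of_int k \<le> - y \<and> - y \<le> real_of_int k + 1 then 1 else 0)"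
      by (auto simp: haar_phi_def y_def h_def indicator_def)
    also have "\<dots> = complex_of_real (sym_ind ((m + 1) / h) t) - complex_of_real (sym_ind (m / h) t)"
    proof (cases "k \<ge> 0")
      case True
      then have "m = real_of_int k" "real_of_int k \<ge> 0" by (auto simp: m_def max_def)
      then show ?thesis unfolding s using k1 by auto
    next
      case False
      then have "real_of_int k \<le> -1" by linarith
      moreover from this have "m = - real_of_int k - 1" by (auto simp: m_def max_def)
      ultimately show ?thesis unfolding s using k1 by auto
    qed
    finally show ?case .
  qed
  with m h show ?thesis by (intro that[of "(m + 1) / h" "m / h"]) auto
qed

text \<open>Evenness is replaced by averaging: u equals half of u(t) + u(-t) almost everywhere, so
  each Haar function may be exchanged for its symmetrisation without comparing coefficients.\<close>

lemma V_plus_even_step: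
  assumes u: "u \<in> V_plus j"
  obtains S \<alpha> where "even_step u S \<alpha>"
proof -
  obtain K c where K: "finite K" "\<And>t. u t = (\<Sum>k\<in>K. c k * haar_phi j k t)"
    and even: "AE t in lborel. u (- t) = u t"
    using u by (auto simp: V_plus_def V_space_def)
  have um: "u \<in> borel_measurable borel"
    unfolding K(2)[abs_def] by measurable
  have step: "\<exists>S \<alpha>. even_step (\<lambda>t. haar_phi j k t + haar_phi j k (- t)) S \<alpha>" for k
  proof -
    obtain a b where ab: "a \<ge> 0" "b \<ge> 0"
      "AE t in lborel. haar_phi j k t + haar_phi j k (- t)
        = complex_of_real (sym_ind a t) - complex_of_real (sym_ind b t)"
      by (rule haar_even_part)
    obtain S \<alpha> where 1: "even_step (\<lambda>t. complex_of_real (sym_ind a t)) S \<alpha>"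
      using even_step_sym_ind[OF ab(1)] by blast
    obtain S' \<beta> where 2: "even_step (\<lambda>t. complex_of_real (sym_ind b t)) S' \<beta>"
      using even_step_sym_ind[OF ab(2)] by blast
    have "AE t in lborel. haar_phi j k t + haar_phi j k (- t)
        = complex_of_real (sym_ind a t) + (-1) * complex_of_real (sym_ind b t)"
      using ab(3) by simp
    moreover have "(\<lambda>t. haar_phi j k t + haar_phi j k (- t)) \<in> borel_measurable borel"
      by measurable
    ultimately show ?thesis
      using even_step_cong_AE[OF even_step_add[OF 1 even_step_cmult[OF 2, of "-1"]]] by blast
  qed
  have "\<exists>S \<alpha>. even_step (\<lambda>t. \<Sum>k\<in>K. (c k / 2) * (haar_phi j k t + haar_phi j k (- t))) S \<alpha>"
    using K(1)
  proof (induction K)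
    case empty
    then show ?case using even_step_zero by (simp only: sum.empty) blast
  next
    case (insert k K)
    obtain S \<alpha> where 1: "even_step (\<lambda>t. haar_phi j k t + haar_phi j k (- t)) S \<alpha>"
      using step by blast
    obtain S' \<beta> where 2: "even_step (\<lambda>t. \<Sum>k\<in>K. (c k / 2) * (haar_phi j k t + haar_phi j k (- t))) S' \<beta>"
      using insert.IH by blast
    show ?case
      unfolding sum.insert[OF insert.hyps] using even_step_add[OF even_step_cmult[OF 1] 2] by blast
  qed
  then obtain S \<alpha> where S: "even_step (\<lambda>t. \<Sum>k\<in>K. (c k / 2) * (haar_phi j k t + haar_phi j k (- t))) S \<alpha>"
    by blast
  have "AE t in lborel. u t = (\<Sum>k\<in>K. (c k / 2) * (haar_phi j k t + haar_phi j k (- t)))"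
    using even
  proof eventually_elim
    case (elim t)
    have "u t = (u t + u (- t)) / 2" using elim by simp
    also have "\<dots> = (\<Sum>k\<in>K. (c k / 2) * (haar_phi j k t + haar_phi j k (- t)))"
      by (simp add: K(2) distrib_left sum.distrib sum_divide_distrib add_divide_distrib)
    finally show ?case .
  qed
  then have "even_step u S \<alpha>" by (rule even_step_cong_AE[OF S um])
  then show ?thesis by (rule that)
qed

text \<open>The interval is tiled by the 2m dyadic cells with index from -m to m - 1. It supplies
  enough members of the prescribed spaces for the uniqueness argument.\<close>

lemma sym_ind_dyadic:
  fixes m j :: nat
  assumes "m > 0"
  obtains u where "u \<in> V_plus (int j)" "AE t in lborel. u t = complex_of_real (sym_ind (real m / 2 ^ j) t)"
    "u \<in> borel_measurable borel"
proof -
  define u where "u t = (\<Sum>k\<in>{- int m..<int m}. 1 * haar_phi (int j) k t)" for t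
  have ae: "AE t in lborel. u t = complex_of_real (sym_ind (real m / 2 ^ j) t)"
    using AE_not_dyadic[of "int j"]
  proof eventually_elim
    case (elim t)
    define y where "y = (2::real) ^ j * t"
    have e: "(2::real) powr real_of_int (int j) = 2 ^ j" by (simp add: powr_realpow)
    have y: "\<forall>i::int. y \<noteq> real_of_int i" using elim unfolding e y_def by simp
    have "u t = (\<Sum>k\<in>{- int m..<int m}. if k = \<lfloor>y\<rfloor> then 1 else 0)"
      unfolding u_def haar_phi_def e y_def[symmetric] indicator_unit_shift[OF y] by simp
    also have "\<dots> = (if \<lfloor>y\<rfloor> \<in> {- int m..<int m} then 1 else 0)"
      by simp
    also have "\<lfloor>y\<rfloor> \<in> {- int m..<int m} \<longleftrightarrow> t \<in> {- (real m / 2 ^ j)..real m / 2 ^ j}"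
    proof -
      have "\<lfloor>y\<rfloor> \<in> {- int m..<int m} \<longleftrightarrow> - real m \<le> y \<and> y < real m"
        by (simp add: le_floor_iff floor_less_iff)
      also have "\<dots> \<longleftrightarrow> - real m \<le> y \<and> y \<le> real m"
        using y[rule_format, of "int m"] by auto
      also have "\<dots> \<longleftrightarrow> t \<in> {- (real m / 2 ^ j)..real m / 2 ^ j}"
        by (auto simp: y_def field_simps)
      finally show ?thesis .
    qed
    finally show ?case by (simp add: sym_ind_def indicator_def)
  qed
  moreover have "u \<in> V_plus (int j)"
    unfolding V_plus_def V_space_def
  proof (intro CollectI conjI)
    show "\<exists>K a. finite K \<and> (\<forall>t. u t = (\<Sum>k\<in>K. a k * haar_phi (int j) k t))"
      by (intro exI[of _ "{- int m..<int m}"] exI[of _ "\<lambda>_. 1"]) (simp add: u_def)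
    show "AE t in lborel. u (- t) = u t"
      using ae AE_lborel_uminus[OF ae] by eventually_elim (simp add: sym_ind_minus)
  qed
  moreover have "u \<in> borel_measurable borel"
    unfolding u_def[abs_def] by measurable
  ultimately show ?thesis using that by blast
qed

section \<open>Even and odd parts\<close>

definition sqL :: "(real \<Rightarrow> real) \<Rightarrow> bool" where
  "sqL g \<longleftrightarrow> g \<in> borel_measurable borel \<and> integrable lborel (\<lambda>x. (g x)\<^sup>2)"

lemma sqL_sqr:
  assumes "sqL g"
  shows "sqr g" "sqr (\<lambda>x. g (- x))"
proof -
  have m: "g \<in> borel_measurable borel" using assms by (simp add: sqL_def)
  have "integrable lborel (\<lambda>x. (g x)\<^sup>2)" using assms by (simp add: sqL_def)
  note i = integrable_hl_of_lborel[OF this]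
  show "sqr g" "sqr (\<lambda>x. g (- x))" using i m by (auto simp: sqr_def)
qed

definition even_part :: "(real \<Rightarrow> real) \<Rightarrow> real \<Rightarrow> real" where
  "even_part g x = (g x + g (- x)) / 2"

definition odd_part :: "(real \<Rightarrow> real) \<Rightarrow> real \<Rightarrow> real" where
  "odd_part g x = (g x - g (- x)) / 2"

lemma sqr_even_part: "sqL g \<Longrightarrow> sqr (even_part g)"
  using sqr_scale[OF sqr_add[OF sqL_sqr], of g g "1/2"] by (simp add: even_part_def[abs_def])

lemma sqr_odd_part: "sqL g \<Longrightarrow> sqr (odd_part g)"
  using sqr_scale[OF sqr_diff[OF sqL_sqr], of g g "1/2"] by (simp add: odd_part_def[abs_def])

definition cl :: "(real \<Rightarrow> real) \<Rightarrow> l2 \<times> l2" where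
  "cl g = (abs_l2 (even_part g), abs_l2 (odd_part g))"

definition mk :: "l2 \<times> l2 \<Rightarrow> real \<Rightarrow> real" where
  "mk p x = rep_l2 (fst p) \<bar>x\<bar> + sgn x * rep_l2 (snd p) \<bar>x\<bar>"

lemma mk_measurable [measurable]: "mk p \<in> borel_measurable borel"
  unfolding mk_def[abs_def] sgn_if by measurable

lemma sqL_mk: "sqL (mk p)"
  unfolding sqL_def
proof
  have 1: "AE x in hl. (mk p x)\<^sup>2 = (rep_l2 (fst p) x + rep_l2 (snd p) x)\<^sup>2"
    unfolding AE_hl by (intro AE_I2 impI) (simp add: mk_def)
  have 2: "AE x in hl. (mk p (- x))\<^sup>2 = (rep_l2 (fst p) x - rep_l2 (snd p) x)\<^sup>2"
    unfolding AE_hl by (intro AE_I2 impI) (simp add: mk_def)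
  have "integrable hl (\<lambda>x. (rep_l2 (fst p) x + rep_l2 (snd p) x)\<^sup>2)"
    "integrable hl (\<lambda>x. (rep_l2 (fst p) x - rep_l2 (snd p) x)\<^sup>2)"
    using sqr_add[OF sqr_rep sqr_rep] sqr_diff[OF sqr_rep sqr_rep] by (auto simp: sqr_def)
  then have "integrable hl (\<lambda>x. (mk p x)\<^sup>2)" "integrable hl (\<lambda>x. (mk p (- x))\<^sup>2)"
    using integrable_cong_AE[OF _ _ 1] integrable_cong_AE[OF _ _ 2] by auto
  then show "integrable lborel (\<lambda>x. (mk p x)\<^sup>2)"
    by (intro lborel_split_halflines(1)) auto
qed measurable

lemma cl_mk: "cl (mk p) = p"
proof -
  have "abs_l2 (even_part (mk p)) = abs_l2 (rep_l2 (fst p))"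
    using sqr_even_part[OF sqL_mk, of p]
    by (subst abs_l2_eq_iff) (auto simp: sqr_rep AE_hl even_part_def mk_def)
  moreover have "abs_l2 (odd_part (mk p)) = abs_l2 (rep_l2 (snd p))"
    using sqr_odd_part[OF sqL_mk, of p]
    by (subst abs_l2_eq_iff) (auto simp: sqr_rep AE_hl odd_part_def mk_def)
  ultimately show ?thesis by (simp add: cl_def abs_rep_l2)
qed

lemma AE_hl_abs:
  assumes "AE x in hl. P x"
  shows "AE x in lborel. P \<bar>x\<bar>"
proof -
  have 1: "AE x in lborel. x > 0 \<longrightarrow> P x" using assms by (simp add: AE_hl)
  show ?thesis
    using 1 AE_lborel_uminus[OF 1] AE_lborel_singleton[of "0::real"]
    by eventually_elim (auto simp: abs_if)
qed

lemma mk_cl: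
  assumes g: "sqL g"
  shows "AE x in lborel. mk (cl g) x = g x"
  using AE_hl_abs[OF rep_abs_l2[OF sqr_even_part[OF g]]]
    AE_hl_abs[OF rep_abs_l2[OF sqr_odd_part[OF g]]] AE_lborel_singleton[of "0::real"]
proof eventually_elim
  case (elim x)
  then show ?case
    by (cases "x > 0") (simp_all add: mk_def cl_def even_part_def odd_part_def field_simps)
qed

lemma cl_lin:
  assumes f: "sqL f" and g: "sqL g"
  shows "sqL (\<lambda>x. a * f x + b * g x)" "cl (\<lambda>x. a * f x + b * g x) = a *\<^sub>R cl f + b *\<^sub>R cl g"
proof -
  have m: "(\<lambda>x. a * f x + b * g x) \<in> borel_measurable borel" using f g by (auto simp: sqL_def)
  have "sqr (\<lambda>x. a * f x + b * g x)" "sqr (\<lambda>x. a * f (- x) + b * g (- x))"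
    using sqr_add[OF sqr_scale[OF sqL_sqr(1)[OF f]] sqr_scale[OF sqL_sqr(1)[OF g]]]
      sqr_add[OF sqr_scale[OF sqL_sqr(2)[OF f]] sqr_scale[OF sqL_sqr(2)[OF g]]] by blast+
  then show "sqL (\<lambda>x. a * f x + b * g x)"
    using m unfolding sqL_def sqr_def by (auto intro!: lborel_split_halflines(1))
  have "even_part (\<lambda>x. a * f x + b * g x) = (\<lambda>x. a * even_part f x + b * even_part g x)"
    "odd_part (\<lambda>x. a * f x + b * g x) = (\<lambda>x. a * odd_part f x + b * odd_part g x)"
    by (auto simp: even_part_def odd_part_def field_simps)
  then show "cl (\<lambda>x. a * f x + b * g x) = a *\<^sub>R cl f + b *\<^sub>R cl g"
    using f g by (simp add: cl_def scaleR_abs_l2 add_abs_l2 sqr_even_part sqr_odd_part sqr_scale)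
qed

lemma norm_cl:
  assumes g: "sqL g"
  shows "(LINT x|lborel. (g x)\<^sup>2) = 2 * (norm (cl g))\<^sup>2"
proof -
  have m: "(\<lambda>x. (g x)\<^sup>2) \<in> borel_measurable borel" using g by (auto simp: sqL_def)
  have s: "integrable hl (\<lambda>x. (g x)\<^sup>2)" "integrable hl (\<lambda>x. (g (- x))\<^sup>2)"
    using sqL_sqr[OF g] by (auto simp: sqr_def)
  have e: "integrable hl (\<lambda>x. (even_part g x)\<^sup>2)" and o: "integrable hl (\<lambda>x. (odd_part g x)\<^sup>2)"
    using sqr_even_part[OF g] sqr_odd_part[OF g] by (auto simp: sqr_def)
  have "(LINT x|lborel. (g x)\<^sup>2) = (LINT x|hl. (g x)\<^sup>2 + (g (- x))\<^sup>2)"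
    unfolding lborel_split_halflines(2)[OF m s] by (rule Bochner_Integration.integral_add[symmetric, OF s])
  also have "\<dots> = (LINT x|hl. 2 * ((even_part g x)\<^sup>2 + (odd_part g x)\<^sup>2))"
    by (rule Bochner_Integration.integral_cong) (auto simp: even_part_def odd_part_def power2_eq_square field_simps)
  also have "\<dots> = 2 * ((LINT x|hl. (even_part g x)\<^sup>2) + (LINT x|hl. (odd_part g x)\<^sup>2))"
    using e o by simp
  also have "\<dots> = 2 * (norm (cl g))\<^sup>2"
    using g by (simp add: cl_def norm_Pair norm_abs_l2 sqr_even_part sqr_odd_part)
  finally show ?thesis .
qed

lemma cl_cong_AE:
  assumes f: "sqL f" and g: "sqL g" and ae: "AE x in lborel. f x = g x"
  shows "cl f = cl g"
proof -
  have "2 * (norm (cl (\<lambda>x. 1 * f x + (-1) * g x)))\<^sup>2 = (LINT x|lborel. (1 * f x + (-1) * g x)\<^sup>2)"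
    by (rule norm_cl[symmetric, OF cl_lin(1)[OF f g]])
  also have "\<dots> = (LINT x|(lborel :: real measure). (0 :: real))"
  proof (rule integral_cong_AE)
    show "AE x in lborel. (1 * f x + (-1) * g x)\<^sup>2 = 0" using ae by eventually_elim simp
  qed (use f g in \<open>auto simp: sqL_def\<close>)
  finally show ?thesis by (simp only: cl_lin(2)[OF f g]) simp
qed

section \<open>Complex functions on the line as four half-line coordinates\<close>

lemma sq_int_iff: "sq_int f \<longleftrightarrow> sqL (\<lambda>x. Re (f x)) \<and> sqL (\<lambda>x. Im (f x))"
proof
  assume f: "sq_int f"
  then have [measurable]: "f \<in> borel_measurable borel" and i: "integrable lborel (\<lambda>x. (cmod (f x))\<^sup>2)"
    by (auto simp: sq_int_def)
  have "integrable lborel (\<lambda>x. (Re (f x))\<^sup>2)"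
    by (rule Bochner_Integration.integrable_bound[OF i]) (auto simp: cmod_power2)
  moreover have "integrable lborel (\<lambda>x. (Im (f x))\<^sup>2)"
    by (rule Bochner_Integration.integrable_bound[OF i]) (auto simp: cmod_power2)
  ultimately show "sqL (\<lambda>x. Re (f x)) \<and> sqL (\<lambda>x. Im (f x))" by (simp add: sqL_def)
next
  assume *: "sqL (\<lambda>x. Re (f x)) \<and> sqL (\<lambda>x. Im (f x))"
  then have "f \<in> borel_measurable borel" by (simp add: sqL_def borel_measurable_complex_iff)
  moreover have "integrable lborel (\<lambda>x. (cmod (f x))\<^sup>2)"
    using * unfolding cmod_power2 sqL_def by auto
  ultimately show "sq_int f" by (simp add: sq_int_def)
qed

text \<open>Order of the coordinates: ((even part, odd part) of the real part, (even part, odd part)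
  of the imaginary part).\<close>

type_synonym vec4 = "(l2 \<times> l2) \<times> (l2 \<times> l2)"

definition vec :: "(real \<Rightarrow> complex) \<Rightarrow> vec4" where
  "vec f = (cl (\<lambda>x. Re (f x)), cl (\<lambda>x. Im (f x)))"

definition fn :: "vec4 \<Rightarrow> real \<Rightarrow> complex" where
  "fn v x = Complex (mk (fst v) x) (mk (snd v) x)"

text \<open>Multiplication by a complex number, spelled out on real and imaginary coordinates
  because \<open>l2\<close> is a real space.\<close>

definition cscale :: "complex \<Rightarrow> vec4 \<Rightarrow> vec4" where
  "cscale a v = (Re a *\<^sub>R fst v - Im a *\<^sub>R snd v, Re a *\<^sub>R snd v + Im a *\<^sub>R fst v)"

lemma sq_int_fn: "sq_int (fn v)"
  by (simp add: sq_int_iff fn_def sqL_mk)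

lemma vec_fn: "vec (fn v) = v"
  by (simp add: vec_def fn_def cl_mk)

lemma fn_vec:
  assumes f: "sq_int f"
  shows "AE x in lborel. fn (vec f) x = f x"
proof -
  have "sqL (\<lambda>x. Re (f x))" "sqL (\<lambda>x. Im (f x))" using f by (auto simp: sq_int_iff)
  from mk_cl[OF this(1)] mk_cl[OF this(2)] show ?thesis
    by eventually_elim (simp add: fn_def vec_def)
qed

lemma vec_eq_iff:
  assumes f: "sq_int f" and g: "sq_int g"
  shows "vec f = vec g \<longleftrightarrow> (AE x in lborel. f x = g x)"
proof
  assume "vec f = vec g"
  with fn_vec[OF f] fn_vec[OF g] show "AE x in lborel. f x = g x"
    by (auto elim: eventually_elim2)
next
  assume ae: "AE x in lborel. f x = g x"
  then have "AE x in lborel. Re (f x) = Re (g x)" "AE x in lborel. Im (f x) = Im (g x)"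
    by (auto elim: eventually_mono)
  then show "vec f = vec g"
    using f g by (auto simp: vec_def sq_int_iff intro!: cl_cong_AE)
qed

lemma vec_lin:
  assumes f: "sq_int f" and g: "sq_int g"
  shows "sq_int (\<lambda>x. a * f x + b * g x)"
    and "vec (\<lambda>x. a * f x + b * g x) = cscale a (vec f) + cscale b (vec g)"
proof -
  have s: "sqL (\<lambda>x. Re (f x))" "sqL (\<lambda>x. Im (f x))" "sqL (\<lambda>x. Re (g x))" "sqL (\<lambda>x. Im (g x))"
    using f g by (auto simp: sq_int_iff)
  have re: "Re (a * f x + b * g x) = 1 * (Re a * Re (f x) + (- Im a) * Im (f x)) + 1 * (Re b * Re (g x) + (- Im b) * Im (g x))"
    and im: "Im (a * f x + b * g x) = 1 * (Re a * Im (f x) + Im a * Re (f x)) + 1 * (Re b * Im (g x) + Im b * Re (g x))" for x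
    by simp_all
  show "sq_int (\<lambda>x. a * f x + b * g x)"
    unfolding sq_int_iff re im by (intro conjI cl_lin(1) s)
  show "vec (\<lambda>x. a * f x + b * g x) = cscale a (vec f) + cscale b (vec g)"
    unfolding vec_def re im
    by (simp only: cl_lin(2)[OF cl_lin(1)[OF s(1,2)] cl_lin(1)[OF s(3,4)]]
        cl_lin(2)[OF cl_lin(1)[OF s(2,1)] cl_lin(1)[OF s(4,3)]] cl_lin(2)[OF s(1,2)] cl_lin(2)[OF s(3,4)]
        cl_lin(2)[OF s(2,1)] cl_lin(2)[OF s(4,3)]) (simp add: cscale_def)
qed

lemma cscale_zero [simp]: "cscale 0 v = 0"
  by (simp add: cscale_def zero_prod_def)

lemma cscale_of_real: "cscale (complex_of_real c) v = c *\<^sub>R v"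
  by (simp add: cscale_def scaleR_prod_def)

lemma vec_scale: "sq_int f \<Longrightarrow> sq_int (\<lambda>x. a * f x)" "sq_int f \<Longrightarrow> vec (\<lambda>x. a * f x) = cscale a (vec f)"
  using vec_lin[of f f a 0] by simp_all

lemma vec_add:
  assumes "sq_int f" "sq_int g"
  shows "sq_int (\<lambda>x. f x + g x)" "vec (\<lambda>x. f x + g x) = vec f + vec g"
  using vec_lin[OF assms, of 1 1] cscale_of_real[of 1] by simp_all

lemma sq_int_zero: "sq_int (\<lambda>_. 0)"
  by (simp add: sq_int_def)

lemma vec_zero: "vec (\<lambda>_. 0) = 0"
  using vec_scale(2)[OF sq_int_zero, of 0] by simp

lemma vec_sum:
  assumes "finite S" "\<And>a. a \<in> S \<Longrightarrow> sq_int (f a)"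
  shows "sq_int (\<lambda>x. \<Sum>a\<in>S. \<alpha> a * f a x) \<and> vec (\<lambda>x. \<Sum>a\<in>S. \<alpha> a * f a x) = (\<Sum>a\<in>S. cscale (\<alpha> a) (vec (f a)))"
  using assms by (induction S) (simp_all add: sq_int_zero vec_zero vec_add vec_scale)

lemma L2_norm_vec:
  assumes f: "sq_int f"
  shows "L2_norm f = sqrt 2 * norm (vec f)"
proof -
  have s: "sqL (\<lambda>x. Re (f x))" "sqL (\<lambda>x. Im (f x))" using f by (auto simp: sq_int_iff)
  then have i: "integrable lborel (\<lambda>x. (Re (f x))\<^sup>2)" "integrable lborel (\<lambda>x. (Im (f x))\<^sup>2)"
    by (auto simp: sqL_def)
  have "(LINT x|lborel. (cmod (f x))\<^sup>2) = 2 * (norm (vec f))\<^sup>2"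
    unfolding cmod_power2 Bochner_Integration.integral_add[OF i] norm_cl[OF s(1)] norm_cl[OF s(2)]
    by (simp add: vec_def norm_Pair)
  then show ?thesis by (simp add: L2_norm_def real_sqrt_mult)
qed

lemma vec_even:
  assumes g: "sqr g" "\<And>x. g (- x) = g x"
  shows "sq_int (\<lambda>x. complex_of_real (g x))" "vec (\<lambda>x. complex_of_real (g x)) = ((abs_l2 g, 0), 0)"
proof -
  have "integrable lborel (\<lambda>x. (g x)\<^sup>2)"
    using g by (intro lborel_even(1)) (auto simp: sqr_def)
  then have s: "sqL g" using g(1) by (simp add: sqL_def sqr_def)
  then show "sq_int (\<lambda>x. complex_of_real (g x))" by (simp add: sq_int_iff sqL_def)
  have "even_part g = g" "odd_part g = (\<lambda>_. 0)"
    "even_part (\<lambda>_. 0) = (\<lambda>_. 0)" "odd_part (\<lambda>_. 0) = (\<lambda>_. 0)"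
    using g(2) by (auto simp: even_part_def odd_part_def)
  then show "vec (\<lambda>x. complex_of_real (g x)) = ((abs_l2 g, 0), 0)"
    by (simp add: vec_def cl_def zero_prod_def flip: zero_abs_l2)
qed

lemma vec_odd:
  assumes g: "sqr g" "\<And>x. g (- x) = - g x"
  shows "sq_int (\<lambda>x. complex_of_real (g x))" "vec (\<lambda>x. complex_of_real (g x)) = ((0, abs_l2 g), 0)"
proof -
  have "integrable lborel (\<lambda>x. (g x)\<^sup>2)"
    using g by (intro lborel_even(1)) (auto simp: sqr_def)
  then have s: "sqL g" using g(1) by (simp add: sqL_def sqr_def)
  then show "sq_int (\<lambda>x. complex_of_real (g x))" by (simp add: sq_int_iff sqL_def)
  have "odd_part g = g" "even_part g = (\<lambda>_. 0)"
    "even_part (\<lambda>_. 0) = (\<lambda>_. 0)" "odd_part (\<lambda>_. 0) = (\<lambda>_. 0)"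
    using g(2) by (auto simp: even_part_def odd_part_def)
  then show "vec (\<lambda>x. complex_of_real (g x)) = ((0, abs_l2 g), 0)"
    by (simp add: vec_def cl_def zero_prod_def flip: zero_abs_l2)
qed

definition flip_odd :: "vec4 \<Rightarrow> vec4" where
  "flip_odd v = ((fst (fst v), - snd (fst v)), (fst (snd v), - snd (snd v)))"

lemma vec_reflect:
  assumes f: "sq_int f"
  shows "sq_int (\<lambda>x. f (- x))" "vec (\<lambda>x. f (- x)) = flip_odd (vec f)"
proof -
  have s: "sqL (\<lambda>x. Re (f x))" "sqL (\<lambda>x. Im (f x))" using f by (auto simp: sq_int_iff)
  have r: "sqL (\<lambda>x. g (- x))" "cl (\<lambda>x. g (- x)) = (fst (cl g), - snd (cl g))" if g: "sqL g" for g
  proof -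
    have [measurable]: "g \<in> borel_measurable borel" using g by (simp add: sqL_def)
    have "integrable lborel (\<lambda>x. (g (0 + - 1 * x))\<^sup>2)"
      using g by (intro lborel_integrable_real_affine[of "\<lambda>x. (g x)\<^sup>2"]) (auto simp: sqL_def)
    then show "sqL (\<lambda>x. g (- x))" by (simp add: sqL_def)
    have "even_part (\<lambda>x. g (- x)) = even_part g" "odd_part (\<lambda>x. g (- x)) = (\<lambda>x. (-1) * odd_part g x)"
      by (auto simp: even_part_def odd_part_def fun_eq_iff field_simps)
    then show "cl (\<lambda>x. g (- x)) = (fst (cl g), - snd (cl g))"
      using scaleR_abs_l2[OF sqr_odd_part[OF g], of "-1"] by (simp add: cl_def)
  qed
  show "sq_int (\<lambda>x. f (- x))" using r(1)[OF s(1)] r(1)[OF s(2)] by (simp add: sq_int_iff)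
  show "vec (\<lambda>x. f (- x)) = flip_odd (vec f)"
    using r(2)[OF s(1)] r(2)[OF s(2)] by (simp add: vec_def flip_odd_def)
qed

section \<open>The transform in coordinates\<close>

text \<open>This is \<open>A\<close> on even parts and \<open>- i W A\<close> on odd parts; the factor \<open>- i\<close> exchanges the
  coordinates of the real and of the imaginary part.\<close>

definition Phi_vec :: "nat \<Rightarrow> vec4 \<Rightarrow> vec4" where
  "Phi_vec n v = ((cos_op n (fst (fst v)), hilb_op (cos_op n (snd (snd v)))),
     (cos_op n (fst (snd v)), - hilb_op (cos_op n (snd (fst v)))))"

lemma Phi_vec_add: "n \<ge> 1 \<Longrightarrow> Phi_vec n (u + v) = Phi_vec n u + Phi_vec n v"
  by (simp add: Phi_vec_def linear_add[OF cos_op_linear] linear_add[OF hilb_op_linear])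

lemma Phi_vec_cscale: "n \<ge> 1 \<Longrightarrow> Phi_vec n (cscale a v) = cscale a (Phi_vec n v)"
  by (simp add: Phi_vec_def cscale_def linear_add[OF cos_op_linear] linear_add[OF hilb_op_linear]
      linear_diff[OF cos_op_linear] linear_diff[OF hilb_op_linear]
      linear_scale[OF cos_op_linear] linear_scale[OF hilb_op_linear])

lemma Phi_vec_zero: "n \<ge> 1 \<Longrightarrow> Phi_vec n 0 = 0"
  using Phi_vec_cscale[of n 0 0] by simp

lemma Phi_vec_sum:
  "n \<ge> 1 \<Longrightarrow> Phi_vec n (\<Sum>a\<in>S. cscale (\<alpha> a) (v a)) = (\<Sum>a\<in>S. cscale (\<alpha> a) (Phi_vec n (v a)))"
  by (induction S rule: infinite_finite_induct) (simp_all add: Phi_vec_zero Phi_vec_add Phi_vec_cscale)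

lemma norm_cos_op: "n \<ge> 1 \<Longrightarrow> norm (cos_op n x) = norm x"
  by (simp add: norm_eq_sqrt_inner cos_op_inner)

lemma norm_hilb_op: "norm (hilb_op x) = norm x"
  by (simp add: norm_eq_sqrt_inner hilb_op_inner)

lemma norm_Phi_vec: "n \<ge> 1 \<Longrightarrow> norm (Phi_vec n v) = norm v"
  by (simp add: Phi_vec_def norm_prod_def norm_cos_op norm_hilb_op)

text \<open>On even parts A A = 1. On odd parts the square of - i W A is - W A W A, which is - A A =
  -1 by \<open>hilb_cos_hilb\<close>.\<close>

lemma Phi_vec_Phi_vec:
  assumes n: "n \<ge> 1"
  shows "Phi_vec n (Phi_vec n v) = flip_odd v"
proof -
  have "hilb_op (cos_op n (hilb_op (cos_op n x))) = x" for x
    by (simp only: hilb_cos_hilb[OF n] cos_op_cos_op[OF n])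
  then show ?thesis
    using n by (simp add: Phi_vec_def flip_odd_def cos_op_cos_op
        linear_neg[OF cos_op_linear] linear_neg[OF hilb_op_linear])
qed

lemma vec_sym_ind:
  assumes a: "a > 0"
  shows "sq_int (\<lambda>t. complex_of_real (sym_ind a t))"
    and "vec (\<lambda>t. complex_of_real (sym_ind a t)) = ((chi a, 0), 0)"
proof -
  have ae: "AE t in hl. sym_ind a t = indicator {0<..a} t"
    unfolding AE_hl by (intro AE_I2 impI) (use a in \<open>auto simp: sym_ind_def indicator_def\<close>)
  have s: "sqr (sym_ind a)"
    using ae by (intro sqr_bound[OF sqr_Ioc[of a]]) (auto elim: eventually_mono)
  have "abs_l2 (sym_ind a) = chi a"
    unfolding chi_def abs_l2_eq_iff[OF s sqr_Ioc] by (rule ae)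
  then show "sq_int (\<lambda>t. complex_of_real (sym_ind a t))"
    "vec (\<lambda>t. complex_of_real (sym_ind a t)) = ((chi a, 0), 0)"
    using vec_even[OF s sym_ind_minus] by simp_all
qed

lemma vec_ell:
  assumes a: "a > 0"
  shows "sq_int (\<lambda>t. complex_of_real (ell a t / pi))"
    and "vec (\<lambda>t. complex_of_real (ell a t / pi)) = ((0, hilb_op (chi a)), 0)"
  using vec_odd[OF sqr_ell_pi[OF a]] by (simp_all add: ell_minus_right hilb_op_chi[OF a])

lemma cos_int_minus: "cos_int n a (- w) = cos_int n a w"
proof -
  have "c_kernel n (- w * t) = c_kernel n (w * t)" for t
    using c_kernel_minus[of n "w * t"] by simp
  then show ?thesis by (simp only: cos_int_def)
qed

lemma vec_cos_int:
  assumes n: "n \<ge> 1" and a: "a > 0"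
  shows "sq_int (\<lambda>w. complex_of_real (cos_int n a w))"
    and "vec (\<lambda>w. complex_of_real (cos_int n a w)) = ((cos_op n (chi a), 0), 0)"
  using vec_even[OF cos_op_chi(1)[OF n a] cos_int_minus] cos_op_chi(2)[OF n a] by simp_all

lemma vec_sgn_cos_int:
  assumes n: "n \<ge> 1" and a: "a > 0"
  shows "sq_int (\<lambda>w. complex_of_real (sgn w * cos_int n a w))"
    and "vec (\<lambda>w. complex_of_real (sgn w * cos_int n a w)) = ((0, cos_op n (chi a)), 0)"
proof -
  note c = cos_op_chi[OF n a]
  have ae: "AE w in hl. sgn w * cos_int n a w = cos_int n a w"
    unfolding AE_hl by (intro AE_I2 impI) simp
  have m: "(\<lambda>w. sgn w * cos_int n a w) \<in> borel_measurable borel"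
    unfolding sgn_if by measurable
  have s: "sqr (\<lambda>w. sgn w * cos_int n a w)"
    using ae by (intro sqr_bound[OF c(1) m]) (auto elim: eventually_mono)
  have "abs_l2 (\<lambda>w. sgn w * cos_int n a w) = cos_op n (chi a)"
    unfolding c(2) abs_l2_eq_iff[OF s c(1)] by (rule ae)
  moreover have "sgn (- w) * cos_int n a (- w) = - (sgn w * cos_int n a w)" for w
    by (simp add: cos_int_minus sgn_minus)
  ultimately show "sq_int (\<lambda>w. complex_of_real (sgn w * cos_int n a w))"
    "vec (\<lambda>w. complex_of_real (sgn w * cos_int n a w)) = ((0, cos_op n (chi a)), 0)"
    using vec_odd[OF s] by simp_all
qed

lemma c_kernel_sym_ind:
  assumes n: "n \<ge> 1" and a: "a > 0"
  shows "has_bochner_integral lborel (\<lambda>t. c_kernel n (w * t) * sym_ind a t) (cos_int n a w)"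
proof -
  define f where "f t = c_kernel n (w * t) * sym_ind a t" for t
  have fm [measurable]: "f \<in> borel_measurable borel" unfolding f_def[abs_def] by measurable
  have even: "f (- t) = f t" for t
    using c_kernel_minus[of n "w * t"] by (simp add: f_def sym_ind_minus)
  have eq: "indicator {0<..} t *\<^sub>R f t = indicator {0<..a} t * c_kernel n (w * t)" for t
    using a by (auto simp: f_def sym_ind_def indicator_def)
  have "integrable hl f"
    unfolding integrable_hl[OF fm] eq by (rule c_kernel_integrable_interval[OF n])
  moreover have "integral\<^sup>L hl f = cos_int n a w / 2"
    unfolding integral_hl[OF fm] eq by (simp add: cos_int_def)
  ultimately have "integrable lborel f" "integral\<^sup>L lborel f = cos_int n a w"
    using lborel_even[OF fm even] by simp_all
  then show ?thesis by (simp add: has_bochner_integral_iff f_def[abs_def])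
qed

lemma c_kernel_even_step:
  assumes n: "n \<ge> 1" and "finite S" "S \<subseteq> {0<..}" and u: "u \<in> borel_measurable borel"
    "AE t in lborel. u t = (\<Sum>a\<in>S. \<alpha> a * complex_of_real (sym_ind a t))"
  shows "(LINT t|lborel. complex_of_real (c_kernel n (w * t)) * u t)
    = (\<Sum>a\<in>S. \<alpha> a * complex_of_real (cos_int n a w))"
proof -
  have "(LINT t|lborel. complex_of_real (c_kernel n (w * t)) * u t)
      = (LINT t|lborel. (\<Sum>a\<in>S. \<alpha> a * complex_of_real (c_kernel n (w * t) * sym_ind a t)))"
  proof (rule integral_cong_AE)
    show "AE t in lborel. complex_of_real (c_kernel n (w * t)) * u t
        = (\<Sum>a\<in>S. \<alpha> a * complex_of_real (c_kernel n (w * t) * sym_ind a t))"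
      using u(2) by eventually_elim (simp add: sum_distrib_left mult_ac)
  qed (use u(1) in measurable)
  also have "\<dots> = (\<Sum>a\<in>S. \<alpha> a * complex_of_real (cos_int n a w))"
  proof (rule has_bochner_integral_integral_eq)
    show "has_bochner_integral lborel (\<lambda>t. \<Sum>a\<in>S. \<alpha> a * complex_of_real (c_kernel n (w * t) * sym_ind a t))
        (\<Sum>a\<in>S. \<alpha> a * complex_of_real (cos_int n a w))"
      using assms(3)
      by (intro has_bochner_integral_sum has_bochner_integral_mult_right has_bochner_integral_of_real c_kernel_sym_ind n) auto
  qed
  finally show ?thesis .
qed

lemma vec_even_step:
  assumes u: "even_step u S \<alpha>"
  shows "sq_int u" "vec u = (\<Sum>a\<in>S. cscale (\<alpha> a) ((chi a, 0), 0))"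
    and "sq_int (hilbert u)" "vec (hilbert u) = (\<Sum>a\<in>S. cscale (\<alpha> a) ((0, hilb_op (chi a)), 0))"
proof -
  have S: "finite S" "S \<subseteq> {0<..}" "u \<in> borel_measurable borel"
    and ae: "AE t in lborel. u t = (\<Sum>a\<in>S. \<alpha> a * complex_of_real (sym_ind a t))"
    using u by (auto simp: even_step_def)
  have cong: "sq_int f \<and> vec f = vec g" if g: "sq_int g" and f: "f \<in> borel_measurable borel"
    and fg: "AE x in lborel. f x = g x" for f g
  proof -
    have "integrable lborel (\<lambda>x. (cmod (f x))\<^sup>2) \<longleftrightarrow> integrable lborel (\<lambda>x. (cmod (g x))\<^sup>2)"
      using f g fg by (intro integrable_cong_AE) (auto simp: sq_int_def elim: eventually_mono)
    then have "sq_int f" using f g by (simp add: sq_int_def)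
    then show ?thesis using g fg by (simp add: vec_eq_iff)
  qed
  have 1: "sq_int (\<lambda>t. \<Sum>a\<in>S. \<alpha> a * complex_of_real (sym_ind a t)) \<and>
      vec (\<lambda>t. \<Sum>a\<in>S. \<alpha> a * complex_of_real (sym_ind a t)) = (\<Sum>a\<in>S. cscale (\<alpha> a) (vec (\<lambda>t. complex_of_real (sym_ind a t))))"
    using S by (intro vec_sum vec_sym_ind) auto
  have 2: "sq_int (\<lambda>t. \<Sum>a\<in>S. \<alpha> a * complex_of_real (ell a t / pi)) \<and>
      vec (\<lambda>t. \<Sum>a\<in>S. \<alpha> a * complex_of_real (ell a t / pi)) = (\<Sum>a\<in>S. cscale (\<alpha> a) (vec (\<lambda>t. complex_of_real (ell a t / pi))))"
    using S by (intro vec_sum vec_ell) auto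
  have h: "AE x in lborel. hilbert u x = (\<Sum>a\<in>S. \<alpha> a * complex_of_real (ell a x / pi))"
    using AE_abs_notin[OF S(1)] by eventually_elim (rule hilbert_even_step[OF u])
  have s: "(\<Sum>a\<in>S. cscale (\<alpha> a) (vec (\<lambda>t. complex_of_real (sym_ind a t)))) = (\<Sum>a\<in>S. cscale (\<alpha> a) ((chi a, 0), 0))"
    "(\<Sum>a\<in>S. cscale (\<alpha> a) (vec (\<lambda>t. complex_of_real (ell a t / pi)))) = (\<Sum>a\<in>S. cscale (\<alpha> a) ((0, hilb_op (chi a)), 0))"
    using S(2) by (auto intro!: sum.cong simp: vec_sym_ind vec_ell simp del: of_real_divide)
  show "sq_int u" "vec u = (\<Sum>a\<in>S. cscale (\<alpha> a) ((chi a, 0), 0))"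
    using cong[OF conjunct1[OF 1] S(3) ae] 1 unfolding s by simp_all
  show "sq_int (hilbert u)" "vec (hilbert u) = (\<Sum>a\<in>S. cscale (\<alpha> a) ((0, hilb_op (chi a)), 0))"
    using cong[OF conjunct1[OF 2] hilbert_even_step_measurable[OF u] h] 2 unfolding s by simp_all
qed

text \<open>By W A W = A the odd function W (chi a) goes to - i A (chi a). This is the value
  prescribed on D_j, where the double Hilbert transform contributes the minus sign.\<close>

lemma Phi_vec_chi:
  assumes n: "n \<ge> 1"
  shows "Phi_vec n ((chi a, 0), 0) = ((cos_op n (chi a), 0), 0)"
    and "Phi_vec n ((0, hilb_op (chi a)), 0) = cscale (- \<i>) ((0, cos_op n (chi a)), 0)"
  using n by (simp_all add: Phi_vec_def cscale_def zero_prod_def linear_0[OF cos_op_linear]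
      linear_0[OF hilb_op_linear] hilb_cos_hilb)

lemma Phi_on_D_vec:
  assumes n: "n \<ge> 1" and u: "even_step u S \<alpha>" and v: "even_step v S' \<beta>"
  shows "sq_int (\<lambda>t. u t + hilbert v t)" "sq_int (Phi_on_D n u v)"
    and "vec (Phi_on_D n u v) = Phi_vec n (vec (\<lambda>t. u t + hilbert v t))"
proof -
  have S: "finite S" "S \<subseteq> {0<..}" and S': "finite S'" "S' \<subseteq> {0<..}"
    using u v by (auto simp: even_step_def)
  have "Phi_on_D n u v w = (\<Sum>a\<in>S. \<alpha> a * complex_of_real (cos_int n a w))
      + (\<Sum>a\<in>S'. (- \<i> * \<beta> a) * complex_of_real (sgn w * cos_int n a w))" for w
  proof -
    have "(LINT t|lborel. complex_of_real (c_kernel n (w * t)) * u t) = (\<Sum>a\<in>S. \<alpha> a * complex_of_real (cos_int n a w))"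
      using u by (intro c_kernel_even_step n) (auto simp: even_step_def)
    \<comment> \<open>The double transform of \<open>v\<close> is \<open>- v\<close> almost
      everywhere, so the coefficients change sign.\<close>
    moreover have "(LINT t|lborel. complex_of_real (c_kernel n (w * t)) * hilbert (hilbert v) t)
        = (\<Sum>a\<in>S'. (- \<beta> a) * complex_of_real (cos_int n a w))"
      using hilbert_hilbert_even_step[OF v] by (intro c_kernel_even_step n S') (auto simp: sum_negf)
    ultimately show ?thesis
      unfolding Phi_on_D_def by (simp add: sum_distrib_left mult_ac)
  qed
  then have eq: "Phi_on_D n u v = (\<lambda>w. (\<Sum>a\<in>S. \<alpha> a * complex_of_real (cos_int n a w))
      + (\<Sum>a\<in>S'. (- \<i> * \<beta> a) * complex_of_real (sgn w * cos_int n a w)))" by blast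
  have 1: "sq_int (\<lambda>w. \<Sum>a\<in>S. \<alpha> a * complex_of_real (cos_int n a w)) \<and>
      vec (\<lambda>w. \<Sum>a\<in>S. \<alpha> a * complex_of_real (cos_int n a w)) = (\<Sum>a\<in>S. cscale (\<alpha> a) (vec (\<lambda>w. complex_of_real (cos_int n a w))))"
    using S by (intro vec_sum vec_cos_int n) auto
  have 2: "sq_int (\<lambda>w. \<Sum>a\<in>S'. (- \<i> * \<beta> a) * complex_of_real (sgn w * cos_int n a w)) \<and>
      vec (\<lambda>w. \<Sum>a\<in>S'. (- \<i> * \<beta> a) * complex_of_real (sgn w * cos_int n a w))
        = (\<Sum>a\<in>S'. cscale (- \<i> * \<beta> a) (vec (\<lambda>w. complex_of_real (sgn w * cos_int n a w))))"
    using S' by (intro vec_sum vec_sgn_cos_int n) auto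
  have comp: "cscale (- \<i> * c) x = cscale c (cscale (- \<i>) x)" for c x
    by (simp add: cscale_def algebra_simps)
  note ue = vec_even_step[OF u] and ve = vec_even_step[OF v]
  show "sq_int (\<lambda>t. u t + hilbert v t)" by (rule vec_add(1)[OF ue(1) ve(3)])
  show "sq_int (Phi_on_D n u v)" unfolding eq using 1 2 by (intro vec_add(1)) blast+
  have "vec (Phi_on_D n u v) = (\<Sum>a\<in>S. cscale (\<alpha> a) (vec (\<lambda>w. complex_of_real (cos_int n a w))))
      + (\<Sum>a\<in>S'. cscale (- \<i> * \<beta> a) (vec (\<lambda>w. complex_of_real (sgn w * cos_int n a w))))"
    unfolding eq using 1 2 by (simp only: vec_add(2) simp_thms)
  also have "\<dots> = (\<Sum>a\<in>S. cscale (\<alpha> a) (Phi_vec n ((chi a, 0), 0)))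
      + (\<Sum>a\<in>S'. cscale (\<beta> a) (Phi_vec n ((0, hilb_op (chi a)), 0)))"
    unfolding comp Phi_vec_chi[OF n]
  proof (intro arg_cong2[where f = "(+)"] sum.cong refl)
    fix a assume "a \<in> S"
    then have "a > 0" using S(2) by auto
    then show "cscale (\<alpha> a) (vec (\<lambda>w. complex_of_real (cos_int n a w))) = cscale (\<alpha> a) ((cos_op n (chi a), 0), 0)"
      by (simp only: vec_cos_int(2)[OF n])
  next
    fix a assume "a \<in> S'"
    then have "a > 0" using S'(2) by auto
    then show "cscale (\<beta> a) (cscale (- \<i>) (vec (\<lambda>w. complex_of_real (sgn w * cos_int n a w))))
        = cscale (\<beta> a) (cscale (- \<i>) ((0, cos_op n (chi a)), 0))"
      by (simp only: vec_sgn_cos_int(2)[OF n])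
  qed
  also have "\<dots> = Phi_vec n (vec (\<lambda>t. u t + hilbert v t))"
    unfolding vec_add(2)[OF ue(1) ve(3)] ue(2) ve(4) Phi_vec_add[OF n] Phi_vec_sum[OF n] ..
  finally show "vec (Phi_on_D n u v) = Phi_vec n (vec (\<lambda>t. u t + hilbert v t))" .
qed

text \<open>The witness that gives the choice operator in \<open>Phi\<close> its meaning.\<close>

lemma is_Phi_exists:
  assumes n: "n \<ge> 1"
  shows "is_Phi n (\<lambda>f. fn (Phi_vec n (vec f)))"
  unfolding is_Phi_def
proof (intro conjI allI impI)
  fix f g :: "real \<Rightarrow> complex" and a b
  assume fg: "sq_int f \<and> sq_int g"
  let ?T = "\<lambda>f. fn (Phi_vec n (vec f))"
  have "vec (?T (\<lambda>x. a * f x + b * g x)) = vec (\<lambda>w. a * ?T f w + b * ?T g w)"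
    using fg n by (simp add: vec_fn vec_lin sq_int_fn Phi_vec_add Phi_vec_cscale)
  then show "AE w in lborel. ?T (\<lambda>x. a * f x + b * g x) w = a * ?T f w + b * ?T g w"
    by (subst (asm) vec_eq_iff) (auto intro: sq_int_fn vec_lin(1))
next
  show "\<exists>C. \<forall>f. sq_int f \<longrightarrow> L2_norm (fn (Phi_vec n (vec f))) \<le> C * L2_norm f"
    using n by (intro exI[of _ 1]) (auto simp: L2_norm_vec sq_int_fn vec_fn norm_Phi_vec)
next
  fix j u v assume uv: "u \<in> V_plus j \<and> v \<in> V_plus j"
  obtain S \<alpha> where u: "even_step u S \<alpha>" using uv V_plus_even_step by blast
  obtain S' \<beta> where v: "even_step v S' \<beta>" using uv V_plus_even_step by blast
  note * = Phi_on_D_vec[OF n u v]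
  have "vec (fn (Phi_vec n (vec (\<lambda>t. u t + hilbert v t)))) = vec (Phi_on_D n u v)"
    by (simp only: vec_fn *(3))
  then show "AE w in lborel. fn (Phi_vec n (vec (\<lambda>t. u t + hilbert v t))) w = Phi_on_D n u v w"
    by (subst (asm) vec_eq_iff) (auto intro: sq_int_fn *(2))
next
  fix f g :: "real \<Rightarrow> complex"
  assume "sq_int f \<and> sq_int g \<and> (AE x in lborel. f x = g x)"
  then have "vec f = vec g" by (simp add: vec_eq_iff)
  then show "AE w in lborel. fn (Phi_vec n (vec f)) w = fn (Phi_vec n (vec g)) w" by simp
qed (rule sq_int_fn)

section \<open>Uniqueness of the bounded extension and the inversion formula\<close>

lemma dist_chi: "a > 0 \<Longrightarrow> b > 0 \<Longrightarrow> (dist (chi a) (chi b))\<^sup>2 = \<bar>a - b\<bar>"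
  by (simp add: dist_norm power2_norm_eq_inner inner_diff_left inner_diff_right inner_chi_chi min_def)

text \<open>The map \<open>chi\<close> is continuous by \<open>dist_chi\<close>, so dyadic endpoints
  suffice; these are the ones realised by \<open>sym_ind_dyadic\<close>.\<close>

lemma dense_chi_dyadic: "closure (span {chi (real m / 2 ^ j) | m j :: nat. m > 0}) = UNIV"
proof -
  define K where "K = closure (span {chi (real m / 2 ^ j) | m j :: nat. m > 0})"
  have sub: "subspace K" unfolding K_def by (intro subspace_closure subspace_span)
  have cl: "closed K" by (simp add: K_def)
  have dy: "chi (real m / 2 ^ j) \<in> K" if "m > 0" for m j :: nat
    unfolding K_def using that by (intro closure_subset[THEN subsetD] span_base) auto
  have "chi a \<in> K" if a: "a > 0" for a
  proof -
    \<comment> \<open>Rounding above the floor keeps \<open>m j\<close> positive even while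
      \<open>a * 2 ^ j\<close> is below 1.\<close>
    define m where "m j = nat (\<lfloor>a * 2 ^ j\<rfloor> + 1)" for j :: nat
    have m: "m j > 0" "\<bar>real (m j) / 2 ^ j - a\<bar> \<le> (1/2) ^ j" for j
    proof -
      have nn: "0 \<le> \<lfloor>a * 2 ^ j\<rfloor>" using a by simp
      then show "m j > 0" by (simp add: m_def)
      have "real (m j) = real_of_int \<lfloor>a * 2 ^ j\<rfloor> + 1" using nn by (simp add: m_def)
      then have "\<bar>real (m j) - a * 2 ^ j\<bar> \<le> 1" by linarith
      then have "\<bar>real (m j) - a * 2 ^ j\<bar> / 2 ^ j \<le> 1 / 2 ^ j" by (intro divide_right_mono) auto
      moreover have "real (m j) / 2 ^ j - a = (real (m j) - a * 2 ^ j) / 2 ^ j"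
        by (simp add: diff_divide_distrib)
      ultimately show "\<bar>real (m j) / 2 ^ j - a\<bar> \<le> (1/2) ^ j"
        by (simp add: abs_divide power_one_over)
    qed
    have lim: "(\<lambda>j. (dist (chi (real (m j) / 2 ^ j)) (chi a))\<^sup>2) \<longlonglongrightarrow> 0"
    proof (rule Lim_null_comparison)
      show "\<forall>\<^sub>F j in sequentially. norm ((dist (chi (real (m j) / 2 ^ j)) (chi a))\<^sup>2) \<le> (1/2) ^ j"
        using m a by (intro always_eventually allI) (subst dist_chi, auto)
      show "(\<lambda>j. (1/2 :: real) ^ j) \<longlonglongrightarrow> 0" by (intro LIMSEQ_power_zero) simp
    qed
    show ?thesis by (rule closed_sequentially[OF cl _ tendsto_dist_power2[OF lim]]) (rule dy[OF m(1)])
  qed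
  then have "x \<in> K" for x
    by (rule closed_subspace_l2_UNIV[OF sub cl])
  then show ?thesis by (auto simp: K_def)
qed

text \<open>The range of \<open>hilb_op\<close> is everything since \<open>W A W A = 1\<close>, so the values prescribed on the
  spaces \<open>D\<^sub>j\<close> determine a bounded operator.\<close>

lemma is_Phi_vec:
  assumes n: "n \<ge> 1" and T: "is_Phi n T" and f: "sq_int f"
  shows "vec (T f) = Phi_vec n (vec f)"
proof -
  have T1: "\<And>f. sq_int f \<Longrightarrow> sq_int (T f)"
    and T2: "\<And>f g. sq_int f \<Longrightarrow> sq_int g \<Longrightarrow> AE x in lborel. f x = g x \<Longrightarrow> AE w in lborel. T f w = T g w"
    and T3: "\<And>f g a b. sq_int f \<Longrightarrow> sq_int g \<Longrightarrow> AE w in lborel. T (\<lambda>x. a * f x + b * g x) w = a * T f w + b * T g w"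
    and T4: "\<exists>C. \<forall>f. sq_int f \<longrightarrow> L2_norm (T f) \<le> C * L2_norm f"
    and T5: "\<And>j u v. u \<in> V_plus j \<Longrightarrow> v \<in> V_plus j \<Longrightarrow> AE w in lborel. T (\<lambda>t. u t + hilbert v t) w = Phi_on_D n u v w"
    using T unfolding is_Phi_def by blast+
  obtain C where C: "\<And>f. sq_int f \<Longrightarrow> L2_norm (T f) \<le> C * L2_norm f" using T4 by blast
  \<comment> \<open>The operator \<open>T\<close> carried over to coordinates. That it does not
    depend on the chosen representatives is \<open>B_vec\<close>, from the compatibility of
    \<open>T\<close> with almost everywhere equality.\<close>
  define B where "B v = vec (T (fn v))" for v
  have B_vec: "B (vec f) = vec (T f)" if "sq_int f" for f
    unfolding B_def using T2[OF sq_int_fn that fn_vec[OF that]] T1 that sq_int_fn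
    by (simp add: vec_eq_iff)
  have B_lin: "B (cscale a u + cscale b v) = cscale a (B u) + cscale b (B v)" for a b u v
  proof -
    define h where "h = (\<lambda>x. a * fn u x + b * fn v x)"
    have h: "sq_int h" "vec h = cscale a u + cscale b v"
      unfolding h_def by (simp_all add: vec_lin sq_int_fn vec_fn)
    have "B (cscale a u + cscale b v) = vec (T h)"
      using B_vec[OF h(1)] by (simp only: h(2))
    also have "\<dots> = vec (\<lambda>w. a * T (fn u) w + b * T (fn v) w)"
      using T3[OF sq_int_fn sq_int_fn, of a u b v] h(1)
      by (subst vec_eq_iff) (auto simp: h_def intro: T1 sq_int_fn vec_lin(1))
    also have "\<dots> = cscale a (B u) + cscale b (B v)"
      unfolding B_def by (intro vec_lin(2) T1 sq_int_fn)
    finally show ?thesis .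
  qed
  have B_add: "B (u + v) = B u + B v" for u v
    using B_lin[of 1 u 1 v] cscale_of_real[of 1] by simp
  have B_cscale: "B (cscale a u) = cscale a (B u)" for a u
    using B_lin[of a u 0 u] by simp
  have B: "bounded_linear B"
  proof (rule bounded_linear_intro[where K = C])
    show "B (u + v) = B u + B v" for u v by (rule B_add)
    show "B (c *\<^sub>R u) = c *\<^sub>R B u" for c u
      using B_cscale[of "complex_of_real c" u] by (simp only: cscale_of_real)
    show "norm (B u) \<le> norm u * C" for u
    proof -
      have "sqrt 2 * norm (B u) \<le> C * (sqrt 2 * norm u)"
        using C[OF sq_int_fn, of u] by (simp add: L2_norm_vec T1 sq_int_fn vec_fn B_def)
      then have "sqrt 2 * norm (B u) \<le> sqrt 2 * (norm u * C)" by (simp add: mult_ac)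
      then show ?thesis by simp
    qed
  qed
  have P: "bounded_linear (Phi_vec n)"
  proof (rule bounded_linear_intro[where K = 1])
    show "Phi_vec n (u + v) = Phi_vec n u + Phi_vec n v" for u v by (rule Phi_vec_add[OF n])
    show "Phi_vec n (c *\<^sub>R u) = c *\<^sub>R Phi_vec n u" for c u
      using Phi_vec_cscale[OF n, of "complex_of_real c" u] by (simp only: cscale_of_real)
  qed (simp add: norm_Phi_vec[OF n])
  have agree: "B ((chi (real m / 2 ^ j), 0), 0) = Phi_vec n ((chi (real m / 2 ^ j), 0), 0) \<and>
      B ((0, hilb_op (chi (real m / 2 ^ j))), 0) = Phi_vec n ((0, hilb_op (chi (real m / 2 ^ j))), 0)"
    if m: "m > 0" for m j :: nat
  proof -
    define a where "a = real m / 2 ^ j"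
    have a: "a > 0" using m by (simp add: a_def)
    obtain u where u: "u \<in> V_plus (int j)" "AE t in lborel. u t = complex_of_real (sym_ind a t)"
      "u \<in> borel_measurable borel"
      unfolding a_def by (rule sym_ind_dyadic[OF m])
    have us: "even_step u {a} (\<lambda>_. 1)"
      using u a by (simp add: even_step_def)
    have z: "(\<lambda>_. 0) \<in> V_plus (int j)"
      unfolding V_plus_def V_space_def by (auto intro!: exI[of _ "{}"])
    have c1: "cscale 1 v = v" for v using cscale_of_real[of 1 v] by simp
    have hz: "hilbert (\<lambda>_. 0) = (\<lambda>_. 0)"
      using hilbert_eq[OF has_hilbert_zero] by (simp add: fun_eq_iff)
    have key: "B (vec (\<lambda>t. p t + hilbert q t)) = Phi_vec n (vec (\<lambda>t. p t + hilbert q t))"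
      if "even_step p S \<alpha>" "even_step q S' \<beta>" "p \<in> V_plus (int j)" "q \<in> V_plus (int j)" for p q S S' \<alpha> \<beta>
    proof -
      note * = Phi_on_D_vec[OF n that(1,2)]
      have "vec (T (\<lambda>t. p t + hilbert q t)) = vec (Phi_on_D n p q)"
        using T5[OF that(3,4)] by (simp add: vec_eq_iff T1 *(1,2))
      then show ?thesis by (simp only: B_vec[OF *(1)] *(3))
    qed
    \<comment> \<open>Combining \<open>u\<close> with 0 in either order separates the even function
      from the Hilbert transform.\<close>
    show ?thesis
      using key[OF us even_step_zero u(1) z] key[OF even_step_zero us z u(1)] vec_even_step[OF us]
      by (simp add: hz c1 a_def)
  qed
  have emb: "bounded_linear (\<lambda>p :: l2. ((p, 0 :: l2), (0 :: l2 \<times> l2)))" "bounded_linear (\<lambda>q :: l2. ((0 :: l2, q), (0 :: l2 \<times> l2)))"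
    by (intro bounded_linear_Pair bounded_linear_ident bounded_linear_zero)+
  have 1: "B ((p, 0), 0) = Phi_vec n ((p, 0), 0)" for p
    by (rule bounded_linear_eq_on_dense[OF dense_chi_dyadic, where f = "\<lambda>p. B ((p, 0), 0)" and g = "\<lambda>p. Phi_vec n ((p, 0), 0)"])
      (use agree in \<open>auto intro!: bounded_linear_compose[OF B emb(1)] bounded_linear_compose[OF P emb(1)]\<close>)
  have 2: "B ((0, hilb_op p), 0) = Phi_vec n ((0, hilb_op p), 0)" for p
  proof (rule bounded_linear_eq_on_dense[OF dense_chi_dyadic, where f = "\<lambda>p. B ((0, hilb_op p), 0)" and g = "\<lambda>p. Phi_vec n ((0, hilb_op p), 0)"])
    note e = bounded_linear_compose[OF emb(2) hilb_op_bounded_linear]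
    show "bounded_linear (\<lambda>p. B ((0, hilb_op p), 0))" by (rule bounded_linear_compose[OF B e])
    show "bounded_linear (\<lambda>p. Phi_vec n ((0, hilb_op p), 0))" by (rule bounded_linear_compose[OF P e])
  qed (use agree in auto)
  have 3: "B ((0, q), 0) = Phi_vec n ((0, q), 0)" for q
    using 2[of "cos_op n (hilb_op (cos_op n q))"] by (simp only: hilb_cos_hilb[OF n] cos_op_cos_op[OF n])
  have 4: "B (x, 0) = Phi_vec n (x, 0)" for x
  proof -
    have x: "(x, 0) = ((fst x, 0), 0) + ((0, snd x), 0 :: l2 \<times> l2)" by simp
    show ?thesis by (subst (1 2) x) (simp only: B_add Phi_vec_add[OF n] 1 3)
  qed
  have "B v = Phi_vec n v" for v
  proof -
    \<comment> \<open>The imaginary coordinates are i times real ones, so complex linearity of both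
      operators reduces the claim to real functions.\<close>
    have v: "v = (fst v, 0) + cscale \<i> (snd v, 0)" by (simp add: cscale_def prod_eq_iff)
    show ?thesis by (subst (1 2) v) (simp only: B_add Phi_vec_add[OF n] B_cscale Phi_vec_cscale[OF n] 4)
  qed
  then show ?thesis using B_vec[OF f] by simp
qed

lemma is_Phi_Phi: "n \<ge> 1 \<Longrightarrow> is_Phi n (Phi n)"
  unfolding Phi_def by (rule someI[of "is_Phi n"]) (rule is_Phi_exists)

theorem Phi_Phi:
  assumes n: "n \<ge> 1" and f: "sq_int f"
  shows "AE w in lborel. Phi n (Phi n f) w = f (- w)"
proof -
  note P = is_Phi_Phi[OF n]
  have "\<forall>f. sq_int f \<longrightarrow> sq_int (Phi n f)"
    using P unfolding is_Phi_def by (rule conjunct1)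
  then have s: "sq_int (Phi n f)" "sq_int (Phi n (Phi n f))"
    using f by simp_all
  have "vec (Phi n (Phi n f)) = vec (\<lambda>x. f (- x))"
    by (simp only: is_Phi_vec[OF n P s(1)] is_Phi_vec[OF n P f] Phi_vec_Phi_vec[OF n] vec_reflect(2)[OF f])
  then show ?thesis using vec_eq_iff[OF s(2) vec_reflect(1)[OF f]] by simp
qed

text \<open>For each \<tau> the function obtained from the operator is fixed only up to a null set,
  so its value at -t along varying \<tau> has no meaning by itself. It is read through a jointly
  measurable version \<open>F\<close>: one exists, and the formula holds for every such
  version.\<close>

theorem theorem5:
  fixes n :: nat and g h :: "real \<Rightarrow> complex"
  assumes "n \<ge> 1"
    and "sq_int g" and "sq_int h"
    and "\<not> (AE x in lborel. g x = 0)"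
    and "\<forall>t. sq_int (\<lambda>t'. g (t' - t) * h t')"
  shows "(\<exists>F. F \<in> borel_measurable (lborel \<Otimes>\<^sub>M lborel) \<and>
            (AE \<tau> in lborel. AE \<omega> in lborel.
               F (\<omega>, \<tau>) = Phi n (\<lambda>\<omega>'. STPhi n g h \<omega>' \<tau>) \<omega>)) \<and>
         (\<forall>F. F \<in> borel_measurable (lborel \<Otimes>\<^sub>M lborel) \<and>
            (AE \<tau> in lborel. AE \<omega> in lborel.
               F (\<omega>, \<tau>) = Phi n (\<lambda>\<omega>'. STPhi n g h \<omega>' \<tau>) \<omega>)
          \<longrightarrow> (AE t in lborel.
                h t = (1 / L2_inner g g) *
                      (LINT \<tau>|lborel. cnj (g (t - \<tau>)) * F (- t, \<tau>))))"
proof -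
  have [measurable]: "g \<in> borel_measurable borel" "h \<in> borel_measurable borel"
    and gi: "integrable lborel (\<lambda>x. (cmod (g x))\<^sup>2)"
    using assms(2,3) by (auto simp: sq_int_def)
  have key: "AE \<omega> in lborel. Phi n (\<lambda>\<omega>'. STPhi n g h \<omega>' \<tau>) \<omega> = g (- \<omega> - \<tau>) * h (- \<omega>)" for \<tau>
  proof -
    have "(\<lambda>\<omega>'. STPhi n g h \<omega>' \<tau>) = Phi n (\<lambda>t'. g (t' - \<tau>) * h t')"
      by (simp add: STPhi_def)
    then show ?thesis
      using Phi_Phi[OF assms(1), of "\<lambda>t'. g (t' - \<tau>) * h t'"] assms(5) by simp
  qed
  define I where "I = (LINT x|lborel. (cmod (g x))\<^sup>2)"
  have sq: "z * cnj z = complex_of_real ((cmod z)\<^sup>2)" for z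
    by (simp only: complex_norm_square)
  have inner: "L2_inner g g = complex_of_real I"
    unfolding L2_inner_def I_def sq by (rule integral_complex_of_real)
  have "I \<noteq> 0"
  proof
    assume "I = 0"
    then have "AE x in lborel. (cmod (g x))\<^sup>2 = 0"
      unfolding I_def using gi by (subst (asm) integral_nonneg_eq_0_iff_AE) auto
    with assms(4) show False by simp
  qed
  show ?thesis
  proof (intro conjI allI impI)
    show "\<exists>F. F \<in> borel_measurable (lborel \<Otimes>\<^sub>M lborel) \<and>
        (AE \<tau> in lborel. AE \<omega> in lborel. F (\<omega>, \<tau>) = Phi n (\<lambda>\<omega>'. STPhi n g h \<omega>' \<tau>) \<omega>)"
    \<comment> \<open>The witness is the reflection of the windowed function, which is what
      \<open>Phi_Phi\<close> yields for each fixed \<tau>.\<close>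
    proof (intro exI[of _ "\<lambda>p. g (- fst p - snd p) * h (- fst p)"] conjI)
      show "(\<lambda>p. g (- fst p - snd p) * h (- fst p)) \<in> borel_measurable (lborel \<Otimes>\<^sub>M lborel)"
        by measurable
      show "AE \<tau> in lborel. AE \<omega> in lborel. g (- fst (\<omega>, \<tau>) - snd (\<omega>, \<tau>)) * h (- fst (\<omega>, \<tau>)) = Phi n (\<lambda>\<omega>'. STPhi n g h \<omega>' \<tau>) \<omega>"
      proof (rule AE_I2)
        fix \<tau> :: real
        show "AE \<omega> in lborel. g (- fst (\<omega>, \<tau>) - snd (\<omega>, \<tau>)) * h (- fst (\<omega>, \<tau>)) = Phi n (\<lambda>\<omega>'. STPhi n g h \<omega>' \<tau>) \<omega>"
          using key[of \<tau>] by eventually_elim simp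
      qed
    qed
  next
    fix F assume F: "F \<in> borel_measurable (lborel \<Otimes>\<^sub>M lborel) \<and>
        (AE \<tau> in lborel. AE \<omega> in lborel. F (\<omega>, \<tau>) = Phi n (\<lambda>\<omega>'. STPhi n g h \<omega>' \<tau>) \<omega>)"
    then have Fm [measurable]: "F \<in> borel_measurable (lborel \<Otimes>\<^sub>M lborel)" by simp
    have "AE \<tau> in lborel. AE \<omega> in lborel. F (\<omega>, \<tau>) = g (- \<omega> - \<tau>) * h (- \<omega>)"
      using conjunct2[OF F]
    proof eventually_elim
      case (elim \<tau>)
      then show ?case using key[of \<tau>] by eventually_elim simp
    qed
    \<comment> \<open>Here joint measurability of \<open>F\<close> matters: the exceptional set is a
      measurable null set of the plane, so the order of the two quantifiers can be
      exchanged.\<close>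
    then have "AE \<omega> in lborel. AE \<tau> in lborel. F (\<omega>, \<tau>) = g (- \<omega> - \<tau>) * h (- \<omega>)"
      by (subst lborel_pair.AE_commute) measurable
    then have "AE t in lborel. AE \<tau> in lborel. F (- t, \<tau>) = g (t - \<tau>) * h t"
      using AE_lborel_uminus[of "\<lambda>\<omega>. AE \<tau> in lborel. F (\<omega>, \<tau>) = g (- \<omega> - \<tau>) * h (- \<omega>)"] by simp
    then show "AE t in lborel. h t = (1 / L2_inner g g) * (LINT \<tau>|lborel. cnj (g (t - \<tau>)) * F (- t, \<tau>))"
    proof eventually_elim
      case (elim t)
      have [measurable]: "cnj \<in> borel_measurable borel"
        by (intro borel_measurable_continuous_onI continuous_intros)
      have "(LINT \<tau>|lborel. cnj (g (t - \<tau>)) * F (- t, \<tau>)) = (LINT \<tau>|lborel. complex_of_real ((cmod (g (t - \<tau>)))\<^sup>2) * h t)"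
      proof (rule integral_cong_AE)
        show "AE \<tau> in lborel. cnj (g (t - \<tau>)) * F (- t, \<tau>) = complex_of_real ((cmod (g (t - \<tau>)))\<^sup>2) * h t"
          using elim
        proof eventually_elim
          case (elim \<tau>)
          then show ?case unfolding sq[symmetric] by (simp add: mult_ac)
        qed
      qed measurable
      also have "\<dots> = complex_of_real (LINT \<tau>|lborel. (cmod (g (t - \<tau>)))\<^sup>2) * h t"
        by (simp only: integral_mult_left_zero integral_complex_of_real)
      also have "(LINT \<tau>|lborel. (cmod (g (t - \<tau>)))\<^sup>2) = I"
        using lborel_integral_real_affine[of "-1" "\<lambda>x. (cmod (g x))\<^sup>2" t] by (simp add: I_def)
      finally show ?case
        using \<open>I \<noteq> 0\<close> by (simp add: inner)
    qed
  qed
qed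

end
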